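(* Let $G=\mathrm{GO}_{2n}$ over $\mathbb F_q$. Fix a character $\chi\colon P\to\mathbb C^\times$, written as $\chi=(\alpha\circ m)(\beta\circ\chi_{\det})$ with characters $\alpha,\beta\colon\mathbb F_q^\times\to\mathbb C^\times$. Assume that $\beta^2=1$ but $\beta\ne1$. (a) If $n=2m$ is even, then the operator $I\circ I$ on $\operatorname{Ind}_P^G\chi$ is diagonalizable and has eigenvalues $$\left\{q^{2m(m-1)+2i^2}:0\le i\le m\right\}.$$ (b) If $n=2m+1$ is odd, then the operator $I\circ I$ on $\operatorname{Ind}_P^G\chi$ is diagonalizable and has eigenvalues $$\left\{q^{2m^2+2i(i+1)}:0\le i\le m\right\}.$$
   Context: $q$ is an odd prime power with $3\nmid q$, and $n\ge1$. $J=\begin{bmatrix}0&1_n\\1_n&0\end{bmatrix}$. $\mathrm{GO}_{2n}$ consists of $g\in\mathrm{GL}_{2n}(\mathbb F_q)$ with $g^\intercal Jg=\lambda J$ for some $\lambda\in\mathbb F_q^\times$. $P=\left\{\begin{bmatrix}A&B\\0&D\end{bmatrix}\in G\right\}$ with $n\times n$ blocks, and $U=\left\{\begin{bmatrix}1_n&B\\0&1_n\end{bmatrix}\in G\right\}$. $\chi_{\det}\colon P\to\mathbb F_q^\times$ is $\begin{bmatrix}A&B\\0&D\end{bmatrix}\mapsto(\det D)^{-1}$, and $m\colon P\to\mathbb F_q^\times$ is $\begin{bmatrix}\lambda A&B\\0&A^{-\intercal}\end{bmatrix}\mapsto\lambda$. (Every character of $P$ has the form $(\alpha\circ m)(\beta\circ\chi_{\det})$;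 the map $m$ should not be confused with the integer $m$ in (a), (b).) The character $\chi^J$ is $\chi^J\left(\begin{bmatrix}A&B\\0&D\end{bmatrix}\right)=\chi\left(\begin{bmatrix}D&0\\0&A\end{bmatrix}\right)$, and $(\chi^J)^J=\chi$. $\operatorname{Ind}_P^G\chi$ is the space of functions $f\colon G\to\mathbb C$ with $f(pg)=\chi(p)f(g)$ for $p\in P$, $g\in G$. The formula $(If)(g)=\sum_{u\in U}f(J^{-1}ug)$ defines maps $\operatorname{Ind}_P^G\chi\to\operatorname{Ind}_P^G\chi^J$ and $\operatorname{Ind}_P^G\chi^J\to\operatorname{Ind}_P^G\chi$, both denoted $I$; $I\circ I$ is their composite. *)

theory Defs
  imports
    Complex_Main
    "HOL-Library.Function_Algebras"
    "HOL-Library.FuncSet"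
    "HOL-Library.Cardinality"
    "HOL-Algebra.Group"
    "Jordan_Normal_Form.Matrix"
    "Jordan_Normal_Form.Determinant"
begin

section \<open>Groups\<close>

definition mult_grp :: "'a::field monoid" where
  "mult_grp = \<lparr>carrier = - {0}, mult = (*), one = 1\<rparr>"

text \<open>Multiplicative characters of a finite field, i.e. homomorphisms into the nonzero complex
  numbers. Values outside the unit group are unconstrained.\<close>

abbreviation mult_characters :: "('a::field \<Rightarrow> complex) set" where
  "mult_characters \<equiv> hom mult_grp mult_grp"

definition GL :: "nat \<Rightarrow> 'a::field mat monoid" where
  "GL n = units_of (ring_mat TYPE('a) n ())"

definition J_mat :: "nat \<Rightarrow> 'a::field mat" where
  "J_mat n = four_block_mat (0\<^sub>m n n) (1\<^sub>m n) (1\<^sub>m n) (0\<^sub>m n n)"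

text \<open>The argument is half the size of the matrices: \<^term>\<open>GO n\<close> is the group of orthogonal
  similitudes of a space of dimension \<^term>\<open>2 * n\<close>.\<close>

definition GO :: "nat \<Rightarrow> 'a::field mat monoid" where
  "GO n = (GL (2 * n))
     \<lparr>carrier := {g \<in> carrier (GL (2 * n)).
        \<exists>l. l \<noteq> 0 \<and> transpose_mat g * J_mat n * g = l \<cdot>\<^sub>m J_mat n}\<rparr>"

definition parabolic :: "nat \<Rightarrow> 'a::field mat set" where
  "parabolic n = {g \<in> carrier (GO n).
     \<exists>A B D. A \<in> carrier_mat n n \<and> B \<in> carrier_mat n n \<and> D \<in> carrier_mat n n
       \<and> g = four_block_mat A B (0\<^sub>m n n) D}"

definition unip_radical :: "nat \<Rightarrow> 'a::field mat set" where
  "unip_radical n = {g \<in> carrier (GO n).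
     \<exists>B. B \<in> carrier_mat n n \<and> g = four_block_mat (1\<^sub>m n) B (0\<^sub>m n n) (1\<^sub>m n)}"

section \<open>Characters of the parabolic subgroup\<close>

definition chi_det :: "nat \<Rightarrow> 'a::field mat \<Rightarrow> 'a" where
  "chi_det n p = (case split_block p n n of (A, B, C, D) \<Rightarrow> inverse (det D))"

text \<open>The scalar below is unique for \<^term>\<open>p \<in> parabolic n\<close> when \<^term>\<open>n \<ge> 1\<close>.\<close>

definition sim_m :: "nat \<Rightarrow> 'a::field mat \<Rightarrow> 'a" where
  "sim_m n p = (THE l. l \<noteq> 0 \<and> (\<exists>A B. A \<in> carrier (GL n) \<and> B \<in> carrier_mat n n
     \<and> p = four_block_mat (l \<cdot>\<^sub>m A) B (0\<^sub>m n n) (transpose_mat (inv\<^bsub>GL n\<^esub> A))))"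

definition conj_J :: "nat \<Rightarrow> ('a::field mat \<Rightarrow> complex) \<Rightarrow> 'a mat \<Rightarrow> complex" where
  "conj_J n \<chi> p = (case split_block p n n of (A, B, C, D) \<Rightarrow>
     \<chi> (four_block_mat D (0\<^sub>m n n) (0\<^sub>m n n) A))"

section \<open>The induced representation and the intertwining operator\<close>

text \<open>Functions on the group are represented as functions on all matrices that vanish off the
  group, so that they form a subspace under the pointwise operations.\<close>

definition Ind :: "nat \<Rightarrow> ('a::field mat \<Rightarrow> complex) \<Rightarrow> ('a mat \<Rightarrow> complex) set" where
  "Ind n \<chi> = {f. (\<forall>g. g \<notin> carrier (GO n) \<longrightarrow> f g = 0)
     \<and> (\<forall>p \<in> parabolic n. \<forall>g \<in> carrier (GO n). f (p * g) = \<chi> p * f g)}"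

text \<open>The operator is restricted to \<^term>\<open>Ind n \<chi>\<close>, being unspecified elsewhere; its values lie in
  \<^term>\<open>Ind n (conj_J n \<chi>)\<close>.\<close>

definition intertwiner ::
  "nat \<Rightarrow> ('a::field mat \<Rightarrow> complex) \<Rightarrow> ('a mat \<Rightarrow> complex) \<Rightarrow> ('a mat \<Rightarrow> complex)" where
  "intertwiner n \<chi> = (\<lambda>f \<in> Ind n \<chi>. \<lambda>g.
     if g \<in> carrier (GO n)
     then \<Sum>u \<in> unip_radical n. f (inv\<^bsub>GO n\<^esub> (J_mat n) * u * g) else 0)"

text \<open>The character \<^term>\<open>conj_J n (conj_J n \<chi>)\<close> agrees with \<^term>\<open>\<chi>\<close> on the parabolic subgroup
  whenever \<^term>\<open>\<chi>\<close> is the product of a character of \<^term>\<open>sim_m n\<close> and one of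
  \<^term>\<open>chi_det n\<close>; the composite is then an endomorphism of \<^term>\<open>Ind n \<chi>\<close>.\<close>

definition intertwiner_sq ::
  "nat \<Rightarrow> ('a::field mat \<Rightarrow> complex) \<Rightarrow> ('a mat \<Rightarrow> complex) \<Rightarrow> ('a mat \<Rightarrow> complex)" where
  "intertwiner_sq n \<chi> = compose (Ind n \<chi>) (intertwiner n (conj_J n \<chi>)) (intertwiner n \<chi>)"

section \<open>Operators on spaces of functions\<close>

definition fun_scale :: "complex \<Rightarrow> ('x \<Rightarrow> complex) \<Rightarrow> ('x \<Rightarrow> complex)" where
  "fun_scale c f = (\<lambda>x. c * f x)"

global_interpretation fun_space: vector_space "fun_scale :: complex \<Rightarrow> ('x \<Rightarrow> complex) \<Rightarrow> _"
  by unfold_locales (auto simp: fun_scale_def fun_eq_iff algebra_simps)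

text \<open>Both notions are meant for a linear endomorphism \<^term>\<open>T\<close> of a subspace \<^term>\<open>V\<close>; the values
  of \<^term>\<open>T\<close> off \<^term>\<open>V\<close> are irrelevant.\<close>

definition eigenvalues_on ::
  "('x \<Rightarrow> complex) set \<Rightarrow> (('x \<Rightarrow> complex) \<Rightarrow> ('x \<Rightarrow> complex)) \<Rightarrow> complex set" where
  "eigenvalues_on V T = {c. \<exists>f \<in> V. f \<noteq> 0 \<and> T f = fun_scale c f}"

definition diagonalizable_on ::
  "('x \<Rightarrow> complex) set \<Rightarrow> (('x \<Rightarrow> complex) \<Rightarrow> ('x \<Rightarrow> complex)) \<Rightarrow> bool" where
  "diagonalizable_on V T \<longleftrightarrow>
     (\<exists>B. fun_space.independent B \<and> fun_space.span B = V
        \<and> (\<forall>b \<in> B. \<exists>c. T b = fun_scale c b))"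

end

theory Submission
  imports Defs
begin

text \<open>Write \<open>q\<close> for the number of field elements and equip the row space of dimension \<open>2 * n\<close>
  with the symmetric bilinear form given by \<open>J\<close>. The lower \<open>n\<close> rows of a similitude form a
  frame, that is, a basis of a maximal isotropic subspace (a Lagrangian). A function in the
  induced representation is determined by its values at the similitudes of multiplier one, where
  it depends only on the frame \<open>R\<close> of lower rows, and a change of basis \<open>D\<close> of the frame
  multiplies it by \<open>\<beta> (det D)\<close>. The unipotent radical is the group of alternating matrices, and
  translating by \<open>J\<close> times its elements replaces \<open>R\<close> by all the frames dual to it. If \<open>\<beta>\<close> were
  absent, the functions would live on the set of Lagrangians, and \<open>I\<close> would be the operator
  \<open>opp\<close> that sums a function over the Lagrangians opposite to a given one.

  A quadratic \<open>\<beta>\<close> can be made absent. There is a sign \<open>twist\<close> on frames with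
  \<open>twist (D * R) = \<beta> (det D) * twist R\<close> and \<open>twist R' = c * twist R\<close> for dual frames \<open>R\<close> and
  \<open>R'\<close>, where \<open>c\<close> is a constant sign. It is a product, over the vectors of norm two taken up to
  sign, of the signs of their coordinate rows \<open>form v R\<close>. That it transforms by \<open>\<beta>\<close> is a version
  for general linear groups of the lemmas of Gauss and Zolotarev, with the number of norm-two
  vectors above a given coordinate row being odd. Multiplication by \<open>twist\<close> carries
  \<open>GL_n\<close>-invariant functions of frames onto the induced representation and \<open>opp \<circ> opp\<close> onto
  \<open>I \<circ> I\<close>, the two signs \<open>c\<close> cancelling (\<open>intertwiner_sq_Phi\<close>).

  The operator \<open>opp\<close> is triangular. Let \<open>phi S\<close> be the indicator of the Lagrangians that contain
  the rows in \<open>S\<close>, and let \<open>Filt k\<close> be the span of the \<open>phi S\<close> with fewer than \<open>k\<close> rows. For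
  independent and mutually orthogonal rows \<open>S\<close>, \<open>k\<close> in number, \<open>opp (phi S)\<close> counts alternating
  matrices with \<open>k\<close> prescribed rows: there are \<open>q ^ ((n - k) choose 2)\<close> of them if the
  Lagrangian meets the span of \<open>S\<close> trivially, and none otherwise (\<open>opp_phi\<close>).
  Inclusion-exclusion over the subspaces of that span shows that the indicator of trivial
  intersection is \<open>(-1) ^ k * q ^ (k choose 2)\<close> times \<open>phi S\<close> modulo \<open>Filt k\<close>
  (\<open>avoid_cong_phi\<close>). So \<open>opp\<close> acts on the \<open>k\<close>-th layer by
  \<open>lam k = (-1) ^ k * q ^ ((k choose 2) + ((n - k) choose 2))\<close>. Being dual is a symmetric
  relation, so \<open>opp\<close> is self-adjoint, and \<open>opp \<circ> opp\<close> is diagonalizable with eigenvalues among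
  the \<open>lam k ^ 2\<close> with \<open>k \<le> n\<close>.

  All of these occur, because the filtration is strictly increasing. If one step were an
  equality, so would be all later ones. The last step is strict because of the sign that tells
  the two families of Lagrangians apart: \<open>orient\<close> is an eigenvector of \<open>opp\<close> for an eigenvalue
  of absolute value \<open>q ^ (n choose 2)\<close>. This exceeds \<open>\<bar>lam j\<bar>\<close> for \<open>0 < j < n\<close>, so in \<open>Filt n\<close>
  the sign would have to be constant (\<open>orient_not_in_Filt\<close>). Finally \<open>lam k ^ 2\<close> is symmetric
  under \<open>k \<mapsto> n - k\<close>, and \<open>k = m - i\<close> gives the listed exponents.\<close>

section \<open>Operators that are triangular along a filtration\<close>

text \<open>Semisimplicity is assumed at the diagonal entries only, in the form in which
  self-adjointness delivers it: the kernels of \<open>T - \<mu> k\<close> and of its square agree. The diagonal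
  entries may repeat.\<close>

locale triangular_operator =
  fixes V :: "('x \<Rightarrow> complex) set"
    and T :: "('x \<Rightarrow> complex) \<Rightarrow> ('x \<Rightarrow> complex)"
    and W :: "nat \<Rightarrow> ('x \<Rightarrow> complex) set"
    and \<mu> :: "nat \<Rightarrow> complex"
    and n :: nat
  assumes T_closed: "f \<in> V \<Longrightarrow> T f \<in> V"
    and T_add: "f \<in> V \<Longrightarrow> g \<in> V \<Longrightarrow> T (f + g) = T f + T g"
    and T_scale: "f \<in> V \<Longrightarrow> T (fun_scale c f) = fun_scale c (T f)"
    and T_semisimple: "k \<le> n \<Longrightarrow> f \<in> V \<Longrightarrow>
      T (T f - fun_scale (\<mu> k) f) = fun_scale (\<mu> k) (T f - fun_scale (\<mu> k) f) \<Longrightarrow>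
      T f = fun_scale (\<mu> k) f"
    and W_subspace: "fun_space.subspace (W k)"
    and W_Suc: "W k \<subseteq> W (Suc k)"
    and W_top: "W n = V"
    and T_W_0: "f \<in> W 0 \<Longrightarrow> T f = fun_scale (\<mu> 0) f"
    and T_W_Suc: "k < n \<Longrightarrow> f \<in> W (Suc k) \<Longrightarrow> T f - fun_scale (\<mu> (Suc k)) f \<in> W k"
begin

lemma W_mono: "i \<le> j \<Longrightarrow> W i \<subseteq> W j"
  by (rule lift_Suc_mono_le[of W, OF W_Suc])

lemma W_V: "k \<le> n \<Longrightarrow> W k \<subseteq> V"
  using W_mono W_top by blast

lemma V_subspace: "fun_space.subspace V"
  using W_subspace[of n] W_top by simp

text \<open>Eigenvalues with index above \<open>k\<close> are excluded so that the induction along the filtration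
  adds one diagonal entry at a time.\<close>

definition eigs :: "nat \<Rightarrow> ('x \<Rightarrow> complex) set" where
  "eigs k = {f \<in> W k. \<exists>j\<le>k. T f = fun_scale (\<mu> j) f}"

lemma span_eigs: "fun_space.span (eigs k) \<subseteq> W k"
  by (rule fun_space.span_minimal[OF _ W_subspace]) (auto simp: eigs_def)

lemma T_zero: "T 0 = 0"
proof -
  have "0 \<in> V" using V_subspace by (rule fun_space.subspace_0)
  from T_scale[OF this, of 0] show ?thesis by simp
qed

lemma T_diff: "f \<in> V \<Longrightarrow> g \<in> V \<Longrightarrow> T (f - g) = T f - T g"
  using T_add[of "f - g" g] fun_space.subspace_diff[OF V_subspace, of f g] by simp

text \<open>On a span of eigenvectors, \<open>T - c\<close> is invertible on the eigenspaces for eigenvalues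
  other than \<open>c\<close>; what remains is the \<open>c\<close>-component \<open>w\<close> of \<open>u\<close>.\<close>

lemma solve_mod_eigenvector:
  assumes k: "k \<le> n" and u: "u \<in> fun_space.span (eigs k)"
  shows "\<exists>e \<in> fun_space.span (eigs k). \<exists>w \<in> V.
    T w = fun_scale c w \<and> u = T e - fun_scale c e + w"
  using u
proof (induction rule: fun_space.span_induct_alt)
  case base
  show ?case
  proof (rule bexI[of _ 0], rule bexI[of _ 0])
    show "T 0 = fun_scale c 0 \<and> 0 = T 0 - fun_scale c 0 + 0"
      unfolding T_zero fun_space.scale_zero_right by simp
  qed (rule fun_space.subspace_0[OF V_subspace], rule fun_space.span_zero)
next
  case (step a x y)
  then obtain e w where e: "e \<in> fun_space.span (eigs k)" and w: "w \<in> V" "T w = fun_scale c w"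
    and y: "y = T e - fun_scale c e + w" by blast
  have eV: "e \<in> V" using e span_eigs W_V[OF k] by blast
  from step(1) obtain j where x: "x \<in> W k" "T x = fun_scale (\<mu> j) x" by (auto simp: eigs_def)
  have xV: "x \<in> V" using x W_V[OF k] by blast
  have sV: "fun_scale b x \<in> V" for b
    using fun_space.subspace_scale[OF V_subspace xV] .
  show ?case
  proof (cases "\<mu> j = c")
    case True
    show ?thesis
    proof (rule bexI[OF _ e], rule bexI[of _ "fun_scale a x + w"])
      show "T (fun_scale a x + w) = fun_scale c (fun_scale a x + w) \<and>
        fun_scale a x + y = T e - fun_scale c e + (fun_scale a x + w)"
        using x True w sV[of a] xV y
        by (simp add: T_add T_scale) (simp add: fun_scale_def fun_eq_iff algebra_simps)
      show "fun_scale a x + w \<in> V" using sV w V_subspace fun_space.subspace_add by blast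
    qed
  next
    case False
    \<comment> \<open>On this eigenvector \<open>T - c\<close> acts by the nonzero scalar \<open>\<mu> j - c\<close>.\<close>
    define b where "b = a / (\<mu> j - c)"
    have "T (fun_scale b x + e) - fun_scale c (fun_scale b x + e)
      = fun_scale (b * (\<mu> j - c)) x + (T e - fun_scale c e)"
      using x xV eV sV by (simp add: T_add T_scale) (simp add: fun_scale_def fun_eq_iff algebra_simps)
    also have "b * (\<mu> j - c) = a" using False by (simp add: b_def)
    finally have "T (fun_scale b x + e) - fun_scale c (fun_scale b x + e)
      = fun_scale a x + (T e - fun_scale c e)" .
    hence eq: "fun_scale a x + y = T (fun_scale b x + e) - fun_scale c (fun_scale b x + e) + w"
      using y by (simp only: add.assoc)
    show ?thesis
    proof (rule bexI[of _ "fun_scale b x + e"], rule bexI[of _ w])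
      show "T w = fun_scale c w \<and>
        fun_scale a x + y = T (fun_scale b x + e) - fun_scale c (fun_scale b x + e) + w"
        using eq w by blast
      show "fun_scale b x + e \<in> fun_space.span (eigs k)"
        using e step(1) by (meson fun_space.span_add fun_space.span_base fun_space.span_scale)
    qed (use w in blast)
  qed
qed

text \<open>Subtracting the solution of the previous lemma leaves a vector that \<open>T - \<mu>\<close> maps to an
  eigenvector for the same \<open>\<mu>\<close>; semisimplicity makes it an eigenvector itself.\<close>

lemma eigenvector_correction:
  assumes k: "k < n" and f: "f \<in> W (Suc k)" and span: "W k = fun_space.span (eigs k)"
  shows "\<exists>e \<in> W k. T (f - e) = fun_scale (\<mu> (Suc k)) (f - e)"
proof -
  let ?c = "\<mu> (Suc k)"
  have fV: "f \<in> V" using f W_V[of "Suc k"] k by auto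
  have "T f - fun_scale ?c f \<in> fun_space.span (eigs k)"
    using T_W_Suc[OF k f] span by simp
  from solve_mod_eigenvector[OF _ this, of ?c] k obtain e w where
    e: "e \<in> fun_space.span (eigs k)" and w: "w \<in> V" "T w = fun_scale ?c w"
    and eq: "T f - fun_scale ?c f = T e - fun_scale ?c e + w" by auto
  have eW: "e \<in> W k" using e span by simp
  hence eV: "e \<in> V" using W_V[of k] k by auto
  have "T (f - e) - fun_scale ?c (f - e) = w"
    using eq by (simp add: T_diff fV eV fun_space.scale_right_diff_distrib algebra_simps)
  hence "T (f - e) = fun_scale ?c (f - e)"
    using T_semisimple[of "Suc k" "f - e"] w k fun_space.subspace_diff[OF V_subspace fV eV] by simp
  thus ?thesis using eW by blast
qed

lemma W_eq_span_eigs: "k \<le> n \<Longrightarrow> W k = fun_space.span (eigs k)"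
proof (induction k)
  case 0
  have "W 0 \<subseteq> eigs 0" using T_W_0 by (auto simp: eigs_def)
  thus ?case using span_eigs[of 0] fun_space.span_superset by blast
next
  case (Suc k)
  hence IH: "W k = fun_space.span (eigs k)" and k: "k < n" by auto
  have mono: "eigs k \<subseteq> eigs (Suc k)"
    using W_mono[of k "Suc k"] by (auto simp: eigs_def intro: le_SucI)
  have "f \<in> fun_space.span (eigs (Suc k))" if f: "f \<in> W (Suc k)" for f
  proof -
    obtain e where e: "e \<in> W k" "T (f - e) = fun_scale (\<mu> (Suc k)) (f - e)"
      using eigenvector_correction[OF k f IH] by blast
    have "f - e \<in> W (Suc k)"
      using e f W_mono[of k "Suc k"] fun_space.subspace_diff[OF W_subspace] by auto
    hence 1: "f - e \<in> fun_space.span (eigs (Suc k))"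
      using e by (intro fun_space.span_base) (auto simp: eigs_def)
    have 2: "e \<in> fun_space.span (eigs (Suc k))"
      using e(1) IH fun_space.span_mono[OF mono] by auto
    show ?thesis using fun_space.span_add[OF 1 2] by simp
  qed
  thus ?case using span_eigs[of "Suc k"] by blast
qed

lemma eigenvectors_span:
  "V = fun_space.span {f \<in> V. \<exists>j\<le>n. T f = fun_scale (\<mu> j) f}"
  using W_eq_span_eigs[of n] W_top by (simp add: eigs_def)

text \<open>A vector of \<open>W k\<close> outside \<open>W (k - 1)\<close> stays nonzero after its correction by an element
  of \<open>W (k - 1)\<close>.\<close>

lemma eigenvalue_attained:
  assumes k: "k \<le> n" and strict: "if k = 0 then W 0 \<noteq> {0} else W k \<noteq> W (k - 1)"
  shows "\<exists>f \<in> V. f \<noteq> 0 \<and> T f = fun_scale (\<mu> k) f"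
proof (cases k)
  case 0
  then obtain f where "f \<in> W 0" "f \<noteq> 0"
    using strict fun_space.subspace_0[OF W_subspace[of 0]] by auto
  thus ?thesis using 0 T_W_0 W_V[of 0] by auto
next
  case (Suc l)
  hence "\<not> W (Suc l) \<subseteq> W l" using strict W_mono[of l "Suc l"] by auto
  then obtain f where f: "f \<in> W (Suc l)" "f \<notin> W l" by auto
  from Suc k have l: "l < n" by simp
  obtain e where e: "e \<in> W l" "T (f - e) = fun_scale (\<mu> (Suc l)) (f - e)"
    using eigenvector_correction[OF l f(1) W_eq_span_eigs] l by auto
  have "f \<in> V" "e \<in> V" using f e l W_V[of l] W_V[of "Suc l"] by auto
  hence "f - e \<in> V" using fun_space.subspace_diff[OF V_subspace] by blast
  moreover have "f - e \<noteq> 0" using e f by auto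
  ultimately show ?thesis using e(2) Suc by blast
qed

text \<open>If \<open>c\<close> differs from all diagonal entries, an eigenvector for \<open>c\<close> descends through the
  whole filtration, since modulo \<open>W j\<close> it is killed by the nonzero scalar \<open>c - \<mu> (Suc j)\<close>.\<close>

lemma only_eigenvalues:
  assumes f: "f \<in> V" "f \<noteq> 0" "T f = fun_scale c f"
  shows "\<exists>k\<le>n. c = \<mu> k"
proof (rule ccontr)
  assume contra: "\<not> ?thesis"
  have cancel: "f \<in> W j" if "fun_scale (c - b) f \<in> W j" "c \<noteq> b" for b j
  proof -
    have "fun_scale (inverse (c - b)) (fun_scale (c - b) f) \<in> W j"
      by (rule fun_space.subspace_scale[OF W_subspace that(1)])
    thus ?thesis using that(2) by simp
  qed
  \<comment> \<open>For \<open>i > n\<close> the truncated subtraction repeats the bottom step, which is harmless.\<close>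
  have "f \<in> W (n - i)" for i
  proof (induction i)
    case 0 show ?case using f W_top by simp
  next
    case (Suc i)
    show ?case
    proof (cases "n - i")
      case 0 thus ?thesis using Suc by (metis diff_Suc_eq_diff_pred diff_commute diff_0_eq_0 diff_is_0_eq le_SucI)
    next
      case (Suc j)
      hence "T f - fun_scale (\<mu> (Suc j)) f \<in> W j" using T_W_Suc[of j f] Suc.IH by simp
      hence "fun_scale (c - \<mu> (Suc j)) f \<in> W j"
        using f by (simp add: fun_space.scale_left_diff_distrib)
      moreover have "c \<noteq> \<mu> (Suc j)" using contra Suc by (metis diff_le_self)
      ultimately have "f \<in> W j" by (rule cancel)
      moreover have "n - Suc i = j" using Suc by simp
      ultimately show ?thesis by simp
    qed
  qed
  from this[of n] have "f \<in> W 0" by simp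
  hence "fun_scale c f = fun_scale (\<mu> 0) f" using T_W_0 f by auto
  hence "c = \<mu> 0" using f(2) by simp
  thus False using contra by auto
qed

end

lemma diagonalizable_onI:
  assumes span: "V = fun_space.span E" and E: "\<And>f. f \<in> E \<Longrightarrow> \<exists>c. T f = fun_scale c f"
  shows "diagonalizable_on V T"
proof -
  obtain B where B: "B \<subseteq> E" "fun_space.independent B" "E \<subseteq> fun_space.span B"
    using fun_space.maximal_independent_subset by blast
  have "fun_space.span B = V"
  proof
    show "fun_space.span B \<subseteq> V" using B(1) span fun_space.span_mono by blast
    show "V \<subseteq> fun_space.span B"
      unfolding span by (rule fun_space.span_minimal[OF B(3) fun_space.subspace_span])
  qed
  thus ?thesis using B E unfolding diagonalizable_on_def by blast
qed

section \<open>Row vectors over a finite field\<close>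

lemma even_card_fixpoint_free_involution:
  assumes "finite A" "\<And>x. x \<in> A \<Longrightarrow> f x \<in> A \<and> f (f x) = x \<and> f x \<noteq> x"
  shows "even (card A)"
  using assms
proof (induction A rule: finite_psubset_induct)
  case (psubset A)
  show ?case
  proof (cases "A = {}")
    case False
    then obtain x where x: "x \<in> A" by blast
    let ?B = "A - {x, f x}"
    have "\<And>y. y \<in> ?B \<Longrightarrow> f y \<in> ?B \<and> f (f y) = y \<and> f y \<noteq> y"
      using psubset.prems x by (metis DiffE DiffI insert_iff singletonD)
    moreover have "?B \<subset> A" using x by blast
    ultimately have "even (card ?B)" using psubset.IH by blast
    moreover have "card A = card ?B + 2"
    proof -
      have "card {x, f x} = 2" using psubset.prems x by (metis card_2_iff)
      moreover have "{x, f x} \<subseteq> A" using psubset.prems x by blast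
      ultimately show ?thesis
        using card_Diff_subset[of "{x, f x}" A] card_mono[of A "{x, f x}"] psubset.hyps by simp
    qed
    ultimately show ?thesis by simp
  qed simp
qed

lemma two_neq_zero:
  assumes "odd CARD('k)" shows "(2::'k::{field,finite}) \<noteq> 0"
proof
  assume "(2::'k) = 0"
  hence "x + 1 + 1 = x" for x :: 'k by (simp add: add.assoc)
  hence "even (card (UNIV :: 'k set))"
    by (intro even_card_fixpoint_free_involution[where f = "\<lambda>x. x + 1"]) auto
  thus False using assms by simp
qed

lemma eq_uminus_self:
  assumes "odd CARD('k)" "(x::'k::{field,finite}) = - x" shows "x = 0"
proof -
  have "x + x = 0" using assms(2) by (rule iffD1[OF eq_neg_iff_add_eq_0])
  hence "2 * x = 0" by (simp only: mult_2)
  thus ?thesis using two_neq_zero[OF assms(1)] by simp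
qed

lemma bij_betw_mat_entries:
  "bij_betw (\<lambda>A. \<lambda>ij \<in> {..<n} \<times> {..<m}. A $$ ij) (carrier_mat n m)
     (({..<n} \<times> {..<m}) \<rightarrow>\<^sub>E UNIV)"
proof (rule bij_betw_byWitness[where f' = "\<lambda>f. mat n m f"])
  show "\<forall>A \<in> carrier_mat n m. mat n m (\<lambda>ij \<in> {..<n} \<times> {..<m}. A $$ ij) = A" by auto
  show "\<forall>f \<in> ({..<n} \<times> {..<m}) \<rightarrow>\<^sub>E UNIV. (\<lambda>ij \<in> {..<n} \<times> {..<m}. mat n m f $$ ij) = f"
    by (auto simp: fun_eq_iff PiE_def extensional_def)
qed (auto split: if_splits)

lemma finite_carrier_mat [simp]: "finite (carrier_mat n m :: 'k::finite mat set)"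
proof -
  have "finite ((({..<n} \<times> {..<m}) \<rightarrow>\<^sub>E UNIV) :: (nat \<times> nat \<Rightarrow> 'k) set)"
    by (intro finite_PiE) auto
  thus ?thesis using bij_betw_finite[OF bij_betw_mat_entries] by blast
qed

lemma card_carrier_mat: "card (carrier_mat n m :: 'k::finite mat set) = CARD('k) ^ (n * m)"
  using bij_betw_same_card[OF bij_betw_mat_entries[of n m, where 'a = 'k]]
  by (simp add: card_funcsetE card_cartesian_product)

definition dot :: "'k::comm_ring_1 mat \<Rightarrow> 'k mat \<Rightarrow> 'k" where
  "dot a b = (\<Sum>i<dim_col a. a $$ (0, i) * b $$ (0, i))"

abbreviation rows_of :: "nat \<Rightarrow> 'k mat set" where
  "rows_of n \<equiv> carrier_mat 1 n"

lemma row_eqI: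
  assumes "a \<in> rows_of n" "b \<in> rows_of n" "\<And>i. i < n \<Longrightarrow> a $$ (0, i) = b $$ (0, i)"
  shows "a = b"
  using assms by (intro eq_matI) auto

lemma dot_commute: "a \<in> rows_of n \<Longrightarrow> b \<in> rows_of n \<Longrightarrow> dot a b = dot b a"
  by (simp add: dot_def mult.commute)

lemma dot_linear:
  assumes "a \<in> rows_of n" "b \<in> rows_of n" "c \<in> rows_of n"
  shows "dot (a + b) c = dot a c + dot b c"
    and "dot c (a + b) = dot c a + dot c b"
    and "dot (a - b) c = dot a c - dot b c"
    and dot_diff_right: "dot c (a - b) = dot c a - dot c b"
  using assms
  by (auto simp: dot_def sum.distrib sum_subtractf sum_distrib_left algebra_simps intro!: sum.cong)

lemma dot_smult:
  assumes "a \<in> rows_of n" "c \<in> rows_of n"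
  shows "dot (k \<cdot>\<^sub>m a) c = k * dot a c"
    and dot_smult_right: "dot c (k \<cdot>\<^sub>m a) = k * dot c a"
  using assms by (auto simp: dot_def sum_distrib_left algebra_simps intro!: sum.cong)

lemma dot_zero:
  assumes "a \<in> rows_of n"
  shows "dot (0\<^sub>m (Suc 0) n) a = 0" "dot a (0\<^sub>m (Suc 0) n) = 0"
  using assms by (auto simp: dot_def)

lemma dot_eq_mult_transpose:
  assumes "a \<in> rows_of n" "b \<in> rows_of n"
  shows "dot a b = (a * transpose_mat b) $$ (0, 0)"
  using assms by (simp add: dot_def scalar_prod_def atLeast0LessThan)

text \<open>Recursion on the list lets every statement about spans and independence be proved by
  adjoining one row at a time.\<close>

fun lspan :: "nat \<Rightarrow> 'k::field mat list \<Rightarrow> 'k mat set" where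
  "lspan n [] = {0\<^sub>m 1 n}"
| "lspan n (v # S) = {c \<cdot>\<^sub>m v + s | c s. s \<in> lspan n S}"

fun lindep :: "nat \<Rightarrow> 'k::field mat list \<Rightarrow> bool" where
  "lindep n [] \<longleftrightarrow> False"
| "lindep n (v # S) \<longleftrightarrow> v \<in> lspan n S \<or> lindep n S"

lemma lspan_ConsI: "s \<in> lspan n S \<Longrightarrow> c \<cdot>\<^sub>m v + s \<in> lspan n (v # S)"
  by auto

lemma lspan_closed: "set S \<subseteq> rows_of n \<Longrightarrow> lspan n S \<subseteq> rows_of n"
  by (induction S) auto

lemma lspan_smult:
  "set S \<subseteq> rows_of n \<Longrightarrow> a \<in> lspan n S \<Longrightarrow> k \<cdot>\<^sub>m a \<in> lspan n S"
proof (induction S arbitrary: a)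
  case (Cons v S)
  then obtain c s where a: "a = c \<cdot>\<^sub>m v + s" "s \<in> lspan n S" by auto
  hence "s \<in> rows_of n" using Cons lspan_closed[of S n] by auto
  hence "k \<cdot>\<^sub>m a = (k * c) \<cdot>\<^sub>m v + k \<cdot>\<^sub>m s" using a Cons(2)
    by (intro row_eqI[of _ n]) (auto simp: algebra_simps)
  thus ?case using Cons a by auto
qed auto

lemma lspan_add:
  "set S \<subseteq> rows_of n \<Longrightarrow> a \<in> lspan n S \<Longrightarrow> b \<in> lspan n S \<Longrightarrow> a + b \<in> lspan n S"
proof (induction S arbitrary: a b)
  case (Cons v S)
  then obtain c s d t where ab: "a = c \<cdot>\<^sub>m v + s" "s \<in> lspan n S" "b = d \<cdot>\<^sub>m v + t" "t \<in> lspan n S"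
    by auto
  hence "s \<in> rows_of n" "t \<in> rows_of n" using Cons lspan_closed[of S n] by auto
  hence "a + b = (c + d) \<cdot>\<^sub>m v + (s + t)" using ab Cons(2)
    by (intro row_eqI[of _ n]) (auto simp: algebra_simps)
  thus ?case using Cons ab by auto
qed auto

lemma lspan_mono_Cons: "set (v # S) \<subseteq> rows_of n \<Longrightarrow> lspan n S \<subseteq> lspan n (v # S)"
proof
  fix a assume *: "set (v # S) \<subseteq> rows_of n" "a \<in> lspan n S"
  hence "a \<in> rows_of n" using lspan_closed[of S n] by auto
  hence "a = 0 \<cdot>\<^sub>m v + a" using * by (intro row_eqI[of _ n]) auto
  thus "a \<in> lspan n (v # S)" using * by auto
qed

lemma lspan_Cons_dependent:
  assumes S: "set (v # S) \<subseteq> rows_of n" and v: "v \<in> lspan n S"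
  shows "lspan n (v # S) = lspan n S"
  using lspan_mono_Cons[OF S] lspan_add[of S n] lspan_smult[of S n v] v S by auto

lemma lspan_diff:
  assumes "set S \<subseteq> rows_of n" "a \<in> lspan n S" "b \<in> lspan n S"
  shows "a - b \<in> lspan n S"
proof -
  have "a \<in> rows_of n" "b \<in> rows_of n" using assms lspan_closed[of S n] by auto
  hence "a - b = a + (-1) \<cdot>\<^sub>m b" by (intro row_eqI[of _ n]) auto
  thus ?thesis using lspan_add lspan_smult assms by metis
qed

lemma lspan_Cons_unique:
  assumes S: "set (v # S) \<subseteq> rows_of n" and v: "v \<notin> lspan n S"
    and st: "s \<in> lspan n S" "t \<in> lspan n S" and eq: "c \<cdot>\<^sub>m v + s = d \<cdot>\<^sub>m v + t"
  shows "c = d \<and> s = t"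
proof -
  have car: "s \<in> rows_of n" "t \<in> rows_of n" "v \<in> rows_of n"
    using S st lspan_closed[of S n] by auto
  have e: "c * v $$ (0, i) + s $$ (0, i) = d * v $$ (0, i) + t $$ (0, i)" if "i < n" for i
    using arg_cong[OF eq, of "\<lambda>M. M $$ (0, i)"] car that by simp
  have "c = d"
  proof (rule ccontr)
    assume cd: "c \<noteq> d"
    have "v = (1 / (c - d)) \<cdot>\<^sub>m (t - s)"
      using e car cd by (intro row_eqI[of _ n]) (auto simp: field_simps)
    thus False using v lspan_smult[of S n "t - s"] lspan_diff[of S n t s] st S by auto
  qed
  moreover have "s = t" using e car \<open>c = d\<close> by (intro row_eqI[of _ n]) auto
  ultimately show ?thesis by blast
qed

lemma card_lspan:
  "set S \<subseteq> rows_of n \<Longrightarrow> \<not> lindep n S \<Longrightarrow>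
     card (lspan n S :: 'k::{field,finite} mat set) = CARD('k) ^ length S"
proof (induction S)
  case (Cons v S)
  have "bij_betw (\<lambda>(c, s). c \<cdot>\<^sub>m v + s) (UNIV \<times> lspan n S) (lspan n (v # S))"
    unfolding bij_betw_def
  proof
    show "inj_on (\<lambda>(c, s). c \<cdot>\<^sub>m v + s) (UNIV \<times> lspan n S)"
      using lspan_Cons_unique[OF Cons.prems(1)] Cons.prems(2) by (fastforce simp: inj_on_def)
  qed auto
  from bij_betw_same_card[OF this] show ?case
    using Cons by (simp add: card_cartesian_product)
qed auto

text \<open>Elimination along the list: a row \<open>w\<close> dual to the head \<open>s\<close> serves to correct a solution
  for the tail, once \<open>a\<close> has been replaced by its component \<open>a - dot a w \<cdot>\<^sub>m s\<close>.\<close>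

lemma ex_dual_row:
  fixes S :: "'k::field mat list"
  shows "set S \<subseteq> rows_of n \<Longrightarrow> a \<in> rows_of n \<Longrightarrow> a \<notin> lspan n S \<Longrightarrow>
    \<exists>z \<in> rows_of n. dot a z = 1 \<and> (\<forall>s \<in> set S. dot s z = 0)"
proof (induction S arbitrary: a)
  case Nil
  then obtain i where i: "i < n" "a $$ (0, i) \<noteq> 0"
    by (metis lspan.simps(1) singletonI row_eqI index_zero_mat(1) less_one zero_carrier_mat)
  let ?z = "mat 1 n (\<lambda>(_, j). if j = i then 1 / a $$ (0, i) else 0)"
  have "dot a ?z = (\<Sum>j<n. if j = i then 1 else 0)"
    unfolding dot_def using Nil i by (intro sum.cong) auto
  also have "\<dots> = 1" using i by simp
  finally show ?case by (intro bexI[of _ ?z]) auto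
next
  case (Cons s S)
  hence car: "s \<in> rows_of n" "set S \<subseteq> rows_of n" by auto
  show ?case
  proof (cases "s \<in> lspan n S")
    case True
    hence "a \<notin> lspan n S" using Cons.prems lspan_Cons_dependent by blast
    then obtain z where z: "z \<in> rows_of n" "dot a z = 1" "\<forall>s \<in> set S. dot s z = 0"
      using Cons.IH car Cons.prems by blast
    have "\<forall>v \<in> lspan n S'. dot v z = 0" if "set S' \<subseteq> rows_of n" "\<forall>s \<in> set S'. dot s z = 0" for S'
      using that
    proof (induction S')
      case Nil thus ?case using z by (simp add: dot_zero)
    next
      case (Cons w S')
      thus ?case using z lspan_closed[of S' n]
        by (auto simp: dot_linear[of _ n] dot_smult[of _ n] subset_iff)
    qed
    hence "dot s z = 0" using True car z by blast
    thus ?thesis using z by auto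
  next
    case False
    then obtain w where w: "w \<in> rows_of n" "dot s w = 1" "\<forall>t \<in> set S. dot t w = 0"
      using Cons.IH car by blast
    define b where "b = a - dot a w \<cdot>\<^sub>m s"
    have b: "b \<in> rows_of n" using Cons.prems car by (auto simp: b_def)
    have "b \<notin> lspan n S"
    proof
      assume "b \<in> lspan n S"
      moreover have "a = dot a w \<cdot>\<^sub>m s + b"
        using Cons.prems car by (intro row_eqI[of _ n]) (auto simp: b_def)
      ultimately show False using Cons.prems by auto
    qed
    then obtain z where z: "z \<in> rows_of n" "dot b z = 1" "\<forall>t \<in> set S. dot t z = 0"
      using Cons.IH car b by blast
    let ?z = "z - dot s z \<cdot>\<^sub>m w"
    have "dot a ?z = dot b z"
      using Cons.prems car z w by (simp add: b_def dot_linear[of _ n] dot_smult[of _ n] algebra_simps)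
    moreover have "dot s ?z = 0"
      using car z w by (simp add: dot_linear[of _ n] dot_smult[of _ n])
    moreover have "dot t ?z = 0" if "t \<in> set S" for t
    proof -
      have "t \<in> rows_of n" using car that by blast
      thus ?thesis using z w that by (simp add: dot_linear[of _ n] dot_smult[of _ n])
    qed
    ultimately show ?thesis using z w by (intro bexI[of _ ?z]) auto
  qed
qed

definition perp :: "nat \<Rightarrow> 'k::field mat list \<Rightarrow> 'k mat set" where
  "perp n S = {y \<in> rows_of n. \<forall>s \<in> set S. dot s y = 0}"

lemma finite_perp: "finite (perp n S :: 'k::{field,finite} mat set)"
  by (simp add: perp_def)

text \<open>Each further independent condition cuts the solution space by a factor \<open>q\<close>: a row dual
  to the new one splits off a line.\<close>

lemma card_perp:
  fixes S :: "'k::{field,finite} mat list"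
  shows "set S \<subseteq> rows_of n \<Longrightarrow> \<not> lindep n S \<Longrightarrow>
    card (perp n S) * CARD('k) ^ length S = CARD('k) ^ n"
proof (induction S)
  case Nil
  thus ?case using card_carrier_mat[of 1 n, where 'k = 'k] by (simp add: perp_def)
next
  case (Cons s S)
  hence car: "s \<in> rows_of n" "set S \<subseteq> rows_of n" and s: "s \<notin> lspan n S" by auto
  obtain w where w: "w \<in> rows_of n" "dot s w = 1" "\<forall>t \<in> set S. dot t w = 0"
    using ex_dual_row[OF car(2,1) s] by blast
  have tc: "t \<in> rows_of n" if "t \<in> set S" for t using car that by blast
  have "bij_betw (\<lambda>(c, y). y + c \<cdot>\<^sub>m w) (UNIV \<times> perp n (s # S)) (perp n S)"
  proof (rule bij_betw_byWitness[where f' = "\<lambda>y. (dot s y, y - dot s y \<cdot>\<^sub>m w)"])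
    show "\<forall>x \<in> UNIV \<times> perp n (s # S).
        (\<lambda>y. (dot s y, y - dot s y \<cdot>\<^sub>m w)) ((\<lambda>(c, y). y + c \<cdot>\<^sub>m w) x) = x"
      using w(1,2) car by (auto simp: perp_def dot_linear[of _ n] dot_smult[of _ n] intro!: row_eqI[of _ n])
    show "\<forall>y \<in> perp n S. (\<lambda>(c, y). y + c \<cdot>\<^sub>m w) (dot s y, y - dot s y \<cdot>\<^sub>m w) = y"
      using w car by (auto simp: perp_def intro!: row_eqI[of _ n])
    show "(\<lambda>(c, y). y + c \<cdot>\<^sub>m w) ` (UNIV \<times> perp n (s # S)) \<subseteq> perp n S"
      using w tc by (auto simp: perp_def dot_linear[of _ n] dot_smult[of _ n])
    show "(\<lambda>y. (dot s y, y - dot s y \<cdot>\<^sub>m w)) ` perp n S \<subseteq> UNIV \<times> perp n (s # S)"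
      using w tc car by (auto simp: perp_def dot_linear[of _ n] dot_smult[of _ n])
  qed
  from bij_betw_same_card[OF this]
  have "card (perp n S) = CARD('k) * card (perp n (s # S))" by (simp add: card_cartesian_product)
  thus ?case using Cons by (simp add: mult.commute mult.left_commute)
qed

lemma card_perp_eq:
  fixes S :: "'k::{field,finite} mat list"
  assumes "set S \<subseteq> rows_of n" "\<not> lindep n S"
  shows "length S \<le> n" "card (perp n S) = CARD('k) ^ (n - length S)"
proof -
  have q: "1 < CARD('k)"
    using card_mono[of "UNIV :: 'k set" "{0, 1}"] by simp
  note c = card_perp[OF assms]
  have "0\<^sub>m 1 n \<in> perp n S" using assms by (auto simp: perp_def subset_iff dot_zero)
  hence pos: "0 < card (perp n S)"
    using finite_perp[of n S] card_gt_0_iff by blast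
  show le: "length S \<le> n"
  proof (rule ccontr)
    assume "\<not> ?thesis"
    hence "CARD('k) ^ n < CARD('k) ^ length S" using q by (simp add: power_strict_increasing)
    also have "\<dots> \<le> card (perp n S) * CARD('k) ^ length S" using pos by simp
    finally show False using c by simp
  qed
  have "CARD('k) ^ n = CARD('k) ^ (n - length S) * CARD('k) ^ length S"
    using le by (simp add: power_add[symmetric])
  thus "card (perp n S) = CARD('k) ^ (n - length S)" using c q by simp
qed

section \<open>Alternating matrices with prescribed rows\<close>

text \<open>In odd characteristic this forces a zero diagonal, so the skew-symmetric matrices are
  the alternating ones.\<close>

definition skew :: "nat \<Rightarrow> 'k::field mat set" where
  "skew n = {X \<in> carrier_mat n n. transpose_mat X = - X}"

lemma skew_iff:
  "X \<in> skew n \<longleftrightarrow> X \<in> carrier_mat n n \<and> (\<forall>i<n. \<forall>j<n. X $$ (i, j) + X $$ (j, i) = 0)"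
proof -
  have "transpose_mat X = - X \<longleftrightarrow> (\<forall>i<n. \<forall>j<n. X $$ (i, j) + X $$ (j, i) = 0)"
    if X: "X \<in> carrier_mat n n"
  proof
    assume e: "transpose_mat X = - X"
    have "X $$ (i, j) + X $$ (j, i) = 0" if "i < n" "j < n" for i j
    proof -
      have "transpose_mat X $$ (i, j) = (- X) $$ (i, j)" using e by simp
      thus ?thesis using X that by simp
    qed
    thus "\<forall>i<n. \<forall>j<n. X $$ (i, j) + X $$ (j, i) = 0" by blast
  next
    assume e: "\<forall>i<n. \<forall>j<n. X $$ (i, j) + X $$ (j, i) = 0"
    show "transpose_mat X = - X"
    proof (rule eq_matI)
      fix i j assume "i < dim_row (- X)" "j < dim_col (- X)"
      thus "transpose_mat X $$ (i, j) = (- X) $$ (i, j)"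
        using e X by (simp add: eq_neg_iff_add_eq_0)
    qed (use X in auto)
  qed
  thus ?thesis by (auto simp: skew_def)
qed

lemma card_skew:
  assumes "odd CARD('k)"
  shows "card (skew n :: 'k::{field,finite} mat set) = CARD('k) ^ (n choose 2)"
proof -
  let ?I = "SIGMA j:{..<n}. {..<j}"
  note diag = eq_uminus_self[OF assms]
  have "bij_betw (\<lambda>X. \<lambda>ij \<in> ?I. X $$ ij) (skew n :: 'k mat set) (?I \<rightarrow>\<^sub>E UNIV)"
  proof (rule bij_betw_byWitness[where f' = "\<lambda>f. mat n n (\<lambda>(i, j).
      if j < i then f (i, j) else if i < j then - f (j, i) else 0)"])
    show "\<forall>X \<in> skew n. mat n n (\<lambda>(i, j). if j < i then (\<lambda>ij \<in> ?I. X $$ ij) (i, j)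
        else if i < j then - (\<lambda>ij \<in> ?I. X $$ ij) (j, i) else 0) = (X :: 'k mat)"
    proof
      fix X :: "'k mat" assume X: "X \<in> skew n"
      hence s: "X $$ (i, j) + X $$ (j, i) = 0" if "i < n" "j < n" for i j
        using that unfolding skew_iff by blast
      have d: "X $$ (i, i) = 0" if "i < n" for i
        using s[OF that that] by (intro diag) (simp add: eq_neg_iff_add_eq_0)
      have u: "- X $$ (j, i) = X $$ (i, j)" if "i < j" "j < n" for i j
        using s[of j i] that by (intro minus_unique) simp
      have t: "\<not> i < j \<Longrightarrow> \<not> j < i \<Longrightarrow> i = j" for i j :: nat by simp
      have Xc: "X \<in> carrier_mat n n" using X by (simp add: skew_def)
      show "mat n n (\<lambda>(i, j). if j < i then (\<lambda>ij \<in> ?I. X $$ ij) (i, j)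
        else if i < j then - (\<lambda>ij \<in> ?I. X $$ ij) (j, i) else 0) = X"
      proof (rule eq_matI, unfold carrier_matD[OF Xc])
        fix i j assume "i < n" "j < n"
        thus "mat n n (\<lambda>(i, j). if j < i then (\<lambda>ij \<in> ?I. X $$ ij) (i, j)
          else if i < j then - (\<lambda>ij \<in> ?I. X $$ ij) (j, i) else 0) $$ (i, j) = X $$ (i, j)"
          using t[of i j] by (cases "i = j") (auto simp: d u)
      qed auto
    qed
    show "\<forall>f \<in> ?I \<rightarrow>\<^sub>E UNIV. (\<lambda>ij \<in> ?I. mat n n (\<lambda>(i, j).
      if j < i then f (i, j) else if i < j then - f (j, i) else 0) $$ ij) = (f :: _ \<Rightarrow> 'k)"
      by (auto simp: fun_eq_iff PiE_def extensional_def)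
  qed (auto simp: skew_iff split: if_splits)
  from bij_betw_same_card[OF this]
  have "card (skew n :: 'k mat set) = CARD('k) ^ card ?I" by (simp add: card_funcsetE)
  also have "card ?I = (\<Sum>j<n. j)" by simp
  also have "\<dots> = n choose 2"
    by (induction n) (auto simp: numeral_2_eq_2)
  finally show ?thesis .
qed

lemma choose_two_Suc: "Suc m choose 2 = (m choose 2) + m"
  by (simp add: numeral_2_eq_2)

text \<open>Each pair \<open>(a, b)\<close> prescribes the value \<open>b\<close> of \<open>X\<close> at the row \<open>a\<close>. After a change of
  basis this fixes as many rows of \<open>X\<close> as there are pairs.\<close>

definition skew_sol :: "nat \<Rightarrow> ('k::field mat \<times> 'k mat) list \<Rightarrow> 'k mat set" where
  "skew_sol n ps = {X \<in> skew n. \<forall>(a, b) \<in> set ps. a * X = b}"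

text \<open>The decomposable alternating form \<open>z \<and> y\<close>, used to alter the value of \<open>X\<close> at one row
  without changing it at the others.\<close>

definition wedge :: "nat \<Rightarrow> 'k::field mat \<Rightarrow> 'k mat \<Rightarrow> 'k mat" where
  "wedge n z y = mat n n (\<lambda>(i, j). z $$ (0, i) * y $$ (0, j) - y $$ (0, i) * z $$ (0, j))"

lemma wedge_skew: "wedge n z y \<in> skew n"
  by (auto simp: skew_iff wedge_def)

lemma mult_wedge:
  assumes "a \<in> rows_of n" "z \<in> rows_of n" "y \<in> rows_of n"
  shows "a * wedge n z y = dot a z \<cdot>\<^sub>m y - dot a y \<cdot>\<^sub>m z"
  using assms
  by (intro row_eqI[of _ n])
    (auto simp: wedge_def dot_def scalar_prod_def atLeast0LessThan algebra_simps
      sum_subtractf sum_distrib_left sum_distrib_right)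

lemma skew_add: fixes X :: "'k::field mat" assumes "X \<in> skew n" "Y \<in> skew n" shows "X + Y \<in> skew n"
proof -
  have "x + y + (x' + y') = 0" if "x + x' = 0" "y + y' = 0" for x y x' y' :: 'k
  proof -
    have "x + y + (x' + y') = (x + x') + (y + y')" by (simp only: add_ac)
    thus ?thesis using that by simp
  qed
  thus ?thesis using assms by (auto simp: skew_iff)
qed

lemma skew_diff: fixes X :: "'k::field mat" assumes "X \<in> skew n" "Y \<in> skew n" shows "X - Y \<in> skew n"
proof -
  have "x - y + (x' - y') = 0" if "x + x' = 0" "y + y' = 0" for x y x' y' :: 'k
  proof -
    have "x - y + (x' - y') = (x + x') - (y + y')" by (simp add: algebra_simps)
    thus ?thesis using that by simp
  qed
  thus ?thesis using assms by (auto simp: skew_iff minus_carrier_mat)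
qed

lemma dot_mult_skew:
  assumes "a \<in> rows_of n" "b \<in> rows_of n" "X \<in> skew n"
  shows "dot (a * X) b = - dot (b * X) a"
proof -
  have X: "X \<in> carrier_mat n n" using assms by (simp add: skew_def)
  have t: "transpose_mat (b * X) = - (X * transpose_mat b)"
    using assms X by (subst transpose_mult[of _ 1 n _ n]) (auto simp: skew_def)
  have "dot a (b * X) = (a * transpose_mat (b * X)) $$ (0, 0)"
    using assms X by (intro dot_eq_mult_transpose[of _ n]) auto
  also have "\<dots> = - ((a * (X * transpose_mat b)) $$ (0, 0))"
    unfolding t using assms X by simp
  also have "a * (X * transpose_mat b) = (a * X) * transpose_mat b"
    using assms X by (intro assoc_mult_mat[symmetric, of _ 1 n _ n _ 1]) auto
  also have "\<dots> $$ (0, 0) = dot (a * X) b"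
    using assms X by (intro dot_eq_mult_transpose[of _ n, symmetric]) auto
  finally have "dot (b * X) a = - dot (a * X) b"
    using assms X dot_commute[of a n "b * X"] by simp
  thus ?thesis by (simp only: minus_minus)
qed

text \<open>For an alternating \<open>X\<close> the number \<open>dot (a * X) b\<close> changes sign when \<open>a\<close> and \<open>b\<close> are
  exchanged, so the condition on the pairs is necessary for solvability. It is also sufficient,
  by induction: with \<open>z\<close> dual to the new row \<open>a\<close>, adding \<open>wedge n z y\<close> alters \<open>a * X\<close> by \<open>y\<close> and
  respects the old conditions when \<open>y\<close> is orthogonal to all the rows. The error \<open>a * X - b\<close> of
  an old solution is orthogonal to them, so every old solution is uniquely a new solution plus
  such a term.\<close>

lemma card_skew_sol:
  fixes ps :: "('k::{field,finite} mat \<times> 'k mat) list"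
  assumes odd: "odd CARD('k)"
  shows "set ps \<subseteq> rows_of n \<times> rows_of n \<Longrightarrow> \<not> lindep n (map fst ps) \<Longrightarrow>
    (\<forall>(a, b) \<in> set ps. \<forall>(a', b') \<in> set ps. dot a b' + dot b a' = 0) \<Longrightarrow>
    card (skew_sol n ps) = CARD('k) ^ ((n - length ps) choose 2)"
proof (induction ps)
  case Nil
  show ?case using card_skew[OF odd, of n] by (simp add: skew_sol_def)
next
  case (Cons p ps)
  obtain a b where p: "p = (a, b)" by force
  have car: "a \<in> rows_of n" "b \<in> rows_of n" "set ps \<subseteq> rows_of n \<times> rows_of n"
    using Cons.prems p by auto
  have two: "(2::'k) \<noteq> 0" by (rule two_neq_zero[OF odd])
  let ?as = "map fst ps"
  have asc: "set ?as \<subseteq> rows_of n" "set (map fst (p # ps)) \<subseteq> rows_of n"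
    using Cons.prems(1) by auto
  obtain z where z: "z \<in> rows_of n" "dot a z = 1" "\<forall>s \<in> set ?as. dot s z = 0"
    using ex_dual_row[OF asc(1) car(1)] Cons.prems(2) p by auto
  \<comment> \<open>The error of \<open>X\<close> at the new condition; it is the \<open>y\<close> of the decomposition.\<close>
  define F where "F X = a * X - b" for X
  let ?Y = "perp n (a # ?as)"
  have pr: "dot c d' + dot d c' = 0" if "(c, d) \<in> set (p # ps)" "(c', d') \<in> set (p # ps)" for c d c' d'
    using bspec[OF bspec[OF Cons.prems(3) that(1), unfolded prod.case] that(2), unfolded prod.case] .
  have orth: "dot a' b + dot b' a = 0" if "(a', b') \<in> set ps" for a' b'
    using pr[of a' b' a b] that by (simp add: p)
  have ab0: "dot a b = 0"
  proof -
    have "dot a b + dot b a = 0"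
      using pr[of a b a b] by (simp add: p)
    hence "2 * dot a b = 0" using dot_commute[OF car(1,2)] by simp
    thus ?thesis using two by simp
  qed
  \<comment> \<open>Alternation of \<open>X\<close> and compatibility of the pairs make the error orthogonal to all the
    rows.\<close>
  have F_perp: "F X \<in> ?Y" if X: "X \<in> skew_sol n ps" for X
  proof -
    have Xs: "X \<in> skew n" "X \<in> carrier_mat n n" using X by (auto simp: skew_sol_def skew_def)
    have aX: "a * X \<in> rows_of n" using car Xs by auto
    have "dot a (a * X) = - dot a (a * X)"
      unfolding dot_commute[OF car(1) aX] by (rule dot_mult_skew[OF car(1,1) Xs(1)])
    hence "dot a (a * X) = 0" by (rule eq_uminus_self[OF odd])
    hence "dot a (F X) = 0" using ab0 by (simp add: F_def dot_diff_right[OF aX car(2,1)])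
    moreover have "dot a' (F X) = 0" if a': "(a', b') \<in> set ps" for a' b'
    proof -
      have c: "a' \<in> rows_of n" "b' \<in> rows_of n" using a' car by auto
      have eq: "a' * X = b'" using X a' by (auto simp: skew_sol_def)
      have "dot a' (a * X) = - dot b' a"
        unfolding dot_commute[OF c(1) aX] eq[symmetric] by (rule dot_mult_skew[OF car(1) c(1) Xs(1)])
      moreover have "dot a' b = - dot b' a" using orth[OF a'] by (simp add: eq_neg_iff_add_eq_0)
      ultimately show ?thesis by (simp add: F_def dot_diff_right[OF aX car(2) c(1)])
    qed
    ultimately show ?thesis using aX car by (auto simp: perp_def F_def)
  qed
  have sol0: "X \<in> skew_sol n (p # ps) \<longleftrightarrow> X \<in> skew_sol n ps \<and> a * X = b" for X
    by (auto simp: skew_sol_def p)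
  have shift: "a' * (X + wedge n z y) = a' * X + dot a' z \<cdot>\<^sub>m y"
    "a' * (X - wedge n z y) = a' * X - dot a' z \<cdot>\<^sub>m y"
    if "a' \<in> set (a # ?as)" "X \<in> skew n" "y \<in> ?Y" for a' X y
  proof -
    have c: "a' \<in> rows_of n" "X \<in> carrier_mat n n" "y \<in> rows_of n" "dot a' y = 0"
      using that asc p by (auto simp: skew_def perp_def)
    have W: "wedge n z y \<in> carrier_mat n n" by (simp add: wedge_def)
    have aX: "a' * X \<in> rows_of n" using c by auto
    have mw: "a' * wedge n z y = dot a' z \<cdot>\<^sub>m y"
      unfolding mult_wedge[OF c(1) z(1) c(3)] c(4) using c(3) z(1) by (intro row_eqI[of _ n]) auto
    show "a' * (X + wedge n z y) = a' * X + dot a' z \<cdot>\<^sub>m y"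
      using mult_add_distrib_mat[OF c(1,2) W] mw by simp
    show "a' * (X - wedge n z y) = a' * X - dot a' z \<cdot>\<^sub>m y"
      using mult_minus_distrib_mat[OF c(1,2) W] mw by simp
  qed
  have keep: "X + wedge n z y \<in> skew_sol n ps \<and> X - wedge n z y \<in> skew_sol n ps"
    if X: "X \<in> skew_sol n ps" and y: "y \<in> ?Y" for X y
  proof -
    have Xs: "X \<in> skew n" using X by (simp add: skew_sol_def)
    have "a' * (X + wedge n z y) = b' \<and> a' * (X - wedge n z y) = b'" if ab: "(a', b') \<in> set ps" for a' b'
    proof -
      have a': "a' \<in> set ?as" using ab by force
      hence a'': "a' \<in> set (a # ?as)" by simp
      have c: "b' \<in> rows_of n" "y \<in> rows_of n" using ab car y by (auto simp: perp_def)
      have aX: "a' * X = b'" using X ab by (auto simp: skew_sol_def)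
      have az: "dot a' z = 0" using z(3) a' by blast
      have "b' + 0 \<cdot>\<^sub>m y = b'" "b' - 0 \<cdot>\<^sub>m y = b'" using c by (auto intro!: row_eqI[of _ n])
      thus ?thesis unfolding shift[OF a'' Xs y] aX az by blast
    qed
    thus ?thesis using skew_add[OF Xs wedge_skew] skew_diff[OF Xs wedge_skew]
      by (auto simp: skew_sol_def)
  qed
  have yc: "y \<in> rows_of n" if "y \<in> ?Y" for y using that by (simp add: perp_def)
  have Fc: "X \<in> carrier_mat n n" if "X \<in> skew_sol n l" for X l using that by (auto simp: skew_sol_def skew_def)
  have Wc: "wedge n z y \<in> carrier_mat n n" for y by (simp add: wedge_def)
  have a1: "a \<in> set (a # ?as)" by simp
  have F0: "F (X + wedge n z y) = y" if X: "X \<in> skew_sol n (p # ps)" and y: "y \<in> ?Y" for X y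
  proof -
    have Xs: "X \<in> skew n" "a * X = b" using X sol0 by (auto simp: skew_sol_def)
    have "F (X + wedge n z y) = b + 1 \<cdot>\<^sub>m y - b"
      unfolding F_def shift(1)[OF a1 Xs(1) y] Xs(2) z(2) ..
    also have "\<dots> = y" using car(2) yc[OF y] by (intro row_eqI[of _ n]) auto
    finally show ?thesis .
  qed
  have R1: "X + wedge n z y - wedge n z y = X" if "X \<in> skew_sol n (p # ps)" for X y
    using Fc[OF that] Wc[of y] by (intro eq_matI) auto
  have R2: "X - wedge n z y + wedge n z y = X" if "X \<in> skew_sol n ps" for X y
    using Fc[OF that] Wc[of y] by (intro eq_matI) auto
  have R3: "X - wedge n z (F X) \<in> skew_sol n (p # ps)" if X: "X \<in> skew_sol n ps" for X
  proof -
    have Xs: "X \<in> skew n" using X by (simp add: skew_sol_def)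
    have "a * (X - wedge n z (F X)) = a * X - 1 \<cdot>\<^sub>m F X"
      unfolding shift(2)[OF a1 Xs F_perp[OF X]] z(2) ..
    also have "\<dots> = b" using car Fc[OF X] by (intro row_eqI[of _ n]) (auto simp: F_def)
    finally show ?thesis using keep[OF X F_perp[OF X]] sol0 by blast
  qed
  have R4: "X + wedge n z y \<in> skew_sol n ps" if "X \<in> skew_sol n (p # ps)" "y \<in> ?Y" for X y
    using keep that sol0 by blast
  have "bij_betw (\<lambda>(X, y). X + wedge n z y) (skew_sol n (p # ps) \<times> ?Y) (skew_sol n ps)"
    using F0 R1 R2 R3 R4 F_perp
    by (intro bij_betw_byWitness[where f' = "\<lambda>X. (X - wedge n z (F X), F X)"] ballI image_subsetI)
      (simp_all add: mem_Times_iff split_beta prod_eq_iff)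
  from bij_betw_same_card[OF this]
  have 1: "card (skew_sol n (p # ps)) * card ?Y = card (skew_sol n ps)"
    by (simp add: card_cartesian_product)
  have ind: "\<not> lindep n (a # ?as)" using Cons.prems(2) p by simp
  have asc': "set (a # ?as) \<subseteq> rows_of n" using asc p by auto
  have le: "Suc (length ps) \<le> n" and Y: "card ?Y = CARD('k) ^ (n - Suc (length ps))"
    using card_perp_eq[OF asc' ind] by simp_all
  have 2: "card (skew_sol n ps) = CARD('k) ^ ((n - length ps) choose 2)"
  proof (rule Cons.IH[OF car(3)])
    show "\<not> lindep n ?as" using ind by simp
    show "\<forall>(a, b) \<in> set ps. \<forall>(a', b') \<in> set ps. dot a b' + dot b a' = 0"
    proof clarify
      fix c d c' d' assume "(c, d) \<in> set ps" "(c', d') \<in> set ps"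
      thus "dot c d' + dot d c' = 0" using pr[of c d c' d'] by simp
    qed
  qed
  have "n - length ps = Suc (n - Suc (length ps))" using le by simp
  hence ch: "(n - length ps) choose 2 = ((n - Suc (length ps)) choose 2) + (n - Suc (length ps))"
    using choose_two_Suc[of "n - Suc (length ps)"] by (simp only:)
  have eq: "card (skew_sol n (p # ps)) * card ?Y
      = CARD('k) ^ ((n - Suc (length ps)) choose 2) * card ?Y"
    using trans[OF 1 2] unfolding ch power_add Y .
  have nz: "card ?Y \<noteq> 0" unfolding Y by simp
  show ?case using iffD1[OF mult_cancel2 eq] nz unfolding list.size(4) add_Suc_right add_0_right by blast
qed

section \<open>Hyperbolic pairs of frames\<close>

lemma row_append_rows:
  assumes "T \<in> carrier_mat n m" "R \<in> carrier_mat n' m" "i < n + n'"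
  shows "row (T @\<^sub>r R) i = (if i < n then row T i else row R (i - n))"
  using assms by (intro eq_vecI) (auto simp: append_rows_def)

lemma append_rows_mult:
  assumes T: "T \<in> carrier_mat n m" and R: "R \<in> carrier_mat n' m" and X: "X \<in> carrier_mat m l"
  shows "(T @\<^sub>r R) * X = (T * X) @\<^sub>r (R * X)"
proof (rule eq_matI)
  have c: "T @\<^sub>r R \<in> carrier_mat (n + n') m" using T R by simp
  have d: "(T * X) @\<^sub>r (R * X) \<in> carrier_mat (n + n') l" using T R X by simp
  fix i j assume "i < dim_row ((T * X) @\<^sub>r (R * X))" "j < dim_col ((T * X) @\<^sub>r (R * X))"
  hence ij: "i < n + n'" "j < l" using d by auto
  have "((T @\<^sub>r R) * X) $$ (i, j) = row (T @\<^sub>r R) i \<bullet> col X j" using c X ij by simp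
  also have "\<dots> = ((T * X) @\<^sub>r (R * X)) $$ (i, j)"
    unfolding row_append_rows[OF T R ij(1)] using T R X ij by (auto simp: append_rows_def)
  finally show "((T @\<^sub>r R) * X) $$ (i, j) = ((T * X) @\<^sub>r (R * X)) $$ (i, j)" .
qed (use T R X in \<open>auto simp: append_rows_def\<close>)

lemma four_block_mult_append_rows:
  assumes "A \<in> carrier_mat n n" "B \<in> carrier_mat n n" "C \<in> carrier_mat n n" "D \<in> carrier_mat n n"
    and "T \<in> carrier_mat n m" "R \<in> carrier_mat n m"
  shows "four_block_mat A B C D * (T @\<^sub>r R) = (A * T + B * R) @\<^sub>r (C * T + D * R)"
  unfolding append_rows_def
  by (subst mult_four_block_mat[of _ n n _ n _ n _ _ m _ 0]) (use assms in auto)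

lemma assoc4_mat:
  assumes "A \<in> carrier_mat N N" "B \<in> carrier_mat N N" "C \<in> carrier_mat N N" "D \<in> carrier_mat N N"
  shows "A * (B * C * D) = A * B * C * D" "A * (B * (C * D)) = A * B * C * D"
  using assms by (simp_all add: assoc_mult_mat[of _ N N _ N _ N] mult_carrier_mat[of _ N N _ N])

lemma add_eq_zero_mat_iff:
  fixes X Y :: "'k::ring_1 mat"
  assumes "X \<in> carrier_mat n m" "Y \<in> carrier_mat n m"
  shows "X + Y = 0\<^sub>m n m \<longleftrightarrow> X = - Y"
proof
  assume e: "X + Y = 0\<^sub>m n m"
  show "X = - Y"
  proof (rule eq_matI)
    fix i j assume "i < dim_row (- Y)" "j < dim_col (- Y)"
    thus "X $$ (i, j) = (- Y) $$ (i, j)"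
      using arg_cong[OF e, of "\<lambda>M. M $$ (i, j)"] assms by (simp add: eq_neg_iff_add_eq_0)
  qed (use assms in auto)
qed (use assms in \<open>auto intro!: eq_matI\<close>)

locale hyperbolic_space =
  fixes n :: nat and field_type :: "'k::{field,finite} itself"
  assumes odd_q: "odd CARD('k)" and n_pos: "n \<ge> 1"
begin

abbreviation J :: "'k mat" where "J \<equiv> J_mat n"

lemma J_carrier [simp]: "J \<in> carrier_mat (2 * n) (2 * n)"
  using four_block_carrier_mat[of "0\<^sub>m n n :: 'k mat" n n "0\<^sub>m n n" n n] by (simp add: J_mat_def mult_2)

lemma J_transpose: "transpose_mat J = J"
  unfolding J_mat_def by (subst transpose_four_block_mat[of _ n n _ n _ n]) auto

lemma J_square: "J * J = 1\<^sub>m (2 * n)"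
  unfolding J_mat_def
  by (subst mult_four_block_mat[of _ n n _ n _ n _ _ n _ n]) (auto simp: mult_2)

lemma J_mult_append_rows:
  assumes "T \<in> carrier_mat n m" "R \<in> carrier_mat n m"
  shows "J * (T @\<^sub>r R) = R @\<^sub>r T"
  unfolding J_mat_def using assms by (subst four_block_mult_append_rows[of _ n _ _ _ _ m]) auto

text \<open>The bilinear form on row vectors, evaluated at all pairs of rows of two matrices at
  once. For a single row \<open>v\<close>, \<open>form v R\<close> is the row of the products of \<open>v\<close> with the members of
  \<open>R\<close>.\<close>

definition form :: "'k mat \<Rightarrow> 'k mat \<Rightarrow> 'k mat" where
  "form S R = S * J * transpose_mat R"

lemma form_carrier [simp]:
  "S \<in> carrier_mat k (2 * n) \<Longrightarrow> R \<in> carrier_mat l (2 * n) \<Longrightarrow> form S R \<in> carrier_mat k l"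
  unfolding form_def by (auto intro!: mult_carrier_mat[of _ _ "2 * n"])

lemma form_transpose:
  assumes S: "S \<in> carrier_mat k (2 * n)" and R: "R \<in> carrier_mat l (2 * n)"
  shows "transpose_mat (form S R) = form R S"
proof -
  have SJ: "S * J \<in> carrier_mat k (2 * n)" using S by (rule mult_carrier_mat) simp
  have "transpose_mat (form S R) = R * transpose_mat (S * J)"
    unfolding form_def using SJ R by (subst transpose_mult[of _ k "2 * n" _ l]) auto
  also have "transpose_mat (S * J) = J * transpose_mat S"
    using S by (subst transpose_mult[of _ k "2 * n" _ "2 * n"]) (auto simp: J_transpose)
  also have "R * (J * transpose_mat S) = R * J * transpose_mat S"
    using R S by (intro assoc_mult_mat[symmetric, of _ l "2 * n" _ "2 * n" _ k]) auto
  finally show ?thesis by (simp add: form_def)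
qed

lemma form_mult_left:
  assumes A: "A \<in> carrier_mat m k" and S: "S \<in> carrier_mat k (2 * n)" and R: "R \<in> carrier_mat l (2 * n)"
  shows "form (A * S) R = A * form S R"
proof -
  have "A * S * J = A * (S * J)" using A S by (intro assoc_mult_mat[of _ m k _ "2 * n" _ "2 * n"]) auto
  moreover have "A * (S * J) * transpose_mat R = A * (S * J * transpose_mat R)"
    using A S R by (intro assoc_mult_mat[of _ m k _ "2 * n" _ l]) (auto intro!: mult_carrier_mat[of _ _ "2 * n"])
  ultimately show ?thesis by (simp add: form_def)
qed

lemma form_mult_right:
  assumes "A \<in> carrier_mat m l" "S \<in> carrier_mat k (2 * n)" "R \<in> carrier_mat l (2 * n)"
  shows "form S (A * R) = form S R * transpose_mat A"
proof -
  have AR: "A * R \<in> carrier_mat m (2 * n)" using assms by auto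
  have "form S (A * R) = transpose_mat (form (A * R) S)" using form_transpose[OF AR assms(2)] by simp
  also have "form (A * R) S = A * form R S" using assms by (simp add: form_mult_left)
  also have "transpose_mat (A * form R S) = transpose_mat (form R S) * transpose_mat A"
    using assms by (intro transpose_mult[of _ m l _ k]) auto
  finally show ?thesis using assms by (simp add: form_transpose)
qed

lemma form_add_left:
  assumes "S \<in> carrier_mat k (2 * n)" "S' \<in> carrier_mat k (2 * n)" "R \<in> carrier_mat l (2 * n)"
  shows "form (S + S') R = form S R + form S' R"
proof -
  have "(S + S') * J = S * J + S' * J" using assms by (intro add_mult_distrib_mat[of _ k "2 * n" _ _ "2 * n"]) auto
  moreover have "(S * J + S' * J) * transpose_mat R = S * J * transpose_mat R + S' * J * transpose_mat R"
    using assms by (intro add_mult_distrib_mat[of _ k "2 * n" _ _ l]) (auto intro!: mult_carrier_mat[of _ _ "2 * n"])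
  ultimately show ?thesis by (simp add: form_def)
qed

lemma form_add_right:
  assumes "S \<in> carrier_mat k (2 * n)" "R \<in> carrier_mat l (2 * n)" "R' \<in> carrier_mat l (2 * n)"
  shows "form S (R + R') = form S R + form S R'"
proof -
  have "R + R' \<in> carrier_mat l (2 * n)" using assms by simp
  hence "form S (R + R') = transpose_mat (form (R + R') S)" using form_transpose[of "R + R'" l S k] assms by simp
  also have "\<dots> = transpose_mat (form R S + form R' S)" using assms by (simp add: form_add_left)
  also have "\<dots> = form S R + form S R'"
    using assms by (subst transpose_add[of _ l k]) (auto simp: form_transpose)
  finally show ?thesis .
qed

lemma form_smult_left:
  assumes "S \<in> carrier_mat k (2 * n)" "R \<in> carrier_mat l (2 * n)"
  shows "form (c \<cdot>\<^sub>m S) R = c \<cdot>\<^sub>m form S R"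
proof -
  have "c \<cdot>\<^sub>m S * J = c \<cdot>\<^sub>m (S * J)" using assms by (intro mult_smult_assoc_mat[of _ k "2 * n" _ "2 * n"]) auto
  moreover have "c \<cdot>\<^sub>m (S * J) * transpose_mat R = c \<cdot>\<^sub>m (S * J * transpose_mat R)"
    using assms by (intro mult_smult_assoc_mat[of _ k "2 * n" _ l]) (auto intro!: mult_carrier_mat[of _ _ "2 * n"])
  ultimately show ?thesis by (simp add: form_def)
qed

lemma form_append_rows:
  assumes T: "T \<in> carrier_mat n (2 * n)" and R: "R \<in> carrier_mat n (2 * n)"
  shows "form (T @\<^sub>r R) (T @\<^sub>r R) = four_block_mat (form T T) (form T R) (form R T) (form R R)"
proof -
  define g where "g = T @\<^sub>r R"
  have g: "g \<in> carrier_mat (n + n) (2 * n)" using T R by (simp add: g_def)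
  have split: "form g S = form T S @\<^sub>r form R S" if "S \<in> carrier_mat l (2 * n)" for S l
  proof -
    have "g * J = T * J @\<^sub>r R * J" unfolding g_def by (rule append_rows_mult[OF T R J_carrier])
    moreover have "(T * J @\<^sub>r R * J) * transpose_mat S = T * J * transpose_mat S @\<^sub>r R * J * transpose_mat S"
      using T R that by (intro append_rows_mult[of _ n "2 * n" _ n _ l]) auto
    ultimately show ?thesis by (simp add: form_def)
  qed
  have entry: "form S g $$ (i, j) = (if j < n then form S T $$ (i, j) else form S R $$ (i, j - n))"
    if S: "S \<in> carrier_mat n (2 * n)" and ij: "i < n" "j < n + n" for S i j
  proof -
    have c: "form S T \<in> carrier_mat n n" "form S R \<in> carrier_mat n n" using S T R by auto
    have "form S g = transpose_mat (form T S @\<^sub>r form R S)"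
      using split[OF S] form_transpose[OF g S] by simp
    also have "form T S = transpose_mat (form S T)" using form_transpose[OF S T] by simp
    also have "form R S = transpose_mat (form S R)" using form_transpose[OF S R] by simp
    also have "transpose_mat (transpose_mat (form S T) @\<^sub>r transpose_mat (form S R)) $$ (i, j)
      = (if j < n then form S T $$ (i, j) else form S R $$ (i, j - n))"
      using c ij by (auto simp: append_rows_def)
    finally show ?thesis .
  qed
  have c: "form T T \<in> carrier_mat n n" "form T R \<in> carrier_mat n n" "form R T \<in> carrier_mat n n"
    "form R R \<in> carrier_mat n n" "form T g \<in> carrier_mat n (n + n)" "form R g \<in> carrier_mat n (n + n)"
    using T R g by auto
  show ?thesis
    unfolding g_def[symmetric] split[OF g] using c
    by (intro eq_matI) (auto simp: append_rows_def entry[OF T] entry[OF R])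
qed

text \<open>Dual bases of two complementary Lagrangians. Equivalently, \<open>T\<close> stacked on \<open>R\<close> is an
  isometry.\<close>

definition hyper :: "'k mat \<Rightarrow> 'k mat \<Rightarrow> bool" where
  "hyper T R \<longleftrightarrow> T \<in> carrier_mat n (2 * n) \<and> R \<in> carrier_mat n (2 * n) \<and>
     form T T = 0\<^sub>m n n \<and> form R R = 0\<^sub>m n n \<and> form T R = 1\<^sub>m n"

lemma hyperD:
  assumes "hyper T R"
  shows "T \<in> carrier_mat n (2 * n)" "R \<in> carrier_mat n (2 * n)"
    "form T T = 0\<^sub>m n n" "form R R = 0\<^sub>m n n" "form T R = 1\<^sub>m n" "form R T = 1\<^sub>m n"
  using assms form_transpose[of T n R n] by (auto simp: hyper_def)

lemma hyper_sym: "hyper T R \<Longrightarrow> hyper R T"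
  unfolding hyper_def[of R T] using hyperD[of T R] by blast

lemma hyper_isometry:
  assumes "hyper T R"
  shows "(T @\<^sub>r R) * J * transpose_mat (T @\<^sub>r R) = J"
  unfolding form_def[symmetric] form_append_rows[OF hyperD(1,2)[OF assms]] hyperD(3-6)[OF assms]
  by (simp add: J_mat_def)

text \<open>The coordinates of a vector in a hyperbolic basis are its products with the dual basis
  vectors. In matrix terms, an isometry \<open>g\<close> satisfies \<open>g * J * g\<^sup>T = J\<close>; hence \<open>J * g\<^sup>T * J\<close> is
  its two-sided inverse, and the product in the other order is the expansion of the unit
  matrix.\<close>

lemma hyper_expansion:
  assumes h: "hyper T R" and S: "S \<in> carrier_mat k (2 * n)"
  shows "S = form S R * T + form S T * R"
proof -
  note TR = hyperD(1,2)[OF h]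
  define N where "N = 2 * n"
  define g where "g = T @\<^sub>r R"
  have TRN: "T \<in> carrier_mat n N" "R \<in> carrier_mat n N" using TR by (auto simp: N_def)
  have g: "g \<in> carrier_mat N N"
    using carrier_append_rows[OF TRN] by (simp add: g_def N_def mult_2)
  have JN: "J \<in> carrier_mat N N" by (simp add: N_def)
  have gt: "transpose_mat g \<in> carrier_mat N N" using g by simp
  have "g * (J * transpose_mat g * J) = 1\<^sub>m N"
    using assoc4_mat(1)[OF g JN gt JN] hyper_isometry[OF h] J_square by (simp add: g_def N_def)
  moreover have JgJ: "J * transpose_mat g * J \<in> carrier_mat N N" using JN gt by auto
  ultimately have inv: "J * transpose_mat g * J * g = 1\<^sub>m N"
    using mat_mult_left_right_inverse[OF g JgJ] by blast
  have tT: "transpose_mat T \<in> carrier_mat N n" "transpose_mat R \<in> carrier_mat N n" using TRN by auto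
  have tg: "transpose_mat g * (R @\<^sub>r T) = transpose_mat T * R + transpose_mat R * T"
  proof -
    have 1: "transpose_mat g = four_block_mat (transpose_mat T) (transpose_mat R) (0\<^sub>m 0 n) (0\<^sub>m 0 n)"
      unfolding append_rows_def g_def using TRN
      by (subst transpose_four_block_mat[of _ n N _ 0 _ n]) auto
    have 2: "R @\<^sub>r T = four_block_mat R (0\<^sub>m n 0) T (0\<^sub>m n 0)"
      using TRN by (simp add: append_rows_def)
    have "transpose_mat g * (R @\<^sub>r T) = four_block_mat (transpose_mat T * R + transpose_mat R * T)
      (transpose_mat T * 0\<^sub>m n 0 + transpose_mat R * 0\<^sub>m n 0) (0\<^sub>m 0 n * R + 0\<^sub>m 0 n * T)
      (0\<^sub>m 0 n * 0\<^sub>m n 0 + 0\<^sub>m 0 n * 0\<^sub>m n 0)"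
      unfolding 1 2 by (rule mult_four_block_mat[OF tT _ _ TRN(2) _ TRN(1)]) auto
    also have "\<dots> = transpose_mat T * R + transpose_mat R * T"
      using TRN by (intro eq_matI) auto
    finally show ?thesis .
  qed
  have P: "transpose_mat T * R + transpose_mat R * T \<in> carrier_mat N N"
    "transpose_mat T * R \<in> carrier_mat N N" "transpose_mat R * T \<in> carrier_mat N N"
    using TRN tT by auto
  have "J * (transpose_mat T * R + transpose_mat R * T) = J * (transpose_mat g * (J * g))"
    unfolding tg[symmetric] using J_mult_append_rows[OF TRN] by (simp add: g_def)
  also have "\<dots> = 1\<^sub>m N" using assoc4_mat(2)[OF JN gt JN g] inv by simp
  finally have one: "J * (transpose_mat T * R + transpose_mat R * T) = 1\<^sub>m N" .
  have SN: "S \<in> carrier_mat k N" using S by (simp add: N_def)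
  have SJ: "S * J \<in> carrier_mat k N" using SN JN by auto
  have "S = S * (J * (transpose_mat T * R + transpose_mat R * T))" unfolding one using SN by simp
  also have "\<dots> = S * J * (transpose_mat T * R + transpose_mat R * T)"
    by (rule assoc_mult_mat[symmetric, OF SN JN P(1)])
  also have "\<dots> = S * J * (transpose_mat T * R) + S * J * (transpose_mat R * T)"
    by (rule mult_add_distrib_mat[OF SJ P(2,3)])
  also have "S * J * (transpose_mat T * R) = form S T * R"
    unfolding form_def by (rule assoc_mult_mat[symmetric, OF SJ tT(1) TRN(2)])
  also have "S * J * (transpose_mat R * T) = form S R * T"
    unfolding form_def by (rule assoc_mult_mat[symmetric, OF SJ tT(2) TRN(1)])
  also have "form S T * R + form S R * T = form S R * T + form S T * R"
    using S TR by (intro comm_add_mat[of _ k "2 * n"]) (auto intro!: mult_carrier_mat[of _ _ n])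
  finally show ?thesis .
qed

definition frames :: "'k mat set" where "frames = {R. \<exists>T. hyper T R}"

lemma frames_carrier: "R \<in> frames \<Longrightarrow> R \<in> carrier_mat n (2 * n)"
  by (auto simp: frames_def hyper_def)

lemma finite_frames [simp]: "finite frames"
  using frames_carrier by (intro finite_subset[OF _ finite_carrier_mat[of n "2 * n"]]) auto

definition GLs :: "'k mat set" where "GLs = {D \<in> carrier_mat n n. det D \<noteq> 0}"

lemma GLs_inverse:
  assumes "D \<in> GLs"
  obtains D' where "D' \<in> GLs" "D * D' = 1\<^sub>m n" "D' * D = 1\<^sub>m n"
proof -
  have D: "D \<in> carrier_mat n n" "det D \<noteq> 0" using assms by (auto simp: GLs_def)
  from det_non_zero_imp_unit[OF D, unfolded Units_def ring_mat_def]
  obtain D' where D': "D' \<in> carrier_mat n n" "D' * D = 1\<^sub>m n" "D * D' = 1\<^sub>m n" by auto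
  have "det D * det D' = 1" using det_mult[OF D(1) D'(1)] D'(3) by simp
  hence "det D' \<noteq> 0" by auto
  thus ?thesis using that D' by (auto simp: GLs_def)
qed

lemma GLs_transpose: "D \<in> GLs \<Longrightarrow> transpose_mat D \<in> GLs"
  by (auto simp: GLs_def det_transpose)

lemma hyper_GLs:
  assumes h: "hyper T R" and D: "D \<in> carrier_mat n n" "E \<in> carrier_mat n n" and E: "transpose_mat E * D = 1\<^sub>m n"
  shows "hyper (E * T) (D * R)"
proof -
  note hD = hyperD[OF h]
  have ET: "E * T \<in> carrier_mat n (2 * n)" "D * R \<in> carrier_mat n (2 * n)" using hD D by auto
  have "transpose_mat (transpose_mat E * D) = transpose_mat D * E"
    using D by (subst transpose_mult[of _ n n _ n]) auto
  hence "transpose_mat D * E = 1\<^sub>m n" using E by simp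
  hence ED: "E * transpose_mat D = 1\<^sub>m n"
    using mat_mult_left_right_inverse[of "transpose_mat D" n E] D by auto
  show ?thesis
    unfolding hyper_def using ET hD D ED
    by (simp add: form_mult_left[of _ n n _ _ n] form_mult_right[of _ n n _ n])
qed

lemma hyper_shift:
  assumes h: "hyper T R" and X: "X \<in> skew n"
  shows "hyper (T + X * R) R"
proof -
  note hD = hyperD[OF h]
  have Xc: "X \<in> carrier_mat n n" "transpose_mat X = - X" using X by (auto simp: skew_def)
  have XR: "X * R \<in> carrier_mat n (2 * n)" using Xc hD by auto
  have "X + - X = 0\<^sub>m n n" using Xc(1) by (intro eq_matI) auto
  thus ?thesis
    unfolding hyper_def using XR hD Xc
    by (simp add: form_add_left[of _ n _ _ n] form_add_right[of _ n _ n] form_mult_left[of _ n n _ _ n]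
      form_mult_right[of _ n n _ n])
qed

text \<open>By the expansion in the basis \<open>T, R\<close>, a frame dual to \<open>R\<close> has the form \<open>T + X * R\<close>, and
  its isotropy says that \<open>X\<close> is alternating. These frames are the orbit of \<open>T\<close> under the
  unipotent radical.\<close>

lemma opposite_param:
  assumes h: "hyper T R"
  shows "bij_betw (\<lambda>X. T + X * R) (skew n) {R' \<in> frames. form R' R = 1\<^sub>m n}"
proof (rule bij_betw_byWitness[where f' = "\<lambda>R'. form R' T"])
  note hD = hyperD[OF h]
  have opp: "T + X * R \<in> {R' \<in> frames. form R' R = 1\<^sub>m n}" if "X \<in> skew n" for X
    using hyper_shift[OF h that] hyper_sym hyperD(5) by (auto simp: frames_def)
  have inv1: "form (T + X * R) T = X" if "X \<in> skew n" for X
  proof -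
    have "X \<in> carrier_mat n n" using that by (simp add: skew_def)
    thus ?thesis using hD by (simp add: form_add_left[of _ n _ _ n] form_mult_left[of _ n n _ _ n])
  qed
  have forth: "R' = T + form R' T * R" if "R' \<in> carrier_mat n (2 * n)" "form R' R = 1\<^sub>m n" for R'
  proof -
    have "R' = form R' R * T + form R' T * R" by (rule hyper_expansion[OF h that(1)])
    also have "form R' R * T = T" using hD by (simp add: that(2))
    finally show ?thesis .
  qed
  have skew: "form R' T \<in> skew n" if R': "R' \<in> frames" "form R' R = 1\<^sub>m n" for R'
  proof -
    have c: "R' \<in> carrier_mat n (2 * n)" "form R' T \<in> carrier_mat n n"
      using frames_carrier[OF R'(1)] hD by auto
    have "form R' R' = 0\<^sub>m n n" using R' by (auto simp: frames_def hyper_def)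
    also have "form R' R' = form R' (T + form R' T * R)" unfolding forth[OF c(1) R'(2), symmetric] ..
    also have "\<dots> = form R' T + form R' (form R' T * R)"
      using c hD by (intro form_add_right[of _ n _ n]) (auto intro!: mult_carrier_mat[of _ _ n])
    also have "form R' (form R' T * R) = form R' R * transpose_mat (form R' T)"
      by (rule form_mult_right[OF c(2,1) hD(2)])
    also have "\<dots> = transpose_mat (form R' T)" using c(2) by (simp add: R'(2))
    finally have "transpose_mat (form R' T) + form R' T = 0\<^sub>m n n"
      using c comm_add_mat[of "form R' T" n n "transpose_mat (form R' T)"] by simp
    thus ?thesis using c add_eq_zero_mat_iff[of "transpose_mat (form R' T)" n n "form R' T"]
      by (simp add: skew_def)
  qed
  show "\<forall>X \<in> skew n. form (T + X * R) T = X" using inv1 by blast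
  show "\<forall>R' \<in> {R' \<in> frames. form R' R = 1\<^sub>m n}. T + form R' T * R = R'"
    by (simp add: forth[symmetric] frames_carrier)
  show "(\<lambda>X. T + X * R) ` skew n \<subseteq> {R' \<in> frames. form R' R = 1\<^sub>m n}" using opp by blast
  show "(\<lambda>R'. form R' T) ` {R' \<in> frames. form R' R = 1\<^sub>m n} \<subseteq> skew n" using skew by blast
qed

text \<open>A frame orthogonal to \<open>R\<close> has no \<open>T\<close>-component, because a Lagrangian is its own
  orthogonal complement; so it is another basis of the span of \<open>R\<close>.\<close>

lemma same_span_param:
  assumes R: "R \<in> frames"
  shows "bij_betw (\<lambda>D. D * R) GLs {R' \<in> frames. form R' R = 0\<^sub>m n n}"
proof -
  obtain T where h: "hyper T R" using R by (auto simp: frames_def)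
  note hD = hyperD[OF h]
  show ?thesis
  proof (rule bij_betw_byWitness[where f' = "\<lambda>R'. form R' T"])
    show "\<forall>D \<in> GLs. form (D * R) T = D"
      using hD by (auto simp: GLs_def form_mult_left[of _ n n _ _ n])
    have forth: "R' = form R' T * R" if "R' \<in> frames" "form R' R = 0\<^sub>m n n" for R'
    proof -
      have "R' = form R' R * T + form R' T * R"
        by (rule hyper_expansion[OF h frames_carrier[OF that(1)]])
      also have "form R' R * T = 0\<^sub>m n (2 * n)" using hD by (simp add: that(2))
      also have "\<dots> + form R' T * R = form R' T * R"
        using frames_carrier[OF that(1)] hD
        by (intro left_add_zero_mat) (auto intro!: mult_carrier_mat[of _ _ n])
      finally show ?thesis .
    qed
    show "\<forall>R' \<in> {R' \<in> frames. form R' R = 0\<^sub>m n n}. form R' T * R = R'"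
      by (simp add: forth[symmetric])
    show "(\<lambda>D. D * R) ` GLs \<subseteq> {R' \<in> frames. form R' R = 0\<^sub>m n n}"
    proof (rule image_subsetI)
      fix D assume D: "D \<in> GLs"
      then obtain D' where D': "D' \<in> GLs" "D' * D = 1\<^sub>m n" using GLs_inverse by metis
      have "hyper (transpose_mat D' * T) (D * R)"
        using D D' by (intro hyper_GLs[OF h]) (auto simp: GLs_def)
      thus "D * R \<in> {R' \<in> frames. form R' R = 0\<^sub>m n n}"
        using D hD by (auto simp: frames_def GLs_def form_mult_left[of _ n n _ _ n])
    qed
    show "(\<lambda>R'. form R' T) ` {R' \<in> frames. form R' R = 0\<^sub>m n n} \<subseteq> GLs"
    proof (rule image_subsetI)
      fix R' assume "R' \<in> {R' \<in> frames. form R' R = 0\<^sub>m n n}"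
      hence R': "R' \<in> frames" "form R' R = 0\<^sub>m n n" by auto
      obtain T' where h': "hyper T' R'" using R' by (auto simp: frames_def)
      note hD' = hyperD[OF h']
      let ?D = "form R' T"
      have D: "?D \<in> carrier_mat n n" using hD hD' by auto
      have "1\<^sub>m n = form T' (?D * R)" unfolding forth[OF R', symmetric] using hD'(5) by simp
      also have "\<dots> = form T' R * transpose_mat ?D"
        using hD hD' D by (intro form_mult_right[of _ n n _ n]) auto
      finally have eq: "1\<^sub>m n = form T' R * transpose_mat ?D" .
      have "det (form T' R * transpose_mat ?D) = det (form T' R) * det (transpose_mat ?D)"
        using D hD hD' by (intro det_mult[of _ n]) auto
      hence "1 = det (form T' R) * det (transpose_mat ?D)" unfolding eq[symmetric] by simp
      hence "det ?D \<noteq> 0" using det_transpose[OF D] by auto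
      thus "?D \<in> GLs" using D by (simp add: GLs_def)
    qed
  qed
qed

lemma GLs_frames: "D \<in> GLs \<Longrightarrow> R \<in> frames \<Longrightarrow> D * R \<in> frames"
  using same_span_param[of R] by (auto simp: bij_betw_def)

end

section \<open>The opposition operator on incidence functions\<close>

context hyperbolic_space
begin

text \<open>Each Lagrangian opposite to the span of \<open>R\<close> has exactly one basis dual to \<open>R\<close>. On
  functions of Lagrangians the sum is therefore over all opposite Lagrangians.\<close>

definition opp :: "('k mat \<Rightarrow> complex) \<Rightarrow> 'k mat \<Rightarrow> complex" where
  "opp h = (\<lambda>R. if R \<in> frames then \<Sum>R' \<in> {R' \<in> frames. form R' R = 1\<^sub>m n}. h R' else 0)"

text \<open>A Lagrangian is its own orthogonal complement, so this is the indicator of the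
  Lagrangians that contain \<open>S\<close>.\<close>

definition phi :: "'k mat list \<Rightarrow> 'k mat \<Rightarrow> complex" where
  "phi S = (\<lambda>R. if R \<in> frames \<and> (\<forall>v \<in> set S. form v R = 0\<^sub>m 1 n) then 1 else 0)"

text \<open>In the sense of \<open>phi\<close>, \<open>form v R = 0\<close> says that the Lagrangian contains \<open>v\<close>; so this is
  the indicator of the Lagrangians that meet the span of \<open>S\<close> trivially.\<close>

definition avoid :: "'k mat list \<Rightarrow> 'k mat \<Rightarrow> complex" where
  "avoid S = (\<lambda>R. if R \<in> frames \<and>
     (\<forall>v \<in> lspan (2 * n) S. form v R = 0\<^sub>m 1 n \<longrightarrow> v = 0\<^sub>m 1 (2 * n)) then 1 else 0)"

definition isotropic :: "'k mat list \<Rightarrow> bool" where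
  "isotropic S \<longleftrightarrow> (\<forall>v \<in> set S. \<forall>w \<in> set S. form v w = 0\<^sub>m 1 1)"

lemma form_row_zero:
  assumes "R \<in> carrier_mat n (2 * n)" shows "form (0\<^sub>m 1 (2 * n)) R = 0\<^sub>m 1 n"
  using assms carrier_matD[OF J_carrier] by (simp add: form_def)

lemma lspan_form:
  assumes R: "R \<in> carrier_mat n (2 * n)"
  shows "set S \<subseteq> rows_of (2 * n) \<Longrightarrow>
    lspan n (map (\<lambda>v. form v R) S) = (\<lambda>v. form v R) ` lspan (2 * n) S"
proof (induction S)
  case Nil
  show ?case using form_row_zero[OF R] by simp
next
  case (Cons v S)
  have f: "form (c \<cdot>\<^sub>m v + s) R = c \<cdot>\<^sub>m form v R + form s R" if "s \<in> lspan (2 * n) S" for c s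
  proof -
    have c: "v \<in> rows_of (2 * n)" "s \<in> rows_of (2 * n)"
      using Cons.prems that lspan_closed[of S "2 * n"] by auto
    hence cv: "c \<cdot>\<^sub>m v \<in> rows_of (2 * n)" by simp
    show ?thesis unfolding form_add_left[OF cv c(2) R] form_smult_left[OF c(1) R] ..
  qed
  have IH: "lspan n (map (\<lambda>v. form v R) S) = (\<lambda>v. form v R) ` lspan (2 * n) S"
    using Cons by simp
  show ?case
  proof (intro equalityI subsetI)
    fix a assume "a \<in> lspan n (map (\<lambda>v. form v R) (v # S))"
    then obtain c s where "a = c \<cdot>\<^sub>m form v R + form s R" "s \<in> lspan (2 * n) S"
      using IH by auto
    thus "a \<in> (\<lambda>v. form v R) ` lspan (2 * n) (v # S)"
      using f[of s c] by (intro image_eqI[of _ _ "c \<cdot>\<^sub>m v + s"]) auto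
  next
    fix a assume "a \<in> (\<lambda>v. form v R) ` lspan (2 * n) (v # S)"
    then obtain c s where a: "a = form (c \<cdot>\<^sub>m v + s) R" "s \<in> lspan (2 * n) S" by auto
    hence "form s R \<in> lspan n (map (\<lambda>v. form v R) S)" using IH by auto
    thus "a \<in> lspan n (map (\<lambda>v. form v R) (v # S))"
      unfolding a(1) f[OF a(2)] by auto
  qed
qed

lemma form_lspan_zero:
  assumes R: "R \<in> carrier_mat n (2 * n)" and S: "set S \<subseteq> rows_of (2 * n)"
    and 0: "\<forall>v \<in> set S. form v R = 0\<^sub>m 1 n" and v: "v \<in> lspan (2 * n) S"
  shows "form v R = 0\<^sub>m 1 n"
proof -
  have "lspan n l \<subseteq> {0\<^sub>m 1 n}" if "set l \<subseteq> {0\<^sub>m 1 n :: 'k mat}" for l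
    using that by (induction l) (auto intro!: eq_matI)
  moreover have "set (map (\<lambda>v. form v R) S) \<subseteq> {0\<^sub>m 1 n}" using 0 by auto
  ultimately show ?thesis using lspan_form[OF R S] v by blast
qed

text \<open>The kernel of \<open>v \<mapsto> form v R\<close> is the span of \<open>R\<close>; where it meets the span of \<open>S\<close>
  trivially, independence survives.\<close>

lemma not_lindep_form:
  assumes R: "R \<in> carrier_mat n (2 * n)"
  shows "set S \<subseteq> rows_of (2 * n) \<Longrightarrow> \<not> lindep (2 * n) S \<Longrightarrow>
    \<forall>v \<in> lspan (2 * n) S. form v R = 0\<^sub>m 1 n \<longrightarrow> v = 0\<^sub>m 1 (2 * n) \<Longrightarrow>
    \<not> lindep n (map (\<lambda>v. form v R) S)"
proof (induction S)
  case (Cons v S)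
  have car: "v \<in> rows_of (2 * n)" "set S \<subseteq> rows_of (2 * n)" using Cons.prems by auto
  have sub: "lspan (2 * n) S \<subseteq> lspan (2 * n) (v # S)" by (rule lspan_mono_Cons[OF Cons.prems(1)])
  hence IH: "\<not> lindep n (map (\<lambda>v. form v R) S)" using Cons by auto
  moreover have "form v R \<notin> lspan n (map (\<lambda>v. form v R) S)"
  proof
    assume "form v R \<in> lspan n (map (\<lambda>v. form v R) S)"
    then obtain s where s: "s \<in> lspan (2 * n) S" "form v R = form s R"
      unfolding lspan_form[OF R car(2)] by blast
    have sc: "s \<in> rows_of (2 * n)" using s lspan_closed[OF car(2)] by auto
    have "form (v + (-1) \<cdot>\<^sub>m s) R = form v R + (-1) \<cdot>\<^sub>m form s R"
      using form_add_left[OF car(1) _ R, of "(-1) \<cdot>\<^sub>m s"] form_smult_left[OF sc R] sc by simp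
    also have "\<dots> = 0\<^sub>m 1 n"
      unfolding s(2) using form_carrier[OF sc R] by (intro row_eqI[of _ n]) auto
    finally have z: "form (v + (-1) \<cdot>\<^sub>m s) R = 0\<^sub>m 1 n" .
    have "v + (-1) \<cdot>\<^sub>m s = 1 \<cdot>\<^sub>m v + (-1) \<cdot>\<^sub>m s"
      using car sc by (intro eq_matI) auto
    hence "v + (-1) \<cdot>\<^sub>m s \<in> lspan (2 * n) (v # S)"
      using lspan_ConsI[OF lspan_smult[OF car(2) s(1), of "-1"], of 1 v] by simp
    hence z': "v + (-1) \<cdot>\<^sub>m s = 0\<^sub>m 1 (2 * n)" using z Cons.prems(3) by blast
    have "v = s"
    proof (rule row_eqI[OF car(1) sc])
      fix i assume "i < 2 * n"
      thus "v $$ (0, i) = s $$ (0, i)"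
        using arg_cong[OF z', of "\<lambda>M. M $$ (0, i)"] car sc by simp
    qed
    thus False using s Cons.prems(2) by simp
  qed
  ultimately show ?case by simp
qed simp

lemma form_rows_expansion:
  assumes h: "hyper T R" and v: "v \<in> rows_of (2 * n)" and w: "w \<in> rows_of (2 * n)"
  shows "form v w $$ (0, 0) = dot (form v R) (form w T) + dot (form v T) (form w R)"
proof -
  note hD = hyperD[OF h]
  have c: "form v R \<in> rows_of n" "form v T \<in> rows_of n" "form w R \<in> rows_of n" "form w T \<in> rows_of n"
    using v w hD by auto
  have p: "form v R * T \<in> rows_of (2 * n)" "form v T * R \<in> rows_of (2 * n)"
    using c hD by (auto intro!: mult_carrier_mat[of _ _ n])
  have "form v w = form (form v R * T + form v T * R) w"
    using hyper_expansion[OF h v] by (rule arg_cong)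
  also have "\<dots> = form v R * form T w + form v T * form R w"
    unfolding form_add_left[OF p w] form_mult_left[OF c(1) hD(1) w] form_mult_left[OF c(2) hD(2) w] ..
  also have "form T w = transpose_mat (form w T)" using form_transpose[OF w hD(1)] by simp
  also have "form R w = transpose_mat (form w R)" using form_transpose[OF w hD(2)] by simp
  finally have e: "form v w = form v R * transpose_mat (form w T) + form v T * transpose_mat (form w R)" .
  show ?thesis
    unfolding e using c by (simp add: dot_eq_mult_transpose[of _ n])
qed

lemma phi_at_shift:
  assumes h: "hyper T R" and X: "X \<in> skew n" and v: "v \<in> rows_of (2 * n)"
  shows "form v (T + X * R) = 0\<^sub>m 1 n \<longleftrightarrow> form v R * X = form v T"
proof -
  note hD = hyperD[OF h]
  have Xc: "X \<in> carrier_mat n n" "transpose_mat X = - X" using X by (auto simp: skew_def)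
  have XR: "X * R \<in> carrier_mat n (2 * n)" using Xc hD by auto
  have c: "form v R \<in> rows_of n" "form v T \<in> rows_of n" using v hD by auto
  have cX: "form v R * X \<in> rows_of n" using c Xc by auto
  have "form v (T + X * R) = form v T + - (form v R * X)"
    unfolding form_add_right[OF v hD(1) XR] form_mult_right[OF Xc(1) v hD(2)] Xc(2)
    using c(1) Xc(1) by simp
  also have "\<dots> = 0\<^sub>m 1 n \<longleftrightarrow> form v T = form v R * X"
    using add_eq_zero_mat_iff[of "form v T" 1 n "- (form v R * X)"] c cX
    by (simp add: uminus_carrier_iff_mat)
  finally show ?thesis by auto
qed

text \<open>The frame \<open>T + X * R\<close> is orthogonal to \<open>v\<close> if and only if \<open>X\<close> has a prescribed value at
  the row \<open>form v R\<close>.\<close>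

lemma opp_phi_eq_card:
  assumes h: "hyper T R" and S: "set S \<subseteq> rows_of (2 * n)"
  shows "opp (phi S) R = of_nat (card (skew_sol n (map (\<lambda>v. (form v R, form v T)) S)))"
proof -
  let ?ps = "map (\<lambda>v. (form v R, form v T)) S"
  have R: "R \<in> frames" using h by (auto simp: frames_def)
  have fin: "finite (skew n :: 'k mat set)" by (rule finite_subset[of _ "carrier_mat n n"]) (auto simp: skew_def)
  have "opp (phi S) R = (\<Sum>R' \<in> {R' \<in> frames. form R' R = 1\<^sub>m n}. phi S R')"
    using R by (simp add: opp_def)
  also have "\<dots> = (\<Sum>X \<in> skew n. phi S (T + X * R))"
    by (rule sum.reindex_bij_betw[OF opposite_param[OF h], symmetric])
  also have "\<dots> = (\<Sum>X \<in> skew n. if X \<in> skew_sol n ?ps then 1 else 0)"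
  proof (rule sum.cong)
    fix X :: "'k mat" assume X: "X \<in> skew n"
    have "T + X * R \<in> frames" using hyper_sym[OF hyper_shift[OF h X]] by (auto simp: frames_def)
    moreover have "(\<forall>v \<in> set S. form v (T + X * R) = 0\<^sub>m 1 n) \<longleftrightarrow> (\<forall>v \<in> set S. form v R * X = form v T)"
      using phi_at_shift[OF h X] S by blast
    ultimately show "phi S (T + X * R) = (if X \<in> skew_sol n ?ps then 1 else 0)"
      using X by (simp add: phi_def skew_sol_def)
  qed simp
  also have "\<dots> = of_nat (card {X \<in> skew n. X \<in> skew_sol n ?ps})"
    using fin by (simp add: sum.If_cases Int_def)
  also have "{X \<in> skew n. X \<in> skew_sol n ?ps} = skew_sol n ?ps" by (auto simp: skew_sol_def)
  finally show ?thesis .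
qed

text \<open>If the span of \<open>S\<close> avoids the Lagrangian of \<open>R\<close>, then the prescribed rows are
  independent, and isotropy of \<open>S\<close> is their compatibility; so the count of alternating matrices
  applies. If a nonzero vector of the span lies in the Lagrangian of \<open>R\<close>, no opposite Lagrangian
  contains it.\<close>

lemma opp_phi:
  assumes S: "set S \<subseteq> rows_of (2 * n)" and ind: "\<not> lindep (2 * n) S" and iso: "isotropic S"
  shows "opp (phi S) = fun_scale (of_nat CARD('k) ^ ((n - length S) choose 2)) (avoid S)"
proof
  fix R
  show "opp (phi S) R = fun_scale (of_nat CARD('k) ^ ((n - length S) choose 2)) (avoid S) R"
  proof (cases "R \<in> frames")
    case False thus ?thesis by (simp add: opp_def avoid_def fun_scale_def)
  next
    case True
    then obtain T where h: "hyper T R" using hyper_sym by (auto simp: frames_def)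
    note hD = hyperD[OF h]
    let ?ps = "map (\<lambda>v. (form v R, form v T)) S"
    show ?thesis
    proof (cases "\<forall>v \<in> lspan (2 * n) S. form v R = 0\<^sub>m 1 n \<longrightarrow> v = 0\<^sub>m 1 (2 * n)")
      case avoids: True
      have fst: "map fst ?ps = map (\<lambda>v. form v R) S" by simp
      have "card (skew_sol n ?ps) = CARD('k) ^ ((n - length ?ps) choose 2)"
      proof (rule card_skew_sol[OF odd_q])
        show "set ?ps \<subseteq> rows_of n \<times> rows_of n" using S hD(1,2) by (auto simp: subset_iff)
        show "\<not> lindep n (map fst ?ps)"
          unfolding fst by (rule not_lindep_form[OF hD(2) S ind avoids])
        have "dot (form v R) (form w T) + dot (form v T) (form w R) = 0"
          if "v \<in> set S" "w \<in> set S" for v w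
          using form_rows_expansion[OF h, of v w] that S iso by (simp add: isotropic_def subset_iff)
        thus "\<forall>(a, b) \<in> set ?ps. \<forall>(a', b') \<in> set ?ps. dot a b' + dot b a' = 0"
          by auto
      qed
      thus ?thesis
        using True avoids by (simp add: opp_phi_eq_card[OF h S] avoid_def fun_scale_def)
    next
      case False
      then obtain v where v: "v \<in> lspan (2 * n) S" "form v R = 0\<^sub>m 1 n" "v \<noteq> 0\<^sub>m 1 (2 * n)" by blast
      have vc: "v \<in> rows_of (2 * n)" using v lspan_closed[OF S] by auto
      have "X \<notin> skew_sol n ?ps" for X
      proof
        assume X: "X \<in> skew_sol n ?ps"
        hence Xs: "X \<in> skew n" by (simp add: skew_sol_def)
        let ?R' = "T + X * R"
        note h' = hyper_shift[OF h Xs]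
        have "\<forall>w \<in> set S. form w ?R' = 0\<^sub>m 1 n"
          using X phi_at_shift[OF h Xs] S by (auto simp: skew_sol_def)
        hence z: "form v ?R' = 0\<^sub>m 1 n"
          by (rule form_lspan_zero[OF hyperD(1)[OF h'] S _ v(1)])
        have "v = form v R * ?R' + form v ?R' * R" by (rule hyper_expansion[OF h' vc])
        also have "\<dots> = 0\<^sub>m 1 (2 * n)"
          unfolding z v(2) left_mult_zero_mat[OF hyperD(1)[OF h']] left_mult_zero_mat[OF hyperD(2)[OF h']]
          by simp
        finally show False using v(3) by blast
      qed
      hence "skew_sol n ?ps = {}" by blast
      moreover have "avoid S R = 0" using False by (simp add: avoid_def)
      ultimately show ?thesis by (simp add: opp_phi_eq_card[OF h S] fun_scale_def)
    qed
  qed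
qed

lemma phi_not_isotropic:
  assumes S: "set S \<subseteq> rows_of (2 * n)" and iso: "\<not> isotropic S"
  shows "phi S = 0"
proof
  fix R
  have False if R: "R \<in> frames" and 0: "\<forall>v \<in> set S. form v R = 0\<^sub>m 1 n"
  proof -
    obtain T where h: "hyper T R" using R by (auto simp: frames_def)
    note hD = hyperD[OF h]
    obtain v w where vw: "v \<in> set S" "w \<in> set S" "form v w \<noteq> 0\<^sub>m 1 1"
      using iso by (auto simp: isotropic_def)
    have c: "v \<in> rows_of (2 * n)" "w \<in> rows_of (2 * n)" using vw S by auto
    have "form v R = 0\<^sub>m 1 n" "form w R = 0\<^sub>m 1 n" using 0 vw by auto
    hence "form v w $$ (0, 0) = 0"
      using form_rows_expansion[OF h c] dot_zero(1)[OF form_carrier[OF c(2) hD(1)]]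
        dot_zero(2)[OF form_carrier[OF c(1) hD(1)]] by simp
    hence "form v w = 0\<^sub>m 1 1" using c by (intro row_eqI[of _ 1]) auto
    thus False using vw by blast
  qed
  thus "phi S R = 0 R" by (auto simp: phi_def)
qed

end

section \<open>The filtration by incidence functions\<close>

lemma sum_fun_apply: "(\<Sum>i\<in>A. f i) x = (\<Sum>i\<in>A. f i x)"
  by (induction A rule: infinite_finite_induct) auto

context hyperbolic_space
begin

text \<open>The inequality is strict so that \<open>Filt 0\<close> vanishes and \<open>opp\<close> acts on \<open>Filt (Suc k)\<close>
  modulo \<open>Filt k\<close> by the \<open>k\<close>-th diagonal entry.\<close>

definition Filt :: "nat \<Rightarrow> ('k mat \<Rightarrow> complex) set" where
  "Filt k = fun_space.span {phi S | S. set S \<subseteq> rows_of (2 * n) \<and> length S < k}"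

lemma Filt_subspace: "fun_space.subspace (Filt k)"
  by (simp add: Filt_def)

lemmas Filt_add = fun_space.subspace_add[OF Filt_subspace]
  and Filt_diff = fun_space.subspace_diff[OF Filt_subspace]
  and Filt_scale = fun_space.subspace_scale[OF Filt_subspace]
  and Filt_sum = fun_space.subspace_sum[OF Filt_subspace]

lemma phi_in_Filt: "set S \<subseteq> rows_of (2 * n) \<Longrightarrow> length S < k \<Longrightarrow> phi S \<in> Filt k"
  unfolding Filt_def by (intro fun_space.span_base) blast

lemma Filt_mono: "i \<le> j \<Longrightarrow> Filt i \<subseteq> Filt j"
  unfolding Filt_def by (intro fun_space.span_mono) auto

lemma Filt_0: "Filt 0 = {0}"
  by (simp add: Filt_def)

lemma Filt_induct [consumes 1, case_names zero add]:
  assumes "f \<in> Filt k" "P 0"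
    and "\<And>c S f. set S \<subseteq> rows_of (2 * n) \<Longrightarrow> length S < k \<Longrightarrow> f \<in> Filt k \<Longrightarrow> P f \<Longrightarrow> P (fun_scale c (phi S) + f)"
  shows "P f"
proof -
  have "f \<in> Filt k \<and> P f"
    using assms(1) unfolding Filt_def
  proof (induction rule: fun_space.span_induct_alt)
    case base thus ?case using assms(2) fun_space.span_zero by blast
  next
    case (step c x y)
    then obtain S where S: "x = phi S" "set S \<subseteq> rows_of (2 * n)" "length S < k" by blast
    have y: "y \<in> Filt k" "P y" using step by (auto simp: Filt_def)
    have "fun_scale c x + y \<in> Filt k"
      using y(1) phi_in_Filt[OF S(2,3)] S(1) Filt_add Filt_scale by blast
    thus ?case using assms(3)[OF S(2,3) y, of c] unfolding S(1) Filt_def by blast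
  qed
  thus ?thesis ..
qed

lemma phi_append: "phi S * phi S' = phi (S @ S')"
  by (auto simp: phi_def fun_eq_iff)

lemma Filt_mult_phi:
  assumes f: "f \<in> Filt k" and w: "w \<in> rows_of (2 * n)"
  shows "f * phi [w] \<in> Filt (Suc k)"
  using f
proof (induction rule: Filt_induct)
  case zero
  have "(0 :: 'k mat \<Rightarrow> complex) * phi [w] = 0" by (rule mult_zero_left)
  thus ?case using fun_space.subspace_0[OF Filt_subspace[of "Suc k"]] by (simp only:)
next
  case (add c S f)
  have e: "(fun_scale c (phi S) + f) * phi [w] = fun_scale c (phi (S @ [w])) + f * phi [w]"
    unfolding phi_append[symmetric] by (simp add: fun_eq_iff fun_scale_def algebra_simps)
  have "phi (S @ [w]) \<in> Filt (Suc k)" using add w by (intro phi_in_Filt) auto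
  thus ?case unfolding e using add.IH Filt_add Filt_scale by blast
qed

text \<open>A Lagrangian containing \<open>S\<close> contains \<open>v + s\<close> exactly if it contains \<open>v\<close>.\<close>

lemma phi_mult_adjoin:
  assumes S: "set (v # S) \<subseteq> rows_of (2 * n)" and s: "s \<in> lspan (2 * n) S"
  shows "phi S * phi [v + s] = phi (v # S)"
proof
  fix R
  have c: "v \<in> rows_of (2 * n)" "s \<in> rows_of (2 * n)" "set S \<subseteq> rows_of (2 * n)"
    using S s lspan_closed[of S "2 * n"] by auto
  have "form (v + s) R = 0\<^sub>m 1 n \<longleftrightarrow> form v R = 0\<^sub>m 1 n"
    if R: "R \<in> frames" and 0: "\<forall>w \<in> set S. form w R = 0\<^sub>m 1 n"
  proof -
    note Rc = frames_carrier[OF R]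
    have "form s R = 0\<^sub>m 1 n" by (rule form_lspan_zero[OF Rc c(3) 0 s])
    hence "form (v + s) R = form v R"
      unfolding form_add_left[OF c(1,2) Rc] using form_carrier[OF c(1) Rc]
      by (intro row_eqI[of _ n]) auto
    thus ?thesis by simp
  qed
  thus "(phi S * phi [v + s]) R = phi (v # S) R"
    unfolding times_fun_def by (auto simp: phi_def)
qed

text \<open>If a Lagrangian avoids the span of \<open>S\<close> but not that of \<open>v # S\<close>, it contains a vector
  \<open>v + s\<close>, after scaling, and only one, since the difference of two would lie in the span of
  \<open>S\<close>.\<close>

lemma avoid_Cons:
  assumes S: "set (v # S) \<subseteq> rows_of (2 * n)" and ind: "\<not> lindep (2 * n) (v # S)"
  shows "avoid (v # S) = avoid S - (\<Sum>s \<in> lspan (2 * n) S. avoid S * phi [v + s])"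
proof
  fix R
  let ?N = "2 * n"
  have c: "v \<in> rows_of ?N" "set S \<subseteq> rows_of ?N" using S by auto
  have sc: "s \<in> rows_of ?N" if "s \<in> lspan ?N S" for s using lspan_closed[OF c(2)] that by auto
  have fin: "finite (lspan ?N S)" using sc by (intro finite_subset[OF _ finite_carrier_mat[of 1 ?N]]) auto
  have sub: "lspan ?N S \<subseteq> lspan ?N (v # S)" by (rule lspan_mono_Cons[OF S])
  have rhs: "(avoid S - (\<Sum>s \<in> lspan ?N S. avoid S * phi [v + s])) R
    = avoid S R - (\<Sum>s \<in> lspan ?N S. avoid S R * phi [v + s] R)"
    by (simp add: sum_fun_apply)
  show "avoid (v # S) R = (avoid S - (\<Sum>s \<in> lspan ?N S. avoid S * phi [v + s])) R"
  proof (cases "avoid S R = 0")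
    case True
    hence "avoid (v # S) R = 0" using sub by (auto simp: avoid_def simp del: lspan.simps split: if_splits)
    thus ?thesis unfolding rhs using True by simp
  next
    case False
    hence one: "avoid S R = 1" and R: "R \<in> frames"
      and av: "\<And>w. w \<in> lspan ?N S \<Longrightarrow> form w R = 0\<^sub>m 1 n \<Longrightarrow> w = 0\<^sub>m 1 ?N"
      by (auto simp: avoid_def split: if_splits)
    note Rc = frames_carrier[OF R]
    let ?K = "{s \<in> lspan ?N S. form (v + s) R = 0\<^sub>m 1 n}"
    have "(\<Sum>s \<in> lspan ?N S. avoid S R * phi [v + s] R) = (\<Sum>s \<in> lspan ?N S. if s \<in> ?K then 1 else 0)"
      using one R by (intro sum.cong) (auto simp: phi_def)
    also have "\<dots> = of_nat (card ?K)"
      using fin by (simp add: sum.If_cases Int_def)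
    finally have cnt: "(\<Sum>s \<in> lspan ?N S. avoid S R * phi [v + s] R) = of_nat (card ?K)" .
    have uniq: "s = t" if st: "s \<in> ?K" "t \<in> ?K" for s t
    proof -
      have cs: "s \<in> rows_of ?N" "t \<in> rows_of ?N" using st sc by auto
      have vs: "form v R + form s R = 0\<^sub>m 1 n" "form v R + form t R = 0\<^sub>m 1 n"
        using st form_add_left[OF c(1) cs(1) Rc] form_add_left[OF c(1) cs(2) Rc] by auto
      have fc: "form v R \<in> rows_of n" "form s R \<in> rows_of n" "form t R \<in> rows_of n"
        using c cs Rc by auto
      have "s - t = s + (-1) \<cdot>\<^sub>m t" using cs by (intro row_eqI[of _ ?N]) auto
      hence "form (s - t) R = form s R + (-1) \<cdot>\<^sub>m form t R"
        using form_add_left[OF cs(1) _ Rc, of "(-1) \<cdot>\<^sub>m t"] form_smult_left[OF cs(2) Rc] cs by simp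
      also have "\<dots> = 0\<^sub>m 1 n"
      proof (rule row_eqI[of _ n])
        fix i assume i: "i < n"
        have "form v R $$ (0, i) + form s R $$ (0, i) = form v R $$ (0, i) + form t R $$ (0, i)"
          using arg_cong[OF trans[OF vs(1) vs(2)[symmetric]], of "\<lambda>M. M $$ (0, i)"] fc i by simp
        thus "(form s R + (-1) \<cdot>\<^sub>m form t R) $$ (0, i) = 0\<^sub>m 1 n $$ (0, i)"
          using fc i by simp
      qed (use fc in auto)
      finally have "s - t = 0\<^sub>m 1 ?N" using av lspan_diff[OF c(2)] st by blast
      hence "(s - t) $$ (0, i) = 0" if "i < ?N" for i using that by simp
      thus ?thesis using cs by (intro row_eqI[of _ ?N]) auto
    qed
    have "avoid (v # S) R = 1 \<longleftrightarrow> ?K = {}"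
    proof
      assume "avoid (v # S) R = 1"
      hence a: "w = 0\<^sub>m 1 ?N" if "w \<in> lspan ?N (v # S)" "form w R = 0\<^sub>m 1 n" for w
        using that by (auto simp: avoid_def split: if_splits)
      show "?K = {}"
      proof (rule ccontr)
        assume "?K \<noteq> {}"
        then obtain s where s: "s \<in> lspan ?N S" "form (v + s) R = 0\<^sub>m 1 n" by blast
        have "v + s = 1 \<cdot>\<^sub>m v + s" using c sc[OF s(1)] by (intro row_eqI[of _ ?N]) auto
        hence "v + s \<in> lspan ?N (v # S)" using lspan_ConsI[OF s(1)] by metis
        from a[OF this s(2)] have e: "v + s = 0\<^sub>m 1 ?N" .
        have "v = (-1) \<cdot>\<^sub>m s"
        proof (rule row_eqI[of _ ?N])
          fix i assume "i < ?N"
          thus "v $$ (0, i) = ((-1) \<cdot>\<^sub>m s) $$ (0, i)"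
            using arg_cong[OF e, of "\<lambda>M. M $$ (0, i)"] c sc[OF s(1)]
            by (simp add: eq_neg_iff_add_eq_0)
        qed (use c sc[OF s(1)] in auto)
        thus False using lspan_smult[OF c(2) s(1), of "-1"] ind by simp
      qed
    next
      assume K: "?K = {}"
      have "w = 0\<^sub>m 1 ?N" if w: "w \<in> lspan ?N (v # S)" "form w R = 0\<^sub>m 1 n" for w
      proof -
        obtain a s where as: "w = a \<cdot>\<^sub>m v + s" "s \<in> lspan ?N S" using w by auto
        note ss = sc[OF as(2)]
        have "a = 0"
        proof (rule ccontr)
          assume a: "a \<noteq> 0"
          have cc: "inverse a \<cdot>\<^sub>m s \<in> lspan ?N S" by (rule lspan_smult[OF c(2) as(2)])
          have "v + inverse a \<cdot>\<^sub>m s = inverse a \<cdot>\<^sub>m w"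
            unfolding as(1) using c ss a by (intro row_eqI[of _ ?N]) (auto simp: field_simps)
          moreover have "w \<in> rows_of ?N" unfolding as(1) using c ss by simp
          ultimately have "form (v + inverse a \<cdot>\<^sub>m s) R = inverse a \<cdot>\<^sub>m form w R"
            using form_smult_left[OF _ Rc] by simp
          also have "\<dots> = 0\<^sub>m 1 n" unfolding w(2) by (intro row_eqI[of _ n]) auto
          finally show False using K cc by blast
        qed
        hence "w = s" unfolding as(1) using c ss by (intro row_eqI[of _ ?N]) auto
        thus ?thesis using av as(2) w(2) by simp
      qed
      thus "avoid (v # S) R = 1" using R by (simp add: avoid_def)
    qed
    hence av01: "avoid (v # S) R = (if ?K = {} then 1 else 0)"
      by (auto simp: avoid_def)
    show ?thesis
    proof (cases "?K = {}")
      case True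
      show ?thesis unfolding rhs cnt unfolding av01 one True by simp
    next
      case nempty: False
      then obtain s where s: "s \<in> ?K" by blast
      hence "?K = {s}" using uniq by blast
      hence "card ?K = 1" by simp
      thus ?thesis unfolding rhs cnt unfolding av01 one using nempty by simp
    qed
  qed
qed

text \<open>A row in the span of the rows after it may be dropped.\<close>

lemma phi_dependent:
  "set S \<subseteq> rows_of (2 * n) \<Longrightarrow> lindep (2 * n) S \<Longrightarrow> phi S \<in> Filt (length S)"
proof (induction S)
  case (Cons v S)
  hence c: "v \<in> rows_of (2 * n)" "set S \<subseteq> rows_of (2 * n)" by auto
  show ?case
  proof (cases "v \<in> lspan (2 * n) S")
    case True
    have "phi (v # S) = phi S"
    proof
      fix R
      have "form v R = 0\<^sub>m 1 n" if "R \<in> frames" "\<forall>w \<in> set S. form w R = 0\<^sub>m 1 n"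
        by (rule form_lspan_zero[OF frames_carrier[OF that(1)] c(2) that(2) True])
      thus "phi (v # S) R = phi S R" by (auto simp: phi_def)
    qed
    thus ?thesis using phi_in_Filt[OF c(2)] by simp
  next
    case False
    hence "phi S \<in> Filt (length S)" using Cons by auto
    hence "phi S * phi [v] \<in> Filt (Suc (length S))" using Filt_mult_phi c(1) by blast
    moreover have "phi S * phi [v] = phi (v # S)" unfolding phi_append by (auto simp: phi_def)
    ultimately show ?thesis by simp
  qed
qed simp

text \<open>By \<open>avoid_Cons\<close>, adjoining \<open>v\<close> replaces \<open>avoid S\<close>, which lies in lower filtration, by
  minus the sum of its products with the \<open>phi [v + s]\<close>. The leading part of each product is the
  same multiple of \<open>phi (v # S)\<close>, and there are \<open>q ^ length S\<close> of them. Hence the factor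
  \<open>- q ^ length S\<close> at each step.\<close>

lemma avoid_cong_phi:
  "set S \<subseteq> rows_of (2 * n) \<Longrightarrow> \<not> lindep (2 * n) S \<Longrightarrow>
   avoid S - fun_scale ((-1) ^ length S * of_nat CARD('k) ^ (length S choose 2)) (phi S) \<in> Filt (length S)"
proof (induction S)
  case Nil
  have "avoid [] = phi []" by (auto simp: avoid_def phi_def)
  hence "avoid [] - fun_scale ((-1) ^ length [] * of_nat CARD('k) ^ (length [] choose 2)) (phi []) = 0"
    by (simp add: fun_eq_iff fun_scale_def numeral_2_eq_2)
  thus ?case by (simp only: list.size Filt_0 singleton_iff)
next
  case (Cons v S)
  let ?k = "length S" and ?L = "lspan (2 * n) S"
  let ?c = "(-1) ^ ?k * of_nat CARD('k) ^ (?k choose 2) :: complex"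
  have c: "v \<in> rows_of (2 * n)" "set S \<subseteq> rows_of (2 * n)" using Cons.prems by auto
  have sc: "s \<in> rows_of (2 * n)" if "s \<in> ?L" for s using lspan_closed[OF c(2)] that by auto
  define r where "r = avoid S - fun_scale ?c (phi S)"
  have r: "r \<in> Filt ?k" unfolding r_def by (rule Cons.IH[OF c(2)]) (use Cons.prems(2) in simp)
  have av: "avoid S = r + fun_scale ?c (phi S)" by (simp add: r_def)
  have avF: "avoid S \<in> Filt (Suc ?k)"
    unfolding av using r Filt_mono[of ?k "Suc ?k"] phi_in_Filt[OF c(2), of "Suc ?k"]
    by (intro Filt_add Filt_scale) auto
  have rs: "r * phi [v + s] \<in> Filt (Suc ?k)" if "s \<in> ?L" for s
    using Filt_mult_phi[OF r] c(1) sc[OF that] by simp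
  have "avoid S * phi [v + s] = r * phi [v + s] + fun_scale ?c (phi (v # S))" if s: "s \<in> ?L" for s
    unfolding av phi_mult_adjoin[OF Cons.prems(1) s, symmetric]
    by (simp add: fun_eq_iff fun_scale_def algebra_simps)
  hence "(\<Sum>s \<in> ?L. avoid S * phi [v + s])
      = (\<Sum>s \<in> ?L. r * phi [v + s]) + (\<Sum>s \<in> ?L. fun_scale ?c (phi (v # S)))"
    by (simp add: sum.distrib)
  also have "(\<Sum>s \<in> ?L. fun_scale ?c (phi (v # S)))
      = fun_scale (of_nat (card ?L) * ?c) (phi (v # S))"
    by (simp add: fun_eq_iff sum_fun_apply fun_scale_def)
  finally have sum: "(\<Sum>s \<in> ?L. avoid S * phi [v + s])
      = (\<Sum>s \<in> ?L. r * phi [v + s]) + fun_scale (of_nat (card ?L) * ?c) (phi (v # S))" .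
  have card: "card ?L = CARD('k) ^ ?k"
    using card_lspan[OF c(2)] Cons.prems(2) by simp
  have coeff: "(-1) ^ length (v # S) * of_nat CARD('k) ^ (length (v # S) choose 2)
      = - (of_nat (card ?L) * ?c)"
    unfolding card by (simp add: choose_two_Suc power_add)
  have "avoid (v # S) - fun_scale ((-1) ^ length (v # S) * of_nat CARD('k) ^ (length (v # S) choose 2))
      (phi (v # S)) = avoid S - (\<Sum>s \<in> ?L. r * phi [v + s])"
    unfolding coeff avoid_Cons[OF Cons.prems] sum
    by (simp add: fun_eq_iff fun_scale_def)
  also have "\<dots> \<in> Filt (Suc ?k)"
    using avF Filt_sum[of ?L "\<lambda>s. r * phi [v + s]"] rs Filt_diff by blast
  finally show ?case by (simp only: list.size add_0_right add_Suc_right)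
qed

definition lam :: "nat \<Rightarrow> real" where
  "lam k = (-1) ^ k * real CARD('k) ^ ((k choose 2) + ((n - k) choose 2))"

lemma opp_add: "opp (f + g) = opp f + opp g"
  by (auto simp: opp_def fun_eq_iff sum.distrib)

lemma opp_scale: "opp (fun_scale c f) = fun_scale c (opp f)"
  by (auto simp: opp_def fun_eq_iff fun_scale_def sum_distrib_left)

lemma opp_zero: "opp 0 = 0"
  using opp_scale[of 0 0] by simp

text \<open>Rows that are not mutually orthogonal lie in no common isotropic subspace, and then
  \<open>phi S\<close> vanishes. Otherwise the count of \<open>opp_phi\<close> and the congruence \<open>avoid_cong_phi\<close>
  combine.\<close>

lemma opp_phi_triangular:
  assumes S: "set S \<subseteq> rows_of (2 * n)" and ind: "\<not> lindep (2 * n) S"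
  shows "opp (phi S) - fun_scale (of_real (lam (length S))) (phi S) \<in> Filt (length S)"
proof (cases "isotropic S")
  case True
  let ?k = "length S"
  have "opp (phi S) - fun_scale (of_real (lam ?k)) (phi S)
    = fun_scale (of_nat CARD('k) ^ ((n - ?k) choose 2))
       (avoid S - fun_scale ((-1) ^ ?k * of_nat CARD('k) ^ (?k choose 2)) (phi S))"
    unfolding opp_phi[OF S ind True] lam_def
    by (simp add: fun_eq_iff fun_scale_def power_add algebra_simps)
  thus ?thesis using avoid_cong_phi[OF S ind] Filt_scale by simp
next
  case False
  have "fun_scale c (phi S) = 0" for c unfolding phi_not_isotropic[OF S False] by simp
  thus ?thesis
    using phi_not_isotropic[OF S False] fun_space.subspace_0[OF Filt_subspace] by (simp add: opp_zero)
qed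

lemma opp_triangular:
  "f \<in> Filt (Suc k) \<Longrightarrow> opp f - fun_scale (of_real (lam k)) f \<in> Filt k"
proof (induction k arbitrary: f rule: less_induct)
  case (less k)
  have closed: "opp g \<in> Filt k" if g: "g \<in> Filt k" for g
  proof (cases k)
    case 0 thus ?thesis using g by (simp add: Filt_0 opp_zero)
  next
    case (Suc j)
    have gj: "g \<in> Filt (Suc j)" and jk: "j < k" using g Suc by auto
    have "opp g - fun_scale (of_real (lam j)) g \<in> Filt k"
      using less.IH[OF jk gj] Filt_mono[OF less_imp_le[OF jk]] by blast
    from Filt_add[OF this Filt_scale[OF g, of "of_real (lam j)"]] show ?thesis by simp
  qed
  from less.prems show ?case
  proof (induction rule: Filt_induct)
    case zero
    show ?case
      unfolding opp_zero fun_space.scale_zero_right diff_self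
      by (rule fun_space.subspace_0[OF Filt_subspace])
  next
    case (add c S f)
    have "opp (phi S) - fun_scale (of_real (lam k)) (phi S) \<in> Filt k"
    proof (cases "length S < k \<or> lindep (2 * n) S")
      case True
      hence "phi S \<in> Filt k"
        using add phi_in_Filt phi_dependent Filt_mono[of "length S" k] by (metis in_mono less_Suc_eq_le)
      thus ?thesis using closed Filt_scale Filt_diff by blast
    next
      case False
      thus ?thesis using opp_phi_triangular[of S] add by (simp add: less_Suc_eq)
    qed
    note in_Filt = Filt_add[OF Filt_scale[OF this, of c] add.IH]
    have "opp (fun_scale c (phi S) + f) - fun_scale (of_real (lam k)) (fun_scale c (phi S) + f)
      = fun_scale c (opp (phi S) - fun_scale (of_real (lam k)) (phi S))
        + (opp f - fun_scale (of_real (lam k)) f)"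
      unfolding opp_add opp_scale by (simp add: fun_eq_iff fun_scale_def algebra_simps)
    thus ?case using in_Filt by (simp only:)
  qed
qed

lemma opp_closed: "f \<in> Filt k \<Longrightarrow> opp f \<in> Filt k"
proof (cases k)
  case (Suc j)
  assume f: "f \<in> Filt k"
  hence "f \<in> Filt (Suc j)" using Suc by simp
  hence "opp f - fun_scale (of_real (lam j)) f \<in> Filt k"
    using opp_triangular[of f j] Filt_mono[of j k] unfolding Suc by auto
  from Filt_add[OF this Filt_scale[OF f, of "of_real (lam j)"]] show ?thesis by simp
qed (simp add: Filt_0 opp_zero)

lemma opp_opp_triangular:
  assumes f: "f \<in> Filt (Suc k)"
  shows "opp (opp f) - fun_scale (of_real (lam k ^ 2)) f \<in> Filt k"
proof -
  define u where "u = opp f - fun_scale (of_real (lam k)) f"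
  have u: "u \<in> Filt k" unfolding u_def by (rule opp_triangular[OF f])
  have "opp f = u + fun_scale (of_real (lam k)) f" by (simp add: u_def)
  hence "opp (opp f) = opp u + fun_scale (of_real (lam k)) (opp f)"
    unfolding opp_add[symmetric] opp_scale[symmetric] by (rule arg_cong)
  hence "opp (opp f) - fun_scale (of_real (lam k ^ 2)) f
      = opp u + fun_scale (of_real (lam k)) (opp f) - fun_scale (of_real (lam k ^ 2)) f"
    by (rule arg_cong)
  also have "\<dots> = opp u + fun_scale (of_real (lam k)) u"
    unfolding u_def[symmetric] by (simp add: u_def fun_eq_iff fun_scale_def algebra_simps power2_eq_square)
  finally show ?thesis using opp_closed[OF u] Filt_scale[OF u] Filt_add by (simp only:)
qed

subsection \<open>Self-adjointness\<close>

definition inner :: "('k mat \<Rightarrow> complex) \<Rightarrow> ('k mat \<Rightarrow> complex) \<Rightarrow> complex" where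
  "inner f g = (\<Sum>R \<in> frames. f R * cnj (g R))"

lemma form_one_sym:
  assumes "R \<in> frames" "R' \<in> frames"
  shows "form R' R = 1\<^sub>m n \<longleftrightarrow> form R R' = 1\<^sub>m n"
  using form_transpose[OF frames_carrier[OF assms(1)] frames_carrier[OF assms(2)]]
    form_transpose[OF frames_carrier[OF assms(2)] frames_carrier[OF assms(1)]] transpose_one by metis

text \<open>The kernel of \<open>opp\<close> is a real symmetric matrix, because duality of frames is symmetric.\<close>

lemma opp_adjoint: "inner (opp f) g = inner f (opp g)"
proof -
  let ?o = "\<lambda>R R'. if form R' R = 1\<^sub>m n then 1 else 0 :: complex"
  have opp': "opp h R = (\<Sum>R' \<in> frames. ?o R R' * h R')" if "R \<in> frames" for h R
  proof -
    have "opp h R = (\<Sum>R' \<in> frames. if form R' R = 1\<^sub>m n then h R' else 0)"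
      unfolding opp_def using that by (simp add: sum.inter_filter)
    also have "\<dots> = (\<Sum>R' \<in> frames. ?o R R' * h R')" by (intro sum.cong) auto
    finally show ?thesis .
  qed
  have "inner (opp f) g = (\<Sum>R \<in> frames. \<Sum>R' \<in> frames. ?o R R' * f R' * cnj (g R))"
    unfolding inner_def by (intro sum.cong refl) (simp add: opp' sum_distrib_right del: if_distrib)
  also have "\<dots> = (\<Sum>R' \<in> frames. \<Sum>R \<in> frames. ?o R R' * f R' * cnj (g R))"
    by (rule sum.swap)
  also have "\<dots> = (\<Sum>R' \<in> frames. \<Sum>R \<in> frames. f R' * cnj (?o R' R * g R))"
    using form_one_sym by (intro sum.cong refl) (simp; blast)
  also have "\<dots> = inner f (opp g)"
    unfolding inner_def by (intro sum.cong refl) (simp only: opp' sum_distrib_left cnj_sum)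
  finally show ?thesis .
qed

text \<open>With \<open>u = opp (opp f) - c * f\<close>, self-adjointness turns the product of \<open>u\<close> with itself
  into the product of \<open>f\<close> with \<open>opp (opp u) - c * u = 0\<close>. Real \<open>c\<close> is needed to move it across
  the product.\<close>

lemma opp_opp_semisimple:
  fixes c :: real
  assumes f: "\<And>R. R \<notin> frames \<Longrightarrow> f R = 0"
    and eq: "opp (opp (opp (opp f) - fun_scale (of_real c) f))
      = fun_scale (of_real c) (opp (opp f) - fun_scale (of_real c) f)"
  shows "opp (opp f) = fun_scale (of_real c) f"
proof -
  define u where "u = opp (opp f) - fun_scale (of_real c) f"
  have lin: "inner (g - fun_scale (of_real c) h) k = inner g k - of_real c * inner h k"
    "inner h (fun_scale (of_real c) k) = of_real c * inner h k" for g h k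
    by (simp_all add: inner_def fun_scale_def sum_subtractf sum_distrib_left algebra_simps)
  have "inner u u = inner f (opp (opp u)) - of_real c * inner f u"
    by (subst (1) u_def) (simp add: lin opp_adjoint)
  also have "opp (opp u) = fun_scale (of_real c) u" using eq by (simp add: u_def)
  finally have "inner u u = 0" by (simp add: lin)
  hence "(\<Sum>R \<in> frames. of_real ((cmod (u R))\<^sup>2)) = (0 :: complex)"
    unfolding inner_def complex_norm_square .
  hence "(\<Sum>R \<in> frames. (cmod (u R))\<^sup>2) = 0" unfolding of_real_sum[symmetric] of_real_eq_0_iff .
  hence "\<forall>R \<in> frames. u R = 0" by (simp add: sum_nonneg_eq_0_iff)
  moreover have "u R = 0" if "R \<notin> frames" for R
    using that f by (simp add: u_def opp_def fun_scale_def)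
  ultimately have "u = 0" by (metis zero_fun_apply ext)
  thus ?thesis by (simp add: u_def)
qed

end

lemma choose_two_add: "(a + b) choose 2 = (a choose 2) + (b choose 2) + a * b" for a b :: nat
proof (induction a)
  case (Suc a)
  thus ?case unfolding add_Suc choose_two_Suc by simp
qed (simp add: numeral_2_eq_2)

context hyperbolic_space
begin

section \<open>Invariant functions\<close>

definition invariants :: "('k mat \<Rightarrow> complex) set" where
  "invariants = {h. (\<forall>R. R \<notin> frames \<longrightarrow> h R = 0) \<and> (\<forall>R \<in> frames. \<forall>D \<in> GLs. h (D * R) = h R)}"

text \<open>A change of basis does not alter the orthogonal complement of a frame.\<close>

lemma phi_invariant: "phi S \<in> invariants" if S: "set S \<subseteq> rows_of (2 * n)"
proof -
  have "form v (D * R) = 0\<^sub>m 1 n \<longleftrightarrow> form v R = 0\<^sub>m 1 n"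
    if R: "R \<in> frames" and D: "D \<in> GLs" and v: "v \<in> set S" for R D v
  proof -
    have Rc: "R \<in> carrier_mat n (2 * n)" using frames_carrier[OF R] .
    have vc: "v \<in> rows_of (2 * n)" using S v by blast
    have Dc: "D \<in> carrier_mat n n" using D by (simp add: GLs_def)
    obtain E where E: "E \<in> GLs" "transpose_mat D * E = 1\<^sub>m n"
      using GLs_inverse[OF GLs_transpose[OF D]] by metis
    have Ec: "E \<in> carrier_mat n n" using E by (simp add: GLs_def)
    have fc: "form v R \<in> rows_of n" using vc Rc by auto
    have DR: "form v (D * R) = form v R * transpose_mat D" by (rule form_mult_right[OF Dc vc Rc])
    have "form v R = form v R * (transpose_mat D * E)" unfolding E(2) using fc by simp
    also have "\<dots> = form v (D * R) * E"
      unfolding DR using fc Dc Ec by (intro assoc_mult_mat[symmetric, of _ 1 n _ n _ n]) auto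
    finally have Rv: "form v R = form v (D * R) * E" .
    show ?thesis
    proof
      assume z: "form v (D * R) = 0\<^sub>m 1 n"
      show "form v R = 0\<^sub>m 1 n" unfolding Rv z by (rule left_mult_zero_mat[OF Ec])
    next
      assume z: "form v R = 0\<^sub>m 1 n"
      show "form v (D * R) = 0\<^sub>m 1 n" unfolding DR z using Dc by (intro left_mult_zero_mat[of _ n n]) simp
    qed
  qed
  thus ?thesis using GLs_frames by (auto simp: invariants_def phi_def)
qed

lemma invariants_subspace: "fun_space.subspace invariants"
  by (rule fun_space.subspaceI) (auto simp: invariants_def fun_scale_def)

lemma Filt_invariants: "Filt k \<subseteq> invariants"
  unfolding Filt_def by (rule fun_space.span_minimal[OF _ invariants_subspace]) (clarify, rule phi_invariant)

lemma finite_GLs: "finite GLs"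
  by (rule finite_subset[of _ "carrier_mat n n"]) (auto simp: GLs_def)

text \<open>The \<open>n\<close> rows of a frame \<open>R\<close> are contained in no Lagrangian but its own, so their \<open>phi\<close>
  is the indicator of the frames with the same span. An invariant function is the combination of
  these with its own values as coefficients, divided by the number \<open>card GLs\<close> of bases of a
  Lagrangian.\<close>

lemma invariants_Filt: "invariants \<subseteq> Filt (Suc n)"
proof
  fix h assume h: "h \<in> invariants"
  let ?row = "\<lambda>R i. mat 1 (2 * n) (\<lambda>(_, j). R $$ (i, j)) :: 'k mat"
  let ?rows = "\<lambda>R. map (?row R) [0..<n]"
  let ?c = "of_nat (card GLs) :: complex"
  have "1\<^sub>m n \<in> GLs" by (simp add: GLs_def)
  hence c: "?c \<noteq> 0" using finite_GLs by auto
  have phi: "phi (?rows R) R' = (if form R R' = 0\<^sub>m n n then 1 else 0)"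
    if R: "R \<in> frames" "R' \<in> frames" for R R'
  proof -
    note Rc = frames_carrier[OF R(1)] frames_carrier[OF R(2)]
    have entry: "form (?row R i) R' $$ (0, j) = form R R' $$ (i, j)" if ij: "i < n" "j < n" for i j
    proof -
      have "row (?row R i * J) 0 = row (R * J) i"
        using ij Rc carrier_matD[OF J_carrier]
        by (intro eq_vecI) (auto simp: scalar_prod_def intro!: sum.cong)
      thus ?thesis
        using ij Rc carrier_matD[OF J_carrier] by (simp add: form_def)
    qed
    have fc: "form R R' \<in> carrier_mat n n" using Rc by auto
    have rc: "form (?row R i) R' \<in> rows_of n" for i using Rc by auto
    have "(\<forall>i<n. form (?row R i) R' = 0\<^sub>m 1 n) \<longleftrightarrow> form R R' = 0\<^sub>m n n"
    proof
      assume z: "\<forall>i<n. form (?row R i) R' = 0\<^sub>m 1 n"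
      have "form R R' $$ (i, j) = 0" if ij: "i < n" "j < n" for i j
        unfolding entry[OF ij, symmetric] using z ij by simp
      thus "form R R' = 0\<^sub>m n n" using fc by (intro eq_matI) auto
    next
      assume z: "form R R' = 0\<^sub>m n n"
      have "form (?row R i) R' $$ (0, j) = 0" if ij: "i < n" "j < n" for i j
        unfolding entry[OF ij] using z ij by simp
      thus "\<forall>i<n. form (?row R i) R' = 0\<^sub>m 1 n" using rc by (intro allI impI row_eqI[of _ n]) auto
    qed
    moreover have "(\<forall>v \<in> set (?rows R). Q v) \<longleftrightarrow> (\<forall>i<n. Q (?row R i))" for Q by auto
    ultimately show ?thesis using R(2) unfolding phi_def by (simp only: simp_thms)
  qed
  have "h = (\<Sum>R \<in> frames. fun_scale (h R / ?c) (phi (?rows R)))"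
  proof
    fix R'
    show "h R' = (\<Sum>R \<in> frames. fun_scale (h R / ?c) (phi (?rows R))) R'"
    proof (cases "R' \<in> frames")
      case False
      thus ?thesis using h by (simp add: sum_fun_apply invariants_def fun_scale_def phi_def)
    next
      case True
      have "(\<Sum>R \<in> frames. fun_scale (h R / ?c) (phi (?rows R))) R'
          = (\<Sum>R \<in> frames. if form R R' = 0\<^sub>m n n then h R / ?c else 0)"
        unfolding sum_fun_apply
      proof (intro sum.cong refl)
        fix R assume "R \<in> frames"
        show "fun_scale (h R / ?c) (phi (?rows R)) R' = (if form R R' = 0\<^sub>m n n then h R / ?c else 0)"
          unfolding fun_scale_def phi[OF \<open>R \<in> frames\<close> True] by simp
      qed
      also have "\<dots> = (\<Sum>R \<in> {R \<in> frames. form R R' = 0\<^sub>m n n}. h R / ?c)"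
        by (simp add: sum.inter_filter)
      also have "\<dots> = (\<Sum>D \<in> GLs. h (D * R') / ?c)"
        by (rule sum.reindex_bij_betw[OF same_span_param[OF True], symmetric])
      also have "\<dots> = (\<Sum>D \<in> GLs. h R' / ?c)"
        using h True by (intro sum.cong) (auto simp: invariants_def)
      also have "\<dots> = h R'" using c by simp
      finally show ?thesis by simp
    qed
  qed
  also have "\<dots> \<in> Filt (Suc n)"
    by (intro Filt_sum Filt_scale phi_in_Filt) auto
  finally show "h \<in> Filt (Suc n)" .
qed

lemma invariants_eq_Filt: "invariants = Filt (Suc n)"
  using invariants_Filt Filt_invariants by blast

section \<open>The orientation sign\<close>

text \<open>The blocks of \<open>g * J * g\<^sup>T\<close> are the products of the upper and lower rows of \<open>g\<close>.\<close>

lemma similitude_frames: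
  assumes g: "g \<in> carrier_mat (2 * n) (2 * n)" and sim: "g * J * transpose_mat g = l \<cdot>\<^sub>m J"
  obtains T R where "g = T @\<^sub>r R" "T \<in> carrier_mat n (2 * n)" "R \<in> carrier_mat n (2 * n)"
    "form T T = 0\<^sub>m n n" "form R R = 0\<^sub>m n n" "form T R = l \<cdot>\<^sub>m 1\<^sub>m n"
proof -
  define T where "T = mat n (2 * n) (\<lambda>(i, j). g $$ (i, j))"
  define R where "R = mat n (2 * n) (\<lambda>(i, j). g $$ (n + i, j))"
  have gTR: "g = T @\<^sub>r R" using g by (intro eq_matI) (auto simp: append_rows_def T_def R_def)
  have c: "T \<in> carrier_mat n (2 * n)" "R \<in> carrier_mat n (2 * n)" by (auto simp: T_def R_def)
  have fc: "form T T \<in> carrier_mat n n" "form T R \<in> carrier_mat n n"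
    "form R T \<in> carrier_mat n n" "form R R \<in> carrier_mat n n" using c by auto
  have "form g g = l \<cdot>\<^sub>m J" using sim by (simp add: form_def)
  also have "form g g = four_block_mat (form T T) (form T R) (form R T) (form R R)"
    by (subst (1 2) gTR) (rule form_append_rows[OF c])
  finally have e: "four_block_mat (form T T) (form T R) (form R T) (form R R) $$ (i, j)
      = (l \<cdot>\<^sub>m J) $$ (i, j)" for i j by simp
  have "form T T $$ (i, j) = 0" if "i < n" "j < n" for i j
    using e[of i j] that fc by (simp add: J_mat_def)
  moreover have "form T R $$ (i, j) = (l \<cdot>\<^sub>m 1\<^sub>m n) $$ (i, j)" if "i < n" "j < n" for i j
    using e[of i "n + j"] that fc by (simp add: J_mat_def)
  moreover have "form R R $$ (i, j) = 0" if "i < n" "j < n" for i j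
    using e[of "n + i" "n + j"] that fc by (simp add: J_mat_def)
  ultimately have "form T T = 0\<^sub>m n n" "form T R = l \<cdot>\<^sub>m 1\<^sub>m n" "form R R = 0\<^sub>m n n"
    using fc by (auto intro!: eq_matI)
  thus ?thesis using that[OF gTR c] by blast
qed

lemma det_J: "det J = 1 \<or> det J = -1"
proof -
  have "det J * det J = 1" using det_mult[OF J_carrier J_carrier] J_square by simp
  thus ?thesis using square_eq_1_iff by blast
qed

lemma append_rows_square:
  assumes "T \<in> carrier_mat n (2 * n)" "R \<in> carrier_mat n (2 * n)"
  shows "T @\<^sub>r R \<in> carrier_mat (2 * n) (2 * n)"
  using carrier_append_rows[OF assms] by (simp add: mult_2)

lemma det_hyper:
  assumes h: "hyper T R" shows "det (T @\<^sub>r R) = 1 \<or> det (T @\<^sub>r R) = -1"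
proof -
  let ?g = "T @\<^sub>r R" and ?N = "2 * n"
  have g: "?g \<in> carrier_mat ?N ?N" using append_rows_square hyperD[OF h] by blast
  have gJ: "?g * J \<in> carrier_mat ?N ?N" using mult_carrier_mat[OF g J_carrier] .
  have gt: "transpose_mat ?g \<in> carrier_mat ?N ?N" using g by simp
  have "det J = det ?g * det J * det ?g"
    using det_mult[OF gJ gt] det_mult[OF g J_carrier] det_transpose[OF g] hyper_isometry[OF h] by simp
  hence "det ?g * det ?g = 1" using det_J by auto
  thus ?thesis using square_eq_1_iff by blast
qed

lemma det_block_mult:
  fixes A :: "'k mat"
  assumes "A \<in> carrier_mat n n" "B \<in> carrier_mat n n" "D \<in> carrier_mat n n"
    and T: "T \<in> carrier_mat n (2 * n)" and R: "R \<in> carrier_mat n (2 * n)"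
  shows "det ((A * T + B * R) @\<^sub>r (D * R)) = det A * det D * det (T @\<^sub>r R)"
proof -
  let ?p = "four_block_mat A B (0\<^sub>m n n) D"
  have p: "?p \<in> carrier_mat (2 * n) (2 * n)"
    using four_block_carrier_mat[OF assms(1,3)] by (simp add: mult_2)
  have DR: "D * R \<in> carrier_mat n (2 * n)" using assms by auto
  have "?p * (T @\<^sub>r R) = (A * T + B * R) @\<^sub>r (0\<^sub>m n n * T + D * R)"
    using assms by (intro four_block_mult_append_rows[of _ n]) auto
  also have "0\<^sub>m n n * T + D * R = D * R"
    unfolding left_mult_zero_mat[OF T] by (rule left_add_zero_mat[OF DR])
  finally have "det ((A * T + B * R) @\<^sub>r (D * R)) = det ?p * det (T @\<^sub>r R)"
    using det_mult[OF p append_rows_square[OF T R]] by simp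
  also have "det ?p = det A * det D"
    by (rule det_four_block_mat_lower_left_zero[OF assms(1,2) _ assms(3)]) simp
  finally show ?thesis .
qed

lemma opposite_shift:
  assumes "hyper T R" "R' \<in> frames" "form R' R = 1\<^sub>m n"
  obtains X where "X \<in> skew n" "R' = T + X * R"
  using opposite_param[OF assms(1)] assms(2,3) unfolding bij_betw_def by blast

lemma opposite_hyper:
  assumes R: "R \<in> frames" "R' \<in> frames" "form R' R = 1\<^sub>m n"
  shows "hyper R' R"
proof -
  obtain T where "hyper T R" using R by (auto simp: frames_def)
  moreover then obtain X where "X \<in> skew n" "R' = T + X * R"
    using opposite_shift R by blast
  ultimately show ?thesis using hyper_shift by blast
qed

text \<open>The frames dual to \<open>R\<close> differ by unipotent block matrices, which have determinant one.\<close>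

lemma det_dual_independent:
  assumes h: "hyper T R" "hyper T' R"
  shows "det (T' @\<^sub>r R) = det (T @\<^sub>r R)"
proof -
  have "T' \<in> frames" using hyper_sym[OF h(2)] by (auto simp: frames_def)
  then obtain X where X: "X \<in> skew n" "T' = T + X * R"
    using opposite_shift[OF h(1) _ hyperD(5)[OF h(2)]] by blast
  have Xc: "X \<in> carrier_mat n n" using X by (simp add: skew_def)
  note hD = hyperD[OF h(1)]
  show ?thesis
    using det_block_mult[of "1\<^sub>m n" X "1\<^sub>m n" T R] Xc hD by (simp add: X(2))
qed

text \<open>The Lagrangians of a split quadratic space fall into two families, which are exchanged
  by the isometries of determinant \<open>-1\<close>. The determinant of an isometry with lower rows \<open>R\<close>
  names the family.\<close>

definition orient :: "'k mat \<Rightarrow> complex" where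
  "orient R = (if R \<in> frames then if det ((SOME T. hyper T R) @\<^sub>r R) = 1 then 1 else -1 else 0)"

lemma orient_eq:
  assumes h: "hyper T R" shows "orient R = (if det (T @\<^sub>r R) = 1 then 1 else -1)"
proof -
  have "R \<in> frames" using h by (auto simp: frames_def)
  moreover have "hyper (SOME T. hyper T R) R" using h by (rule someI)
  ultimately show ?thesis using det_dual_independent[OF h] by (simp add: orient_def)
qed

text \<open>A change of basis by \<open>D\<close> changes the dual frame by the transposed inverse of \<open>D\<close>, so the
  determinant is unchanged.\<close>

lemma orient_invariant: "orient \<in> invariants"
proof -
  have "orient (D * R) = orient R" if R: "R \<in> frames" and D: "D \<in> GLs" for R D
  proof -
    obtain T where h: "hyper T R" using R by (auto simp: frames_def)
    note hD = hyperD[OF h]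
    obtain D' where D': "D' \<in> GLs" "D' * D = 1\<^sub>m n" using GLs_inverse[OF D] by metis
    let ?E = "transpose_mat D'"
    have c: "D \<in> carrier_mat n n" "?E \<in> carrier_mat n n" "D' \<in> carrier_mat n n"
      using D D' by (auto simp: GLs_def)
    have h': "hyper (?E * T) (D * R)" using c D'(2) by (intro hyper_GLs[OF h]) auto
    have "?E * T \<in> carrier_mat n (2 * n)" using c hD by auto
    hence "?E * T = ?E * T + 0\<^sub>m n n * R"
      unfolding left_mult_zero_mat[OF hD(2)] by (rule right_add_zero_mat[symmetric])
    hence "det ((?E * T) @\<^sub>r (D * R)) = det ?E * det D * det (T @\<^sub>r R)"
      using det_block_mult[OF c(2) zero_carrier_mat c(1) hD(1,2)] by simp
    also have "det ?E * det D = 1"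
      using det_transpose[OF c(3)] det_mult[OF c(3,1)] D'(2) by simp
    finally show ?thesis by (simp add: orient_eq[OF h] orient_eq[OF h'])
  qed
  thus ?thesis by (auto simp: invariants_def orient_def)
qed

lemma one_neq_minus_one: "(1 :: 'k) \<noteq> -1"
proof
  assume "(1 :: 'k) = -1"
  hence "(1 :: 'k) = 0" by (rule eq_uminus_self[OF odd_q])
  thus False by simp
qed

lemma card_opposite:
  assumes "R \<in> frames" shows "card {R' \<in> frames. form R' R = 1\<^sub>m n} = CARD('k) ^ (n choose 2)"
proof -
  obtain T where "hyper T R" using assms by (auto simp: frames_def)
  from bij_betw_same_card[OF opposite_param[OF this]] show ?thesis
    using card_skew[OF odd_q, of n] by simp
qed

text \<open>Interchanging \<open>R\<close> and its dual multiplies the determinant by \<open>det J\<close>, so opposite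
  Lagrangians always compare in the same way, and there are \<open>q ^ (n choose 2)\<close> of them.\<close>

lemma opp_orient:
  "\<exists>e. (e = 1 \<or> e = -1) \<and> opp orient = fun_scale (of_real (e * real CARD('k) ^ (n choose 2))) orient"
proof -
  let ?e = "if det J = 1 then 1 else -1 :: real"
  have "orient R' = of_real ?e * orient R" if R: "R \<in> frames" "R' \<in> frames" "form R' R = 1\<^sub>m n" for R R'
  proof -
    note h = opposite_hyper[OF R]
    note hD = hyperD[OF h]
    have "R @\<^sub>r R' = J * (R' @\<^sub>r R)" using J_mult_append_rows[OF hD(1,2)] by simp
    hence "det (R @\<^sub>r R') = det J * det (R' @\<^sub>r R)"
      using det_mult[OF J_carrier append_rows_square[OF hD(1,2)]] by simp
    thus ?thesis
      using det_J det_hyper[OF h] one_neq_minus_one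
      by (auto simp: orient_eq[OF h] orient_eq[OF hyper_sym[OF h]])
  qed
  hence "opp orient R = of_real (?e * real CARD('k) ^ (n choose 2)) * orient R" if "R \<in> frames" for R
    using that card_opposite[OF that] by (simp add: opp_def)
  hence "opp orient = fun_scale (of_real (?e * real CARD('k) ^ (n choose 2))) orient"
    by (auto simp: fun_eq_iff fun_scale_def opp_def orient_def)
  thus ?thesis by (intro exI[of _ ?e]) auto
qed

lemma J_entry:
  assumes "i < 2 * n" "j < 2 * n"
  shows "J $$ (i, j) = (if j = i + n \<or> i = j + n then 1 else 0)"
  using assms by (auto simp: J_mat_def)

text \<open>Interchanging the two vectors of one hyperbolic pair is an isometry of determinant
  \<open>-1\<close>.\<close>

lemma orient_not_constant: "\<exists>R \<in> frames. \<exists>R' \<in> frames. orient R \<noteq> orient R'"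
proof -
  let ?N = "2 * n"
  have attained: "\<exists>R \<in> frames. orient R = (if det g = 1 then 1 else -1)"
    if g: "g \<in> carrier_mat ?N ?N" "g * J * transpose_mat g = J" for g
  proof -
    have "g * J * transpose_mat g = 1 \<cdot>\<^sub>m J" unfolding g(2) by (intro eq_matI) auto
    then obtain T R where TR: "g = T @\<^sub>r R" "T \<in> carrier_mat n ?N" "R \<in> carrier_mat n ?N"
      "form T T = 0\<^sub>m n n" "form R R = 0\<^sub>m n n" "form T R = 1 \<cdot>\<^sub>m 1\<^sub>m n"
      using similitude_frames[OF g(1)] by metis
    have "(1 \<cdot>\<^sub>m 1\<^sub>m n :: 'k mat) = 1\<^sub>m n" by (intro eq_matI) auto
    hence h: "hyper T R" using TR by (simp add: hyper_def)
    show ?thesis using orient_eq[OF h] h TR(1) by (intro bexI[of _ R]) (auto simp: frames_def)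
  qed
  let ?P = "swaprows_mat ?N 0 n :: 'k mat"
  have P: "?P \<in> carrier_mat ?N ?N" by simp
  have PJ: "?P * J = swaprows 0 n J"
    using swaprows_mat[OF J_carrier, of 0 n] n_pos by simp
  have M: "swaprows 0 n J \<in> carrier_mat ?N ?N" by simp
  have "transpose_mat (?P * J * transpose_mat ?P) = ?P * transpose_mat (swaprows 0 n J)"
    unfolding PJ using transpose_mult[OF M, of "transpose_mat ?P" ?N] P by simp
  also have "\<dots> = swaprows 0 n (transpose_mat (swaprows 0 n J))"
    using swaprows_mat[of "transpose_mat (swaprows 0 n J)" ?N ?N 0 n] n_pos M by simp
  also have "\<dots> = J"
  proof (rule eq_matI)
    fix i j assume "i < dim_row J" "j < dim_col J"
    hence ij: "i < ?N" "j < ?N" using carrier_matD[OF J_carrier] by auto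
    thus "swaprows 0 n (transpose_mat (swaprows 0 n J)) $$ (i, j) = J $$ (i, j)"
      using n_pos carrier_matD[OF J_carrier]
      by (cases "i = 0"; cases "i = n"; cases "j = 0"; cases "j = n") (simp_all add: J_entry)
  qed (use carrier_matD[OF J_carrier] in auto)
  finally have "transpose_mat (?P * J * transpose_mat ?P) = J" .
  hence iso: "?P * J * transpose_mat ?P = J" using J_transpose transpose_transpose by metis
  have detP: "det ?P = -1" using det_swaprows_mat[of 0 ?N n] n_pos by simp
  have one: "1\<^sub>m ?N * J * transpose_mat (1\<^sub>m ?N) = J"
    using carrier_matD[OF J_carrier] by simp
  obtain R where "R \<in> frames" "orient R = -1"
    using attained[OF P iso] detP one_neq_minus_one by auto
  moreover obtain R' where "R' \<in> frames" "orient R' = 1"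
    using attained[OF one_carrier_mat one] by auto
  ultimately show ?thesis by (intro bexI[of _ R] bexI[of _ R']) auto
qed

section \<open>The spectrum of the squared opposition operator\<close>

text \<open>The difference of the exponents is \<open>j * (n - j) > 0\<close>, by \<open>choose_two_add\<close>.\<close>

lemma lam_less:
  assumes "0 < j" "j < n" shows "\<bar>lam j\<bar> < real CARD('k) ^ (n choose 2)"
proof -
  have q: "1 < real CARD('k)"
    using card_mono[of "UNIV :: 'k set" "{0, 1}"] by simp
  have "j + (n - j) = n" using assms by simp
  hence "n choose 2 = (j choose 2) + ((n - j) choose 2) + j * (n - j)"
    using choose_two_add[of j "n - j"] by simp
  moreover have "0 < j * (n - j)" using assms by simp
  ultimately have "(j choose 2) + ((n - j) choose 2) < n choose 2" by linarith
  thus ?thesis using power_strict_increasing[OF _ q] by (simp add: lam_def abs_mult power_abs)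
qed

text \<open>In \<open>Filt (Suc j)\<close> modulo \<open>Filt j\<close>, \<open>opp\<close> acts by \<open>lam j\<close>, which for \<open>0 < j < n\<close> is not
  the eigenvalue of \<open>orient\<close>. So \<open>orient\<close> would descend to \<open>Filt 1\<close>, which consists of the
  functions that are constant on frames.\<close>

lemma orient_not_in_Filt: "orient \<notin> Filt n"
proof
  assume o: "orient \<in> Filt n"
  obtain e where e: "e = 1 \<or> e = -1"
    and eig: "opp orient = fun_scale (of_real (e * real CARD('k) ^ (n choose 2))) orient"
    using opp_orient by blast
  let ?m = "e * real CARD('k) ^ (n choose 2)"
  have down: "orient \<in> Filt j" if j: "0 < j" "j < n" "orient \<in> Filt (Suc j)" for j
  proof -
    have abs: "\<bar>?m\<bar> = real CARD('k) ^ (n choose 2)" using e by (auto simp: abs_mult power_abs)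
    hence ne: "?m - lam j \<noteq> 0" using lam_less[OF j(1,2)] by auto
    have "fun_scale (of_real ?m) orient - fun_scale (of_real (lam j)) orient \<in> Filt j"
      using opp_triangular[OF j(3)] unfolding eig .
    hence "fun_scale (of_real (?m - lam j)) orient \<in> Filt j"
      unfolding fun_space.scale_left_diff_distrib[symmetric] of_real_diff .
    from Filt_scale[OF this, of "of_real (inverse (?m - lam j))"] show ?thesis
      unfolding fun_space.scale_scale of_real_mult[symmetric] left_inverse[OF ne]
      by (simp only: of_real_1 fun_space.scale_one)
  qed
  have "orient \<in> Filt (n - i)" if "i < n" for i
    using that
  proof (induction i)
    case 0 show ?case using o by simp
  next
    case (Suc i)
    have e: "n - i = Suc (n - Suc i)" using Suc.prems by simp
    have "orient \<in> Filt (n - i)" using Suc by simp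
    hence o': "orient \<in> Filt (Suc (n - Suc i))" unfolding e .
    show ?case by (rule down[OF _ _ o']) (use Suc.prems in simp_all)
  qed
  from this[of "n - 1"] have "orient \<in> Filt 1" using n_pos by simp
  hence "\<forall>R \<in> frames. \<forall>R' \<in> frames. orient R = orient R'"
  proof (induction rule: Filt_induct)
    case (add c S f)
    have S: "S = []" using add.hyps(2) by simp
    show ?case
    proof (intro ballI)
      fix R R' assume R: "R \<in> frames" "R' \<in> frames"
      have "f R = f R'" using add.IH R by blast
      moreover have "fun_scale c (phi S) R = fun_scale c (phi S) R'"
        using R by (simp add: S phi_def fun_scale_def)
      ultimately show "(fun_scale c (phi S) + f) R = (fun_scale c (phi S) + f) R'"
        unfolding plus_fun_def by (simp only:)
    qed
  qed simp
  thus False using orient_not_constant by blast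
qed

text \<open>The filtration is generated by multiplication with the \<open>phi [w]\<close>, so that one equality
  propagates upwards to \<open>Filt (Suc n) = Filt n\<close>; but \<open>orient\<close> is invariant and not in \<open>Filt n\<close>.\<close>

lemma Filt_strict: "k \<le> n \<Longrightarrow> Filt (Suc k) \<noteq> Filt k"
proof
  assume k: "k \<le> n" and eq: "Filt (Suc k) = Filt k"
  have step: "Filt (Suc (Suc j)) \<subseteq> Filt (Suc j)" if j: "Filt (Suc j) = Filt j" for j
    unfolding Filt_def[of "Suc (Suc j)"]
  proof (rule fun_space.span_minimal[OF _ Filt_subspace], clarify)
    fix S :: "'k mat list" assume S: "set S \<subseteq> rows_of (2 * n)" "length S < Suc (Suc j)"
    show "phi S \<in> Filt (Suc j)"
    proof (cases "length S < Suc j")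
      case True thus ?thesis using S phi_in_Filt by blast
    next
      case False
      then obtain w S' where w: "S = w # S'" "length S' = j" using S by (cases S) auto
      have c: "w \<in> rows_of (2 * n)" "set S' \<subseteq> rows_of (2 * n)" using S w by auto
      have "phi S' \<in> Filt j" using phi_in_Filt[OF c(2), of "Suc j"] w j by simp
      hence "phi S' * phi [w] \<in> Filt (Suc j)" using Filt_mult_phi c(1) by blast
      moreover have "phi S' * phi [w] = phi S" unfolding phi_append w by (auto simp: phi_def)
      ultimately show ?thesis by simp
    qed
  qed
  have "Filt (Suc (k + i)) = Filt (k + i)" for i
  proof (induction i)
    case (Suc i)
    show ?case using step[OF Suc.IH] Filt_mono[of "Suc (k + i)" "Suc (Suc (k + i))"] by auto
  qed (use eq in simp)
  from this[of "n - k"] have "Filt (Suc n) = Filt n" using k by simp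
  thus False using orient_not_in_Filt orient_invariant invariants_eq_Filt by blast
qed

lemma triangular_opp_opp:
  "triangular_operator invariants (\<lambda>f. opp (opp f)) (\<lambda>k. Filt (Suc k)) (\<lambda>k. of_real (lam k ^ 2)) n"
proof
  fix f g :: "'k mat \<Rightarrow> complex" and c :: complex and k :: nat
  show "opp (opp f) \<in> invariants" if "f \<in> invariants"
    using that opp_closed unfolding invariants_eq_Filt by blast
  show "opp (opp (f + g)) = opp (opp f) + opp (opp g)" by (simp only: opp_add)
  show "opp (opp (fun_scale c f)) = fun_scale c (opp (opp f))" by (simp only: opp_scale)
  show "opp (opp f) = fun_scale (of_real (lam k ^ 2)) f"
    if "f \<in> invariants" "opp (opp (opp (opp f) - fun_scale (of_real (lam k ^ 2)) f))
      = fun_scale (of_real (lam k ^ 2)) (opp (opp f) - fun_scale (of_real (lam k ^ 2)) f)"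
    using that opp_opp_semisimple[of f "lam k ^ 2"] by (auto simp: invariants_def)
  show "opp (opp f) = fun_scale (of_real (lam 0 ^ 2)) f" if "f \<in> Filt (Suc 0)"
    using opp_opp_triangular[OF that] unfolding Filt_0 singleton_iff by (rule iffD1[OF right_minus_eq])
  show "opp (opp f) - fun_scale (of_real (lam (Suc k) ^ 2)) f \<in> Filt (Suc k)" if "f \<in> Filt (Suc (Suc k))"
    by (rule opp_opp_triangular[OF that])
qed (use Filt_subspace Filt_mono invariants_eq_Filt in auto)

lemma opp_opp_eigenvectors_span:
  "invariants = fun_space.span {f \<in> invariants. \<exists>j\<le>n. opp (opp f) = fun_scale (of_real (lam j ^ 2)) f}"
  by (rule triangular_operator.eigenvectors_span[OF triangular_opp_opp])

lemma opp_opp_eigenvalues: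
  "(\<exists>f \<in> invariants. f \<noteq> 0 \<and> opp (opp f) = fun_scale c f) \<longleftrightarrow> (\<exists>k\<le>n. c = of_real (lam k ^ 2))"
proof
  assume "\<exists>f \<in> invariants. f \<noteq> 0 \<and> opp (opp f) = fun_scale c f"
  thus "\<exists>k\<le>n. c = of_real (lam k ^ 2)"
    using triangular_operator.only_eigenvalues[OF triangular_opp_opp] by blast
next
  assume "\<exists>k\<le>n. c = of_real (lam k ^ 2)"
  then obtain k where k: "k \<le> n" "c = of_real (lam k ^ 2)" by blast
  have "if k = 0 then Filt (Suc 0) \<noteq> {0} else Filt (Suc k) \<noteq> Filt (Suc (k - 1))"
    using Filt_strict[OF k(1)] Filt_0 by (cases "k = 0") simp_all
  from triangular_operator.eigenvalue_attained[OF triangular_opp_opp k(1) this]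
  show "\<exists>f \<in> invariants. f \<noteq> 0 \<and> opp (opp f) = fun_scale c f" unfolding k(2) .
qed

end

section \<open>Products over half systems\<close>

text \<open>A function that is unchanged by the involution has the same product over every set of
  representatives of its orbits. The sign functions single out one representative in each orbit,
  and \<open>f\<close> need not match the two choices.\<close>

lemma half_system_reindex:
  fixes \<kappa> :: "'b \<Rightarrow> 'c::comm_monoid_mult" and \<sigma> :: "'a \<Rightarrow> complex" and \<tau> :: "'b \<Rightarrow> complex"
  assumes f: "bij_betw f A B"
    and nA: "\<And>x. x \<in> A \<Longrightarrow> mA x \<in> A \<and> \<sigma> (mA x) = - \<sigma> x \<and> (\<sigma> x = 1 \<or> \<sigma> x = -1)"
    and nB: "\<And>y. y \<in> B \<Longrightarrow> mB y \<in> B \<and> mB (mB y) = y \<and> \<tau> (mB y) = - \<tau> y \<and> (\<tau> y = 1 \<or> \<tau> y = -1)"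
    and fm: "\<And>x. x \<in> A \<Longrightarrow> f (mA x) = mB (f x)"
    and \<kappa>: "\<And>y. y \<in> B \<Longrightarrow> \<kappa> (mB y) = \<kappa> y"
  shows "(\<Prod>x \<in> {x \<in> A. \<sigma> x = 1}. \<kappa> (f x)) = (\<Prod>y \<in> {y \<in> B. \<tau> y = 1}. \<kappa> y)"
proof -
  let ?h = "\<lambda>x. if \<tau> (f x) = 1 then f x else mB (f x)"
  have fB: "f x \<in> B" if "x \<in> A" for x using f that by (auto simp: bij_betw_def)
  have inj: "x = y" if "x \<in> A" "y \<in> A" "f x = f y" for x y
    using f that by (auto simp: bij_betw_def inj_on_def)
  have "bij_betw ?h {x \<in> A. \<sigma> x = 1} {y \<in> B. \<tau> y = 1}"
  proof (rule bij_betwI')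
    fix x y assume "x \<in> {x \<in> A. \<sigma> x = 1}" "y \<in> {x \<in> A. \<sigma> x = 1}"
    hence xy: "x \<in> A" "\<sigma> x = 1" "y \<in> A" "\<sigma> y = 1" by auto
    show "?h x = ?h y \<longleftrightarrow> x = y"
    proof
      assume eq: "?h x = ?h y"
      have "f x = f y \<or> f x = mB (f y)"
        using eq nB[OF fB[OF xy(1)]] nB[OF fB[OF xy(3)]] by (metis (full_types))
      thus "x = y"
      proof
        assume "f x = mB (f y)"
        hence "x = mA y" using inj[OF xy(1), of "mA y"] nA[OF xy(3)] fm[OF xy(3)] by simp
        thus ?thesis using nA[OF xy(3)] xy by simp
      qed (use inj xy in blast)
    qed simp
  next
    fix x assume "x \<in> {x \<in> A. \<sigma> x = 1}"
    hence x: "x \<in> A" by simp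
    show "?h x \<in> {y \<in> B. \<tau> y = 1}" using fB[OF x] nB[OF fB[OF x]] by auto
  next
    fix y assume "y \<in> {y \<in> B. \<tau> y = 1}"
    hence y: "y \<in> B" "\<tau> y = 1" by auto
    then obtain x where x: "x \<in> A" "f x = y" using f by (auto simp: bij_betw_def)
    show "\<exists>x \<in> {x \<in> A. \<sigma> x = 1}. y = ?h x"
    proof (cases "\<sigma> x = 1")
      case True thus ?thesis using x y by (intro bexI[of _ x]) auto
    next
      case False
      hence "\<sigma> (mA x) = 1" using nA[OF x(1)] by auto
      thus ?thesis using nA[OF x(1)] fm[OF x(1)] nB[OF y(1)] x y by (intro bexI[of _ "mA x"]) auto
    qed
  qed
  hence "(\<Prod>y \<in> {y \<in> B. \<tau> y = 1}. \<kappa> y) = (\<Prod>x \<in> {x \<in> A. \<sigma> x = 1}. \<kappa> (?h x))"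
    by (rule prod.reindex_bij_betw[symmetric])
  also have "\<dots> = (\<Prod>x \<in> {x \<in> A. \<sigma> x = 1}. \<kappa> (f x))"
    using fB \<kappa> by (intro prod.cong) auto
  finally show ?thesis by simp
qed

lemma prod_pm_one:
  "(\<And>x. x \<in> A \<Longrightarrow> f x = 1 \<or> f x = -1) \<Longrightarrow> prod f A = 1 \<or> prod f A = (-1 :: 'a::comm_ring_1)"
proof (induction A rule: infinite_finite_induct)
  case (insert x F)
  have "f x = 1 \<or> f x = -1" "prod f F = 1 \<or> prod f F = -1" using insert by auto
  thus ?case using insert.hyps by auto
qed auto

text \<open>An arbitrary choice of one element from each pair \<open>a, - a\<close>. No multiplicative choice
  exists when \<open>-1\<close> is a square, and any choice serves for counting sign changes.\<close>

definition field_sign :: "'k::{field,finite} \<Rightarrow> complex" where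
  "field_sign = (SOME \<eta>. \<forall>a. (\<eta> a = 1 \<or> \<eta> a = -1) \<and> (a \<noteq> 0 \<longrightarrow> \<eta> (- a) = - \<eta> a))"

lemma field_sign:
  assumes "odd CARD('k)"
  shows field_sign_pm: "field_sign (a :: 'k::{field,finite}) = 1 \<or> field_sign a = -1"
    and field_sign_odd: "a \<noteq> 0 \<Longrightarrow> field_sign (- a) = - field_sign a"
proof -
  obtain f :: "'k \<Rightarrow> nat" where f: "inj f"
    using finite_imp_inj_to_nat_seg[of "UNIV :: 'k set"] by auto
  let ?\<eta> = "\<lambda>a. if f a < f (- a) then 1 else -1 :: complex"
  have "f a \<noteq> f (- a)" if "a \<noteq> 0" for a
  proof
    assume "f a = f (- a)"
    hence "a = - a" by (rule injD[OF f])
    thus False using eq_uminus_self[OF assms, of a] that by blast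
  qed
  hence ne: "f a < f (- a) \<or> f (- a) < f a" if "a \<noteq> 0" for a using that by (meson linorder_neqE_nat)
  have "?\<eta> (- a) = - ?\<eta> a" if "a \<noteq> 0" for a using ne[OF that] by auto
  hence "\<exists>\<eta> :: 'k \<Rightarrow> complex. \<forall>a. (\<eta> a = 1 \<or> \<eta> a = -1) \<and> (a \<noteq> 0 \<longrightarrow> \<eta> (- a) = - \<eta> a)"
    by (intro exI[of _ ?\<eta>]) auto
  from someI_ex[OF this] show "field_sign a = 1 \<or> field_sign a = -1"
    "a \<noteq> 0 \<Longrightarrow> field_sign (- a) = - field_sign a"
    unfolding field_sign_def by blast+
qed

text \<open>As in Gauss's lemma, the product of the elements \<open>t * a\<close> over the half system \<open>H\<close>
  equals, up to the signs that are counted on the left, the product of \<open>H\<close> itself; cancelling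
  leaves \<open>t ^ card H\<close>.\<close>

lemma gauss_product:
  fixes t :: "'k::{field,finite}"
  assumes odd: "odd CARD('k)" and t: "t \<noteq> 0"
  defines "H \<equiv> {a :: 'k. a \<noteq> 0 \<and> field_sign a = 1}"
  shows "(\<Prod>a \<in> H. field_sign (t * a)) = (if t ^ card H = 1 then 1 else -1)"
    and "t ^ card H = 1 \<or> t ^ card H = -1"
proof -
  \<comment> \<open>The same signs as \<open>field_sign\<close>, with values in the field itself.\<close>
  let ?s = "\<lambda>a :: 'k. if field_sign a = 1 then 1 else -1 :: 'k"
  let ?U = "- {0} :: 'k set"
  have H: "H = {a \<in> ?U. field_sign a = 1}" by (auto simp: H_def)
  note sg = field_sign_pm[OF odd] field_sign_odd[OF odd]
  have "(\<Prod>a \<in> {a \<in> ?U. field_sign a = 1}. ?s (t * a) * (t * a)) = (\<Prod>a \<in> {a \<in> ?U. field_sign a = 1}. ?s a * a)"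
  proof (rule half_system_reindex[where f = "\<lambda>a. t * a" and mA = uminus and mB = uminus])
    show "bij_betw (\<lambda>a. t * a) ?U ?U"
      using t by (intro bij_betw_byWitness[where f' = "\<lambda>a. a / t"]) auto
    fix x :: 'k assume x: "x \<in> ?U"
    show "- x \<in> ?U \<and> field_sign (- x) = - field_sign x \<and> (field_sign x = 1 \<or> field_sign x = -1)"
      using x sg[of x] by auto
    show "- x \<in> ?U \<and> - (- x) = x \<and> field_sign (- x) = - field_sign x \<and> (field_sign x = 1 \<or> field_sign x = -1)"
      using x sg[of x] by auto
    show "t * - x = - (t * x)" by simp
    show "?s (- x) * - x = ?s x * x" using x sg[of x] by auto
  qed
  also have "\<dots> = \<Prod>H" unfolding H by (intro prod.cong) auto
  finally have "(\<Prod>a \<in> H. ?s (t * a)) * (\<Prod>a \<in> H. t * a) = \<Prod>H"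
    unfolding H by (simp add: prod.distrib)
  hence "((\<Prod>a \<in> H. ?s (t * a)) * t ^ card H) * \<Prod>H = 1 * \<Prod>H"
    by (simp add: prod.distrib mult.assoc)
  moreover have "\<Prod>H \<noteq> 0" by (auto simp: H_def)
  ultimately have e: "(\<Prod>a \<in> H. ?s (t * a)) * t ^ card H = 1" using mult_cancel_right by blast
  have pm: "(\<Prod>a \<in> H. ?s (t * a)) = 1 \<or> (\<Prod>a \<in> H. ?s (t * a)) = -1"
    by (rule prod_pm_one) auto
  have neg: "t ^ card H = -1" if "(\<Prod>a \<in> H. ?s (t * a)) = -1"
    using e minus_equation_iff[of "t ^ card H" 1] unfolding that by simp
  have pos: "t ^ card H = 1" if "(\<Prod>a \<in> H. ?s (t * a)) = 1"
    using e unfolding that by simp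
  show "t ^ card H = 1 \<or> t ^ card H = -1" using pm pos neg by blast
  have ne: "(1 :: 'k) \<noteq> -1" using eq_uminus_self[OF odd, of 1] by auto
  have st: "(\<Prod>a \<in> H. ?s (t * a)) = 1 \<longleftrightarrow> t ^ card H = 1"
  proof
    assume T: "t ^ card H = 1"
    show "(\<Prod>a \<in> H. ?s (t * a)) = 1"
    proof (rule ccontr)
      assume "(\<Prod>a \<in> H. ?s (t * a)) \<noteq> 1"
      hence "t ^ card H = -1" using pm neg by blast
      hence "(1 :: 'k) = -1" unfolding T .
      thus False using ne by contradiction
    qed
  qed (rule pos)
  have signs: "(\<Prod>a \<in> A. field_sign (t * a)) = (if (\<Prod>a \<in> A. ?s (t * a)) = 1 then 1 else -1)
      \<and> ((\<Prod>a \<in> A. ?s (t * a)) = 1 \<or> (\<Prod>a \<in> A. ?s (t * a)) = -1)" for A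
  proof (induction A rule: infinite_finite_induct)
    case (insert x F)
    thus ?case using sg(1)[of "t * x"] ne by (auto split: if_splits)
  qed auto
  show "(\<Prod>a \<in> H. field_sign (t * a)) = (if t ^ card H = 1 then 1 else -1)"
    unfolding conjunct1[OF signs] st ..
qed

text \<open>Squaring is injective on \<open>H\<close>, so the squares of \<open>H\<close> are \<open>card H\<close> roots of
  \<open>x ^ card H = 1\<close>, hence all of them. So \<open>\<beta>\<close> is trivial where the Gauss sign is, and as \<open>\<beta>\<close> is
  not trivial, it agrees with the Gauss sign also elsewhere.\<close>

lemma quadratic_character_eq_gauss_product:
  fixes t :: "'k::{field,finite}" and \<beta> :: "'k \<Rightarrow> complex"
  assumes odd: "odd CARD('k)" and \<beta>: "\<beta> \<in> mult_characters"
    and sq: "\<forall>x. x \<noteq> 0 \<longrightarrow> \<beta> x ^ 2 = 1" and nt: "\<exists>x. x \<noteq> 0 \<and> \<beta> x \<noteq> 1" and t: "t \<noteq> 0"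
  shows "(\<Prod>a \<in> {a. a \<noteq> 0 \<and> field_sign a = 1}. field_sign (t * a)) = \<beta> t"
proof -
  let ?H = "{a :: 'k. a \<noteq> 0 \<and> field_sign a = 1}"
  note gp = gauss_product[OF odd]
  have mult: "\<beta> (x * y) = \<beta> x * \<beta> y" if "x \<noteq> 0" "y \<noteq> 0" for x y
    using \<beta> that by (auto simp: hom_def mult_grp_def)
  have pm: "\<beta> x = 1 \<or> \<beta> x = -1" if "x \<noteq> 0" for x
    using sq that by (simp add: power2_eq_1_iff)
  have inj: "inj_on (\<lambda>a. a ^ 2) ?H"
  proof (rule inj_onI)
    fix a b :: 'k assume ab: "a \<in> ?H" "b \<in> ?H" "a ^ 2 = b ^ 2"
    hence "a = b \<or> a = - b" by (simp add: power2_eq_iff)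
    thus "a = b" using ab field_sign_odd[OF odd, of b] by auto
  qed
  let ?P = "[:-1:] + monom 1 (card ?H) :: 'k poly"
  have "1 \<in> ?H \<or> -1 \<in> ?H"
    using field_sign_pm[OF odd, of 1] field_sign_odd[OF odd, of 1] by auto
  hence "?H \<noteq> {}" by blast
  hence Hpos: "0 < card ?H" by (simp add: card_gt_0_iff)
  have deg: "degree ?P = card ?H"
    using Hpos by (subst degree_add_eq_right) (auto simp: degree_monom_eq)
  have P0: "?P \<noteq> 0" using deg Hpos by (metis degree_0 less_irrefl)
  have roots: "{x. poly ?P x = 0} = {x :: 'k. x ^ card ?H = 1}" by (auto simp: poly_monom)
  have "(\<lambda>a. a ^ 2) ` ?H \<subseteq> {x :: 'k. x ^ card ?H = 1}"
  proof (rule image_subsetI)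
    fix a assume "a \<in> ?H"
    hence a: "a ^ card ?H = 1 \<or> a ^ card ?H = -1" using gp(2)[of a] by auto
    have "(a ^ 2) ^ card ?H = (a ^ card ?H) ^ 2" by (simp add: power_mult[symmetric] mult.commute)
    also have "\<dots> = 1" using a by auto
    finally show "a ^ 2 \<in> {x :: 'k. x ^ card ?H = 1}" by simp
  qed
  moreover have "card {x :: 'k. x ^ card ?H = 1} \<le> card ((\<lambda>a. a ^ 2) ` ?H)"
    using card_poly_roots_bound[OF P0] deg card_image[OF inj] unfolding roots by simp
  ultimately have squares: "(\<lambda>a. a ^ 2) ` ?H = {x :: 'k. x ^ card ?H = 1}"
    by (intro card_seteq) simp_all
  have triv: "\<beta> x = 1" if x: "x \<noteq> 0" "x ^ card ?H = 1" for x
  proof -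
    have "x \<in> (\<lambda>a. a ^ 2) ` ?H" unfolding squares using x(2) by simp
    then obtain a where a: "a \<noteq> 0" "x = a ^ 2" by auto
    have "\<beta> x = \<beta> a ^ 2" unfolding a(2) power2_eq_square by (rule mult[OF a(1,1)])
    thus ?thesis using sq a by simp
  qed
  obtain x0 where x0: "x0 \<noteq> 0" "\<beta> x0 \<noteq> 1" using nt by blast
  have b0: "\<beta> x0 = -1" using pm[OF x0(1)] x0(2) by blast
  have h0: "x0 ^ card ?H = -1" using gp(2)[OF x0(1)] triv[OF x0(1)] x0(2) by blast
  show ?thesis
  proof (cases "t ^ card ?H = 1")
    case True thus ?thesis using gp(1)[OF t] triv[OF t] by simp
  next
    case False
    hence "t ^ card ?H = -1" using gp(2)[OF t] by blast
    hence "(t * x0) ^ card ?H = 1" using h0 by (simp add: power_mult_distrib)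
    hence "\<beta> t * \<beta> x0 = 1" using triv[of "t * x0"] mult[OF t x0(1)] t x0 by simp
    hence "- \<beta> t = 1" using b0 by simp
    hence "\<beta> t = -1" using minus_equation_iff[of "\<beta> t" 1] by simp
    thus ?thesis using gp(1)[OF t] False by simp
  qed
qed

section \<open>Sign characters of the general linear group\<close>

definition diag_last :: "nat \<Rightarrow> 'k::field \<Rightarrow> 'k mat" where
  "diag_last n t = mat n n (\<lambda>(i, j). if i = j then if Suc i = n then t else 1 else 0)"

lemma mult_upper_unipotent:
  assumes "r \<in> carrier_mat 1 n" "a \<in> carrier_mat 1 1" "r' \<in> carrier_mat 1 n"
    "c \<in> carrier_mat n 1" "A \<in> carrier_mat n n"
  shows "four_block_mat (1\<^sub>m 1) r (0\<^sub>m n 1) (1\<^sub>m n) * four_block_mat a r' c A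
    = four_block_mat (a + r * c) (r' + r * A) c (A :: 'k::field mat)"
proof -
  have "four_block_mat (1\<^sub>m 1) r (0\<^sub>m n 1) (1\<^sub>m n) * four_block_mat a r' c A
    = four_block_mat (1\<^sub>m 1 * a + r * c) (1\<^sub>m 1 * r' + r * A) (0\<^sub>m n 1 * a + 1\<^sub>m n * c) (0\<^sub>m n 1 * r' + 1\<^sub>m n * A)"
    using assms by (intro mult_four_block_mat[of _ 1 1 _ n _ n _ _ 1 _ n]) auto
  thus ?thesis using assms by simp
qed

lemma mult_lower_unipotent:
  assumes "z \<in> carrier_mat n 1" "a \<in> carrier_mat 1 1" "r \<in> carrier_mat 1 n"
    "c \<in> carrier_mat n 1" "A \<in> carrier_mat n n"
  shows "four_block_mat (1\<^sub>m 1) (0\<^sub>m 1 n) z (1\<^sub>m n) * four_block_mat a r c A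
    = four_block_mat a r (z * a + c) (z * r + A :: 'k::field mat)"
proof -
  have "four_block_mat (1\<^sub>m 1) (0\<^sub>m 1 n) z (1\<^sub>m n) * four_block_mat a r c A
    = four_block_mat (1\<^sub>m 1 * a + 0\<^sub>m 1 n * c) (1\<^sub>m 1 * r + 0\<^sub>m 1 n * A) (z * a + 1\<^sub>m n * c) (z * r + 1\<^sub>m n * A)"
    using assms by (intro mult_four_block_mat[of _ 1 1 _ n _ n _ _ 1 _ n]) auto
  thus ?thesis using assms by simp
qed

text \<open>Every transvection is the square of another one because \<open>2\<close> is invertible, so a
  character with values of square one is trivial on the transvections. Row reduction by
  transvections brings \<open>D\<close> to the diagonal matrix with its determinant in the last place. In the
  induction on the size, the corner entry is first made equal to one, which needs a nonzero
  entry below it.\<close>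

lemma sign_character_eq_det:
  fixes \<zeta> :: "'k::field mat \<Rightarrow> complex"
  assumes two: "(2::'k) \<noteq> 0"
  shows "(\<And>D E. D \<in> carrier_mat (Suc n) (Suc n) \<Longrightarrow> E \<in> carrier_mat (Suc n) (Suc n) \<Longrightarrow>
      det D \<noteq> 0 \<Longrightarrow> det E \<noteq> 0 \<Longrightarrow> \<zeta> (D * E) = \<zeta> D * \<zeta> E) \<Longrightarrow>
    (\<And>D. D \<in> carrier_mat (Suc n) (Suc n) \<Longrightarrow> det D \<noteq> 0 \<Longrightarrow> \<zeta> D * \<zeta> D = 1) \<Longrightarrow>
    D \<in> carrier_mat (Suc n) (Suc n) \<Longrightarrow> det D \<noteq> 0 \<Longrightarrow> \<zeta> D = \<zeta> (diag_last (Suc n) (det D))"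
proof (induction n arbitrary: \<zeta> D)
  case 0
  have "D = diag_last (Suc 0) (det D)"
    using 0(3) det_single[of D] by (intro eq_matI) (auto simp: diag_last_def)
  thus ?case by metis
next
  case (Suc m \<zeta> D)
  define n where "n = Suc m"
  have n: "0 < n" by (simp add: n_def)
  note hom = Suc.prems(1)[folded n_def] and sq = Suc.prems(2)[folded n_def]
  \<comment> \<open>Products of transvections along the first row and along the first column.\<close>
  define up :: "'k mat \<Rightarrow> 'k mat" where "up r = four_block_mat (1\<^sub>m 1) r (0\<^sub>m n 1) (1\<^sub>m n)" for r
  define lo :: "'k mat \<Rightarrow> 'k mat" where "lo z = four_block_mat (1\<^sub>m 1) (0\<^sub>m 1 n) z (1\<^sub>m n)" for z
  have fb: "four_block_mat a r c A \<in> carrier_mat (Suc n) (Suc n)"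
    if "a \<in> carrier_mat 1 1" "A \<in> carrier_mat n n" for a r c A :: "'k mat"
    using four_block_carrier_mat[OF that] by simp
  have up: "up r \<in> carrier_mat (Suc n) (Suc n)" "det (up r) = 1" if "r \<in> carrier_mat 1 n" for r
  proof -
    show "up r \<in> carrier_mat (Suc n) (Suc n)" unfolding up_def by (rule fb) auto
    have "det (up r) = det (1\<^sub>m 1 :: 'k mat) * det (1\<^sub>m n :: 'k mat)"
      unfolding up_def by (rule det_four_block_mat_lower_left_zero[OF _ that]) auto
    thus "det (up r) = 1" by simp
  qed
  have lo: "lo z \<in> carrier_mat (Suc n) (Suc n)" "det (lo z) = 1" if "z \<in> carrier_mat n 1" for z
  proof -
    show "lo z \<in> carrier_mat (Suc n) (Suc n)" unfolding lo_def by (rule fb) auto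
    have "det (lo z) = det (1\<^sub>m 1 :: 'k mat) * det (1\<^sub>m n :: 'k mat)"
      unfolding lo_def by (rule det_four_block_mat_upper_right_zero[OF _ _ that]) auto
    thus "det (lo z) = 1" by simp
  qed
  have zup: "\<zeta> (up r) = 1" if r: "r \<in> carrier_mat 1 n" for r
  proof -
    let ?r = "(1 / 2) \<cdot>\<^sub>m r"
    have h: "?r \<in> carrier_mat 1 n" using r by simp
    have "up ?r * up ?r = four_block_mat (1\<^sub>m 1 + ?r * 0\<^sub>m n 1) (?r + ?r * 1\<^sub>m n) (0\<^sub>m n 1) (1\<^sub>m n)"
      unfolding up_def by (rule mult_upper_unipotent[OF h _ h]) auto
    also have "1\<^sub>m 1 + ?r * 0\<^sub>m n 1 = (1\<^sub>m 1 :: 'k mat)" using r by simp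
    also have "?r + ?r * 1\<^sub>m n = r"
      using r two by (intro eq_matI) (auto simp: field_simps)
    finally have "up ?r * up ?r = up r" by (simp add: up_def)
    thus ?thesis using hom[of "up ?r" "up ?r"] sq[of "up ?r"] up[OF h] by simp
  qed
  have zlo: "\<zeta> (lo z) = 1" if z: "z \<in> carrier_mat n 1" for z
  proof -
    let ?z = "(1 / 2) \<cdot>\<^sub>m z"
    have h: "?z \<in> carrier_mat n 1" using z by simp
    have "lo ?z * lo ?z = four_block_mat (1\<^sub>m 1) (0\<^sub>m 1 n) (?z * 1\<^sub>m 1 + ?z) (?z * 0\<^sub>m 1 n + 1\<^sub>m n)"
      unfolding lo_def by (rule mult_lower_unipotent[OF h _ _ h]) auto
    also have "?z * 0\<^sub>m 1 n + 1\<^sub>m n = (1\<^sub>m n :: 'k mat)" using z by simp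
    also have "?z * 1\<^sub>m 1 + ?z = z"
      using z two by (intro eq_matI) (auto simp: field_simps)
    finally have "lo ?z * lo ?z = lo z" by (simp add: lo_def)
    thus ?thesis using hom[of "lo ?z" "lo ?z"] sq[of "lo ?z"] lo[OF h] by simp
  qed
  have mult_up: "\<zeta> (up r * E) = \<zeta> E \<and> det (up r * E) = det E"
    if "r \<in> carrier_mat 1 n" "E \<in> carrier_mat (Suc n) (Suc n)" "det E \<noteq> 0" for r E
    using hom[OF up(1)[OF that(1)] that(2) _ that(3)] zup[OF that(1)] up[OF that(1)]
      det_mult[OF up(1)[OF that(1)] that(2)] by simp
  have mult_lo: "\<zeta> (lo z * E) = \<zeta> E \<and> det (lo z * E) = det E"
    if "z \<in> carrier_mat n 1" "E \<in> carrier_mat (Suc n) (Suc n)" "det E \<noteq> 0" for z E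
    using hom[OF lo(1)[OF that(1)] that(2) _ that(3)] zlo[OF that(1)] lo[OF that(1)]
      det_mult[OF lo(1)[OF that(1)] that(2)] by simp
  define dg :: "'k mat \<Rightarrow> 'k mat" where "dg A = four_block_mat (1\<^sub>m 1) (0\<^sub>m 1 n) (0\<^sub>m n 1) A" for A
  have dg: "dg A \<in> carrier_mat (Suc n) (Suc n)" "det (dg A) = det A" if A: "A \<in> carrier_mat n n" for A
  proof -
    show "dg A \<in> carrier_mat (Suc n) (Suc n)" unfolding dg_def using A by (intro fb) auto
    have "det (dg A) = det (1\<^sub>m 1 :: 'k mat) * det A"
      unfolding dg_def by (rule det_four_block_mat_lower_left_zero[OF _ _ _ A]) auto
    thus "det (dg A) = det A" by simp
  qed
  have diag: "\<zeta> (dg A) = \<zeta> (diag_last (Suc n) (det A))" if A: "A \<in> carrier_mat n n" "det A \<noteq> 0" for A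
  proof -
    have "\<zeta> (dg A) = \<zeta> (dg (diag_last n (det A)))"
    proof (rule Suc.IH[of "\<lambda>A. \<zeta> (dg A)" A, folded n_def])
      show "A \<in> carrier_mat n n" "det A \<noteq> 0" by (fact A)+
    next
      fix D E :: "'k mat" assume DE: "D \<in> carrier_mat n n" "E \<in> carrier_mat n n" "det D \<noteq> 0" "det E \<noteq> 0"
      have "dg D * dg E = four_block_mat (1\<^sub>m 1 * 1\<^sub>m 1 + 0\<^sub>m 1 n * 0\<^sub>m n 1) (1\<^sub>m 1 * 0\<^sub>m 1 n + 0\<^sub>m 1 n * E)
        (0\<^sub>m n 1 * 1\<^sub>m 1 + D * 0\<^sub>m n 1) (0\<^sub>m n 1 * 0\<^sub>m 1 n + D * E)"
        unfolding dg_def using DE by (intro mult_four_block_mat[of _ 1 1 _ n _ n _ _ 1 _ n]) auto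
      also have "\<dots> = dg (D * E)" unfolding dg_def using DE by simp
      finally have "dg (D * E) = dg D * dg E" by simp
      thus "\<zeta> (dg (D * E)) = \<zeta> (dg D) * \<zeta> (dg E)"
        using hom[of "dg D" "dg E"] dg[OF DE(1)] dg[OF DE(2)] DE by simp
    next
      fix D :: "'k mat" assume D: "D \<in> carrier_mat n n" "det D \<noteq> 0"
      show "\<zeta> (dg D) * \<zeta> (dg D) = 1" using sq[of "dg D"] dg[OF D(1)] D by simp
    qed
    moreover have "dg (diag_last n (det A)) = diag_last (Suc n) (det A)"
      unfolding dg_def using n by (intro eq_matI) (auto simp: diag_last_def)
    ultimately show ?thesis by simp
  qed
  have corner_one: "\<zeta> E = \<zeta> (diag_last (Suc n) (det E))"
    if E: "E = four_block_mat (1\<^sub>m 1) r c A" "r \<in> carrier_mat 1 n" "c \<in> carrier_mat n 1" "A \<in> carrier_mat n n"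
      "det E \<noteq> 0" for E r c A
  proof -
    let ?B = "A - c * r"
    have B: "?B \<in> carrier_mat n n" using E by auto
    have cr: "c * r \<in> carrier_mat n n" using E by auto
    have "dg ?B * up r = four_block_mat (1\<^sub>m 1 * 1\<^sub>m 1 + 0\<^sub>m 1 n * 0\<^sub>m n 1) (1\<^sub>m 1 * r + 0\<^sub>m 1 n * 1\<^sub>m n)
        (0\<^sub>m n 1 * 1\<^sub>m 1 + ?B * 0\<^sub>m n 1) (0\<^sub>m n 1 * r + ?B * 1\<^sub>m n)"
      unfolding dg_def up_def using E B by (intro mult_four_block_mat[of _ 1 1 _ n _ n _ _ 1 _ n]) auto
    also have "\<dots> = four_block_mat (1\<^sub>m 1) r (0\<^sub>m n 1) ?B"
      using E B carrier_matD[OF B] by simp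
    finally have du: "dg ?B * up r = four_block_mat (1\<^sub>m 1) r (0\<^sub>m n 1) ?B" .
    have "lo c * (dg ?B * up r) = four_block_mat (1\<^sub>m 1) r (c * 1\<^sub>m 1 + 0\<^sub>m n 1) (c * r + ?B)"
      unfolding du lo_def by (rule mult_lower_unipotent[OF E(3) _ E(2) _ B]) auto
    also have "c * 1\<^sub>m 1 + 0\<^sub>m n 1 = c" using E(3) by simp
    also have "c * r + ?B = A"
    proof -
      have "X + (A - X) = A" if "X \<in> carrier_mat n n" for X
        using that E(4) by (intro eq_matI) auto
      thus ?thesis using cr by blast
    qed
    finally have dec: "lo c * (dg ?B * up r) = E" using E(1) by simp
    have c: "dg ?B * up r \<in> carrier_mat (Suc n) (Suc n)" using dg(1)[OF B] up(1)[OF E(2)] by auto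
    have d1: "det (dg ?B * up r) = det ?B"
      using det_mult[OF dg(1)[OF B] up(1)[OF E(2)]] dg(2)[OF B] up(2)[OF E(2)] by simp
    have d2: "det E = det ?B"
      unfolding dec[symmetric] det_mult[OF lo(1)[OF E(3)] c] lo(2)[OF E(3)] d1 by simp
    have nz: "det ?B \<noteq> 0" using d2 E(5) by simp
    have "\<zeta> E = \<zeta> (dg ?B * up r)" using mult_lo[OF E(3) c] d1 nz dec by simp
    also have "\<dots> = \<zeta> (dg ?B)"
      using hom[OF dg(1)[OF B] up(1)[OF E(2)]] dg(2)[OF B] up(2)[OF E(2)] zup[OF E(2)] nz by simp
    also have "\<dots> = \<zeta> (diag_last (Suc n) (det E))" using diag[OF B nz] d2 by simp
    finally show ?thesis .
  qed
  \<comment> \<open>A nonzero entry below the corner serves to make the corner equal to one.\<close>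
  have column_nonzero: "\<zeta> E = \<zeta> (diag_last (Suc n) (det E))"
    if E: "E = four_block_mat a r c A" "a \<in> carrier_mat 1 1" "r \<in> carrier_mat 1 n" "c \<in> carrier_mat n 1"
      "A \<in> carrier_mat n n" "det E \<noteq> 0" "c \<noteq> 0\<^sub>m n 1" for E a r c A
  proof -
    obtain i where i: "i < n" "c $$ (i, 0) \<noteq> 0"
    proof (rule ccontr)
      assume "\<not> thesis"
      hence "c = 0\<^sub>m n 1" using E(4) that by (intro eq_matI) auto
      thus False using E(7) by blast
    qed
    define y where "y = mat 1 n (\<lambda>(_, j). if j = i then (1 - a $$ (0, 0)) / c $$ (i, 0) else 0)"
    have y: "y \<in> carrier_mat 1 n" by (simp add: y_def)
    have "(y * c) $$ (0, 0)
        = (\<Sum>j \<in> {0..<n}. (if j = i then (1 - a $$ (0, 0)) / c $$ (i, 0) else 0) * c $$ (j, 0))"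
      using E(4) by (simp add: y_def scalar_prod_def)
    also have "\<dots> = (\<Sum>j \<in> {0..<n}. if j = i then 1 - a $$ (0, 0) else 0)"
      using i by (intro sum.cong) auto
    also have "\<dots> = 1 - a $$ (0, 0)" using i by simp
    finally have "a + y * c = 1\<^sub>m 1" using E(2,4) y by (intro eq_matI) auto
    hence uE: "up y * E = four_block_mat (1\<^sub>m 1) (r + y * A) c A"
      unfolding up_def E(1) mult_upper_unipotent[OF y E(2-5)] by simp
    have Ec: "E \<in> carrier_mat (Suc n) (Suc n)" unfolding E(1) using E by (intro fb) auto
    note mu = mult_up[OF y Ec E(6)]
    have "\<zeta> (up y * E) = \<zeta> (diag_last (Suc n) (det (up y * E)))"
      using E y mu by (intro corner_one[OF uE]) auto
    thus ?thesis using mu by simp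
  qed
  obtain a r c A where sp: "split_block D 1 1 = (a, r, c, A)" by (metis prod_cases4)
  have D: "D = four_block_mat a r c A" "a \<in> carrier_mat 1 1" "r \<in> carrier_mat 1 n" "c \<in> carrier_mat n 1"
    "A \<in> carrier_mat n n"
    using split_block[OF sp, of n n] Suc.prems(3) by (auto simp: n_def)
  have dD: "det D \<noteq> 0" by (fact Suc.prems(4))
  have "\<zeta> D = \<zeta> (diag_last (Suc n) (det D))"
  proof (cases "c = 0\<^sub>m n 1")
    case False thus ?thesis using column_nonzero[OF D(1-5) dD] by blast
  next
    case True
    have "det D = det a * det A"
      unfolding D(1) by (rule det_four_block_mat_lower_left_zero[OF D(2,3) True D(5)])
    hence a0: "a $$ (0, 0) \<noteq> 0" using dD det_single[of a] D(2) by auto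
    \<comment> \<open>The column below the corner vanishes, so the corner is copied into it.\<close>
    define z :: "'k mat" where "z = mat n 1 (\<lambda>(i, _). if i = 0 then 1 else 0)"
    have z: "z \<in> carrier_mat n 1" by (simp add: z_def)
    have lE: "lo z * D = four_block_mat a r (z * a + c) (z * r + A)"
      unfolding lo_def D(1) by (rule mult_lower_unipotent[OF z D(2-5)])
    have "(z * a + c) $$ (0, 0) = a $$ (0, 0)"
      using z D(2) n by (simp add: z_def True scalar_prod_def)
    hence ne: "z * a + c \<noteq> 0\<^sub>m n 1" using a0 n by auto
    have Dc: "D \<in> carrier_mat (Suc n) (Suc n)" using Suc.prems(3) by (simp add: n_def)
    note ml = mult_lo[OF z Dc dD]
    have "\<zeta> (lo z * D) = \<zeta> (diag_last (Suc n) (det (lo z * D)))"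
      using D z ml dD by (intro column_nonzero[OF lE _ _ _ _ _ ne]) auto
    thus ?thesis using ml by simp
  qed
  thus ?case by (simp add: n_def)
qed

section \<open>A quadratic twist on frames\<close>

text \<open>The sign of the first nonzero entry, which reverses under \<open>x \<mapsto> - x\<close> for nonzero \<open>x\<close>.\<close>

definition row_sign :: "nat \<Rightarrow> 'k::{field,finite} mat \<Rightarrow> complex" where
  "row_sign n x = field_sign (x $$ (0, LEAST i. i < n \<and> x $$ (0, i) \<noteq> 0))"

lemma row_sign_least:
  assumes "i < n" "x $$ (0, i) \<noteq> 0" "\<And>j. j < i \<Longrightarrow> x $$ (0, j) = 0"
  shows "row_sign n x = field_sign (x $$ (0, i))"
proof -
  have "(LEAST i. i < n \<and> x $$ (0, i) \<noteq> 0) = i"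
    using assms by (intro Least_equality) (auto simp: not_le[symmetric])
  thus ?thesis by (simp add: row_sign_def)
qed

lemma nonzero_row_least:
  assumes "x \<in> rows_of n" "x \<noteq> 0\<^sub>m 1 n"
  obtains i where "i < n" "x $$ (0, i) \<noteq> 0" "\<And>j. j < i \<Longrightarrow> x $$ (0, j) = 0"
proof -
  have ex: "\<exists>i. i < n \<and> x $$ (0, i) \<noteq> 0"
  proof (rule ccontr)
    assume "\<not> ?thesis"
    hence "x = 0\<^sub>m 1 n" using assms(1) by (intro row_eqI[of _ n]) auto
    thus False using assms(2) by blast
  qed
  let ?i = "LEAST i. i < n \<and> x $$ (0, i) \<noteq> 0"
  have "?i < n \<and> x $$ (0, ?i) \<noteq> 0" using ex by (rule LeastI_ex)
  moreover have "x $$ (0, j) = 0" if "j < ?i" for j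
    using not_less_Least[OF that] that calculation by auto
  ultimately show ?thesis using that by blast
qed

context hyperbolic_space
begin

lemma row_sign_pm: "row_sign m (x :: 'k mat) = 1 \<or> row_sign m x = -1"
  unfolding row_sign_def by (rule field_sign_pm[OF odd_q])

lemma row_sign_square: "row_sign m (x :: 'k mat) * row_sign m x = 1"
  using row_sign_pm[of m x] by auto

lemma row_sign_uminus:
  assumes "(x :: 'k mat) \<in> rows_of m" "x \<noteq> 0\<^sub>m 1 m"
  shows "row_sign m (- x) = - row_sign m x"
proof -
  obtain i where i: "i < m" "x $$ (0, i) \<noteq> 0" "\<And>j. j < i \<Longrightarrow> x $$ (0, j) = 0"
    using nonzero_row_least[OF assms] by blast
  have "row_sign m (- x) = field_sign ((- x) $$ (0, i))"
    using i assms(1) by (intro row_sign_least) auto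
  also have "(- x) $$ (0, i) = - x $$ (0, i)" using i assms(1) by simp
  also have "field_sign (- x $$ (0, i)) = - field_sign (x $$ (0, i))"
    by (rule field_sign_odd[OF odd_q i(2)])
  also have "field_sign (x $$ (0, i)) = row_sign m x" using row_sign_least[of i m x] i by simp
  finally show ?thesis .
qed

definition nzrows :: "'k mat set" where "nzrows = rows_of n - {0\<^sub>m 1 n}"

lemma nzrows_uminus:
  assumes "x \<in> nzrows"
  shows "- x \<in> nzrows \<and> - (- x) = x \<and> row_sign n (- x) = - row_sign n x \<and> (row_sign n x = 1 \<or> row_sign n x = -1)"
proof -
  have x: "x \<in> rows_of n" "x \<noteq> 0\<^sub>m 1 n" using assms by (auto simp: nzrows_def)
  have mm: "- (- x) = x" using x by (intro row_eqI[of _ n]) auto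
  have "- x \<noteq> 0\<^sub>m 1 n"
  proof
    assume "- x = 0\<^sub>m 1 n"
    hence "x = - 0\<^sub>m 1 n" using mm by simp
    also have "\<dots> = 0\<^sub>m 1 n" by (intro row_eqI[of _ n]) auto
    finally show False using x(2) by blast
  qed
  thus ?thesis using x mm row_sign_uminus[OF x] row_sign_pm[of n x] by (simp add: nzrows_def)
qed

lemma GLs_bij_nzrows:
  assumes D: "D \<in> GLs" shows "bij_betw (\<lambda>x. x * D) nzrows nzrows"
proof -
  obtain E where E: "E \<in> GLs" "D * E = 1\<^sub>m n" "E * D = 1\<^sub>m n" using GLs_inverse[OF D] by metis
  have c: "D \<in> carrier_mat n n" "E \<in> carrier_mat n n" using D E by (auto simp: GLs_def)
  have inv: "x * A * B = x" if "A \<in> carrier_mat n n" "B \<in> carrier_mat n n" "A * B = 1\<^sub>m n" "x \<in> rows_of n"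
    for x A B :: "'k mat"
    using assoc_mult_mat[OF that(4,1,2)] that by simp
  have nz: "x * A \<in> nzrows" if "A \<in> carrier_mat n n" "B \<in> carrier_mat n n" "A * B = 1\<^sub>m n" "x \<in> nzrows"
    for x A B
  proof -
    have x: "x \<in> rows_of n" "x \<noteq> 0\<^sub>m 1 n" using that by (auto simp: nzrows_def)
    have "x * A \<noteq> 0\<^sub>m 1 n"
    proof
      assume z: "x * A = 0\<^sub>m 1 n"
      have "x = x * A * B" using inv[OF that(1-3) x(1)] by simp
      also have "\<dots> = 0\<^sub>m 1 n" unfolding z by (rule left_mult_zero_mat[OF that(2)])
      finally show False using x(2) by blast
    qed
    thus ?thesis using x that by (auto simp: nzrows_def)
  qed
  show ?thesis
  proof (rule bij_betw_byWitness[where f' = "\<lambda>x. x * E"])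
    show "\<forall>x \<in> nzrows. x * D * E = x" using inv[OF c E(2)] by (auto simp: nzrows_def)
    show "\<forall>x \<in> nzrows. x * E * D = x" using inv[OF c(2,1) E(3)] by (auto simp: nzrows_def)
    show "(\<lambda>x. x * D) ` nzrows \<subseteq> nzrows" using nz[OF c E(2)] by blast
    show "(\<lambda>x. x * E) ` nzrows \<subseteq> nzrows" using nz[OF c(2,1) E(3)] by blast
  qed
qed

text \<open>The number of sign changes that \<open>D\<close> causes on a half system of the nonzero rows, as a
  sign. For \<open>n = 1\<close> this is the Gauss sign of \<open>D\<close>.\<close>

definition zolotarev :: "'k mat \<Rightarrow> complex" where
  "zolotarev D = (\<Prod>x \<in> {x \<in> nzrows. row_sign n x = 1}. row_sign n (x * D))"

lemma zolotarev_square: "zolotarev D * zolotarev D = 1"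
proof -
  have "zolotarev D = 1 \<or> zolotarev D = -1"
    unfolding zolotarev_def by (rule prod_pm_one) (rule row_sign_pm)
  thus ?thesis by auto
qed

text \<open>Writing the sign of \<open>x * D * E\<close> relative to that of \<open>x * D\<close> gives a function of \<open>x * D\<close>
  that is unchanged under negation, so that the half system moved by \<open>D\<close> may be replaced by the
  original one.\<close>

lemma zolotarev_mult:
  assumes D: "D \<in> GLs" and E: "E \<in> GLs"
  shows "zolotarev (D * E) = zolotarev D * zolotarev E"
proof -
  let ?H = "{x \<in> nzrows. row_sign n x = 1}"
  have c: "D \<in> carrier_mat n n" "E \<in> carrier_mat n n" using D E by (auto simp: GLs_def)
  have xc: "x \<in> rows_of n" if "x \<in> nzrows" for x using that by (simp add: nzrows_def)
  have "zolotarev (D * E) = (\<Prod>x \<in> ?H. (row_sign n (x * D * E) * row_sign n (x * D)) * row_sign n (x * D))"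
    unfolding zolotarev_def
  proof (rule prod.cong)
    fix x assume "x \<in> ?H"
    hence x: "x \<in> rows_of n" using xc by blast
    have "x * (D * E) = x * D * E" by (rule assoc_mult_mat[symmetric, OF x c])
    thus "row_sign n (x * (D * E)) = (row_sign n (x * D * E) * row_sign n (x * D)) * row_sign n (x * D)"
      unfolding mult.assoc row_sign_square by simp
  qed simp
  also have "\<dots> = (\<Prod>x \<in> ?H. row_sign n (x * D * E) * row_sign n (x * D)) * zolotarev D"
    unfolding zolotarev_def by (rule prod.distrib)
  also have "(\<Prod>x \<in> ?H. row_sign n (x * D * E) * row_sign n (x * D)) = (\<Prod>x \<in> ?H. row_sign n (x * E) * row_sign n x)"
  proof (rule half_system_reindex[where f = "\<lambda>x. x * D" and mA = uminus and mB = uminus, OF GLs_bij_nzrows[OF D]])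
    fix x assume x: "x \<in> nzrows"
    show "- x \<in> nzrows \<and> row_sign n (- x) = - row_sign n x \<and> (row_sign n x = 1 \<or> row_sign n x = -1)"
      using nzrows_uminus[OF x] by blast
    show "- x \<in> nzrows \<and> - (- x) = x \<and> row_sign n (- x) = - row_sign n x \<and> (row_sign n x = 1 \<or> row_sign n x = -1)"
      by (rule nzrows_uminus[OF x])
    show "- x * D = - (x * D)" using xc[OF x] c by simp
    have e: "- x * E = - (x * E)" using xc[OF x] c by simp
    have "x * E \<in> nzrows" using GLs_bij_nzrows[OF E] x by (auto simp: bij_betw_def)
    thus "row_sign n (- x * E) * row_sign n (- x) = row_sign n (x * E) * row_sign n x"
      unfolding e using nzrows_uminus[of "x * E"] nzrows_uminus[OF x] by simp
  qed
  also have "\<dots> = zolotarev E"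
    unfolding zolotarev_def by (intro prod.cong) auto
  finally show ?thesis by (simp only: mult.commute)
qed

text \<open>Scaling the last coordinate changes the leading entry only of the rows whose other
  coordinates vanish.\<close>

lemma zolotarev_diag_last:
  assumes t: "(t :: 'k) \<noteq> 0"
  shows "zolotarev (diag_last n t) = (\<Prod>a \<in> {a. a \<noteq> 0 \<and> field_sign a = 1}. field_sign (t * a))"
proof -
  let ?H = "{a :: 'k. a \<noteq> 0 \<and> field_sign a = 1}" and ?X = "{x \<in> nzrows. row_sign n x = 1}"
  define u :: "'k \<Rightarrow> 'k mat" where "u a = mat 1 n (\<lambda>(_, j). if Suc j = n then a else 0)" for a
  have entry: "(x * diag_last n t) $$ (0, j) = (if Suc j = n then t * x $$ (0, j) else x $$ (0, j))"
    if "x \<in> rows_of n" "j < n" for x j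
  proof -
    have "(x * diag_last n t) $$ (0, j)
        = (\<Sum>i \<in> {0..<n}. x $$ (0, i) * (if i = j then if Suc i = n then t else 1 else 0))"
      using that by (simp add: diag_last_def scalar_prod_def)
    also have "\<dots> = (\<Sum>i \<in> {0..<n}. if i = j then x $$ (0, i) * (if Suc i = n then t else 1) else 0)"
      by (intro sum.cong) auto
    also have "\<dots> = (if Suc j = n then t * x $$ (0, j) else x $$ (0, j))"
      using that by (simp add: mult.commute)
    finally show ?thesis .
  qed
  have uc: "u a \<in> rows_of n" for a by (simp add: u_def)
  have last: "n - 1 < n" "Suc (n - 1) = n" using n_pos by auto
  have ul: "u a $$ (0, n - 1) = a" for a using last by (simp add: u_def)
  have us: "row_sign n (u a) = field_sign a" if "a \<noteq> 0" for a
  proof -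
    have "row_sign n (u a) = field_sign (u a $$ (0, n - 1))"
    proof (rule row_sign_least[OF last(1)])
      show "u a $$ (0, n - 1) \<noteq> 0" using ul that by simp
      fix j assume "j < n - 1"
      thus "u a $$ (0, j) = 0" by (simp add: u_def)
    qed
    thus ?thesis unfolding ul .
  qed
  have unz: "u a \<in> nzrows" if "a \<noteq> 0" for a
  proof -
    have "u a \<noteq> 0\<^sub>m 1 n" using ul[of a] that last by auto
    thus ?thesis using uc by (simp add: nzrows_def)
  qed
  have ut: "u a * diag_last n t = u (t * a)" for a
  proof (rule row_eqI[of _ n])
    show "u a * diag_last n t \<in> rows_of n" using uc[of a] by (auto simp: diag_last_def)
    show "u (t * a) \<in> rows_of n" by (rule uc)
    fix i assume "i < n"
    thus "(u a * diag_last n t) $$ (0, i) = u (t * a) $$ (0, i)"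
      unfolding entry[OF uc \<open>i < n\<close>] by (simp add: u_def)
  qed
  have inj: "inj_on u ?H" by (rule inj_onI) (metis ul)
  have "zolotarev (diag_last n t) = (\<Prod>x \<in> u ` ?H. row_sign n (x * diag_last n t))"
    unfolding zolotarev_def
  proof (rule prod.mono_neutral_right)
    show "finite ?X" by (rule finite_subset[OF _ finite_carrier_mat[of 1 n]]) (auto simp: nzrows_def)
    show "u ` ?H \<subseteq> ?X" using unz us by auto
    show "\<forall>x \<in> ?X - u ` ?H. row_sign n (x * diag_last n t) = 1"
    proof
      fix x assume x: "x \<in> ?X - u ` ?H"
      hence xc: "x \<in> rows_of n" "x \<noteq> 0\<^sub>m 1 n" "row_sign n x = 1" by (auto simp: nzrows_def)
      obtain i where i: "i < n" "x $$ (0, i) \<noteq> 0" "\<And>j. j < i \<Longrightarrow> x $$ (0, j) = 0"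
        using nonzero_row_least[OF xc(1,2)] by blast
      have xi: "row_sign n x = field_sign (x $$ (0, i))" by (rule row_sign_least[OF i])
      have "Suc i \<noteq> n"
      proof
        assume s: "Suc i = n"
        have "x = u (x $$ (0, i))"
        proof (rule row_eqI[OF xc(1) uc])
          fix j assume "j < n"
          thus "x $$ (0, j) = u (x $$ (0, i)) $$ (0, j)"
            using i(3)[of j] s by (cases "j = i") (auto simp: u_def)
        qed
        moreover have "x $$ (0, i) \<in> ?H" using i(2) xi xc(3) by simp
        ultimately show False using x by blast
      qed
      hence e: "(x * diag_last n t) $$ (0, j) = x $$ (0, j)" if "j \<le> i" for j
        using entry[OF xc(1), of j] that i(1) by simp
      have "row_sign n (x * diag_last n t) = field_sign ((x * diag_last n t) $$ (0, i))"
        using i e by (intro row_sign_least) auto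
      thus "row_sign n (x * diag_last n t) = 1" using e[of i] xi xc(3) by simp
    qed
  qed
  also have "\<dots> = (\<Prod>a \<in> ?H. row_sign n (u a * diag_last n t))"
    by (simp add: prod.reindex[OF inj])
  also have "\<dots> = (\<Prod>a \<in> ?H. field_sign (t * a))"
    using t by (intro prod.cong refl) (simp add: ut us)
  finally show ?thesis .
qed

lemma zolotarev_eq:
  fixes \<beta> :: "'k \<Rightarrow> complex"
  assumes \<beta>: "\<beta> \<in> mult_characters" "\<forall>x. x \<noteq> 0 \<longrightarrow> \<beta> x ^ 2 = 1" "\<exists>x. x \<noteq> 0 \<and> \<beta> x \<noteq> 1"
    and D: "D \<in> GLs"
  shows "zolotarev D = \<beta> (det D)"
proof -
  obtain m where m: "Suc m = n" using n_pos by (cases n) auto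
  have "zolotarev D = zolotarev (diag_last (Suc m) (det D))"
  proof (rule sign_character_eq_det[where \<zeta> = zolotarev and n = m and D = D])
    show "(2 :: 'k) \<noteq> 0" by (rule two_neq_zero[OF odd_q])
    fix D E :: "'k mat"
    assume "D \<in> carrier_mat (Suc m) (Suc m)" "E \<in> carrier_mat (Suc m) (Suc m)" "det D \<noteq> 0" "det E \<noteq> 0"
    thus "zolotarev (D * E) = zolotarev D * zolotarev E"
      by (intro zolotarev_mult) (auto simp: GLs_def m)
  next
    fix D show "zolotarev D * zolotarev D = 1" by (rule zolotarev_square)
  qed (use D in \<open>auto simp: GLs_def m\<close>)
  also have "\<dots> = (\<Prod>a \<in> {a. a \<noteq> 0 \<and> field_sign a = 1}. field_sign (det D * a))"
    unfolding m using D by (intro zolotarev_diag_last) (simp add: GLs_def)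
  also have "\<dots> = \<beta> (det D)"
    using D by (intro quadratic_character_eq_gauss_product[OF odd_q \<beta>]) (simp add: GLs_def)
  finally show ?thesis .
qed

text \<open>The reflection \<open>y \<mapsto> 2 * z - y\<close> in a point \<open>z\<close> of the hyperplane fixes nothing else.\<close>

lemma odd_affine_hyperplane:
  assumes x: "x \<in> nzrows" shows "odd (card {y \<in> rows_of n. dot x y = 1})"
proof -
  have xc: "x \<in> rows_of n" "x \<noteq> 0\<^sub>m 1 n" using x by (auto simp: nzrows_def)
  let ?S = "{y \<in> rows_of n. dot x y = 1}"
  obtain z where z: "z \<in> rows_of n" "dot x z = 1"
    using ex_dual_row[of "[]" n x] xc by auto
  have fin: "finite ?S" by (rule finite_subset[OF _ finite_carrier_mat[of 1 n]]) auto
  have "even (card (?S - {z}))"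
  proof (rule even_card_fixpoint_free_involution[where f = "\<lambda>y. (2 \<cdot>\<^sub>m z) - y"])
    fix y assume "y \<in> ?S - {z}"
    hence y: "y \<in> rows_of n" "dot x y = 1" "y \<noteq> z" by auto
    have c: "2 \<cdot>\<^sub>m z \<in> rows_of n" using z by simp
    have c': "2 \<cdot>\<^sub>m z - y \<in> rows_of n" using c y(1) by (simp add: minus_carrier_mat)
    have d: "dot x (2 \<cdot>\<^sub>m z - y) = 1"
      using dot_diff_right[OF c y(1) xc(1)] dot_smult_right[OF z(1) xc(1), of 2] z y by simp
    have inv: "2 \<cdot>\<^sub>m z - (2 \<cdot>\<^sub>m z - y) = y" using c y(1) by (intro row_eqI[of _ n]) auto
    have ne: "2 \<cdot>\<^sub>m z - y \<noteq> z"
    proof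
      assume e: "2 \<cdot>\<^sub>m z - y = z"
      have "y = z"
      proof (rule row_eqI[OF y(1) z(1)])
        fix i assume "i < n"
        thus "y $$ (0, i) = z $$ (0, i)"
          using arg_cong[OF e, of "\<lambda>M. M $$ (0, i)"] y(1) z(1) by (simp add: algebra_simps)
      qed
      thus False using y(3) by blast
    qed
    have fixfree: "2 \<cdot>\<^sub>m z - y \<noteq> y"
    proof
      assume e: "2 \<cdot>\<^sub>m z - y = y"
      have "y = z"
      proof (rule row_eqI[OF y(1) z(1)])
        fix i assume "i < n"
        hence "2 * z $$ (0, i) = 2 * y $$ (0, i)"
          using arg_cong[OF e, of "\<lambda>M. M $$ (0, i)"] y(1) z(1) by (simp add: algebra_simps)
        thus "y $$ (0, i) = z $$ (0, i)" using two_neq_zero[OF odd_q] by simp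
      qed
      thus False using y(3) by blast
    qed
    show "2 \<cdot>\<^sub>m z - y \<in> ?S - {z} \<and> 2 \<cdot>\<^sub>m z - (2 \<cdot>\<^sub>m z - y) = y \<and> 2 \<cdot>\<^sub>m z - y \<noteq> y"
      using c' d inv ne fixfree by blast
  qed (use fin in simp)
  moreover have "card ?S = Suc (card (?S - {z}))"
    using fin z by (intro card.remove) auto
  ultimately show ?thesis by simp
qed

text \<open>The norm two makes the coordinates \<open>x\<close>, \<open>y\<close> of such a vector in a hyperbolic basis
  satisfy \<open>dot x y = 1\<close>; see \<open>norm_two_rows_param\<close>. In particular no coordinate row vanishes,
  and each has a sign.\<close>

definition norm_two_rows :: "'k mat set" where
  "norm_two_rows = {v \<in> rows_of (2 * n). form v v $$ (0, 0) = 2}"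

definition unit_pairs :: "('k mat \<times> 'k mat) set" where
  "unit_pairs = {(x, y). x \<in> rows_of n \<and> y \<in> rows_of n \<and> dot x y = 1}"

lemma form_uminus_left:
  assumes "v \<in> carrier_mat k (2 * n)" "R \<in> carrier_mat l (2 * n)"
  shows "form (- v) R = - form v R"
proof -
  have e: "- A = (-1) \<cdot>\<^sub>m A" for A :: "'k mat" by (intro eq_matI) auto
  show ?thesis unfolding e by (rule form_smult_left[OF assms])
qed

lemma unit_pairs_nzrows: "(x, y) \<in> unit_pairs \<Longrightarrow> x \<in> nzrows"
  using dot_zero(1)[of y n] by (auto simp: unit_pairs_def nzrows_def)

lemma norm_two_rows_param:
  assumes h: "hyper R' R"
  shows "bij_betw (\<lambda>v. (form v R, form v R')) norm_two_rows unit_pairs"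
proof (rule bij_betw_byWitness[where f' = "\<lambda>(x, y). x * R' + y * R"])
  note hD = hyperD[OF h]
  have two: "(2 :: 'k) \<noteq> 0" by (rule two_neq_zero[OF odd_q])
  have norm: "form v v $$ (0, 0) = 2 * dot (form v R) (form v R')" if v: "v \<in> rows_of (2 * n)" for v
    using form_rows_expansion[OF h v v] dot_commute[OF form_carrier[OF v hD(2)] form_carrier[OF v hD(1)]]
    by simp
  have inv: "form (x * R' + y * R) R = x" "form (x * R' + y * R) R' = y" "x * R' + y * R \<in> rows_of (2 * n)"
    if xy: "x \<in> rows_of n" "y \<in> rows_of n" for x y
  proof -
    have p: "x * R' \<in> rows_of (2 * n)" "y * R \<in> rows_of (2 * n)" using xy hD by auto
    show "form (x * R' + y * R) R = x"
      unfolding form_add_left[OF p hD(2)] form_mult_left[OF xy(1) hD(1,2)] form_mult_left[OF xy(2) hD(2,2)]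
        hD(4,5) using xy by simp
    show "form (x * R' + y * R) R' = y"
      unfolding form_add_left[OF p hD(1)] form_mult_left[OF xy(1) hD(1,1)] form_mult_left[OF xy(2) hD(2,1)]
        hD(3,6) using xy by simp
    show "x * R' + y * R \<in> rows_of (2 * n)" using p by simp
  qed
  show "\<forall>v \<in> norm_two_rows. (case (form v R, form v R') of (x, y) \<Rightarrow> x * R' + y * R) = v"
  proof
    fix v assume "v \<in> norm_two_rows"
    hence "v \<in> rows_of (2 * n)" by (simp add: norm_two_rows_def)
    from hyper_expansion[OF h this] show "(case (form v R, form v R') of (x, y) \<Rightarrow> x * R' + y * R) = v"
      by (simp only: prod.case)
  qed
  show "\<forall>p \<in> unit_pairs. (form (case p of (x, y) \<Rightarrow> x * R' + y * R) R,
      form (case p of (x, y) \<Rightarrow> x * R' + y * R) R') = p"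
    using inv by (auto simp: unit_pairs_def)
  show "(\<lambda>v. (form v R, form v R')) ` norm_two_rows \<subseteq> unit_pairs"
  proof (rule image_subsetI)
    fix v assume "v \<in> norm_two_rows"
    hence v: "v \<in> rows_of (2 * n)" "form v v $$ (0, 0) = 2" by (auto simp: norm_two_rows_def)
    have "2 * dot (form v R) (form v R') = 2 * 1" using norm[OF v(1)] v(2) by simp
    hence "dot (form v R) (form v R') = 1" using two mult_left_cancel by blast
    thus "(form v R, form v R') \<in> unit_pairs"
      using form_carrier[OF v(1) hD(2)] form_carrier[OF v(1) hD(1)] by (simp add: unit_pairs_def)
  qed
  show "(\<lambda>(x, y). x * R' + y * R) ` unit_pairs \<subseteq> norm_two_rows"
  proof (clarify)
    fix x y assume "(x, y) \<in> unit_pairs"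
    hence xy: "x \<in> rows_of n" "y \<in> rows_of n" "dot x y = 1" by (auto simp: unit_pairs_def)
    show "x * R' + y * R \<in> norm_two_rows"
      using norm[OF inv(3)[OF xy(1,2)]] inv[OF xy(1,2)] xy(3) by (simp add: norm_two_rows_def)
  qed
qed

text \<open>One vector is taken from each pair \<open>v, - v\<close>. The set of vectors does not depend on \<open>R\<close>,
  so different frames can be compared factor by factor.\<close>

definition twist :: "'k mat \<Rightarrow> complex" where
  "twist R = (\<Prod>v \<in> {v \<in> norm_two_rows. row_sign (2 * n) v = 1}. row_sign n (form v R))"

lemma twist_pm: "twist R = 1 \<or> twist R = -1"
  unfolding twist_def by (rule prod_pm_one) (rule row_sign_pm)

text \<open>In the coordinates given by a hyperbolic pair the half system of norm-two vectors may be
  replaced by one that refers to the first coordinate alone. The product then no longer depends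
  on the pair.\<close>

lemma twist_reindex:
  assumes h: "hyper R' R"
    and \<kappa>: "\<And>x y. (x, y) \<in> unit_pairs \<Longrightarrow> \<kappa> (- x, - y) = \<kappa> (x, y)"
  shows "(\<Prod>v \<in> {v \<in> norm_two_rows. row_sign (2 * n) v = 1}. \<kappa> (form v R, form v R'))
    = (\<Prod>p \<in> {p \<in> unit_pairs. row_sign n (fst p) = 1}. (\<kappa> p :: complex))"
proof (rule half_system_reindex[where f = "\<lambda>v. (form v R, form v R')" and mA = uminus
      and mB = "\<lambda>p. (- fst p, - snd p)", OF norm_two_rows_param[OF h]])
  note hD = hyperD[OF h]
  fix v assume "v \<in> norm_two_rows"
  hence v: "v \<in> rows_of (2 * n)" "form v v $$ (0, 0) = 2" by (auto simp: norm_two_rows_def)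
  have two: "(2 :: 'k) \<noteq> 0" by (rule two_neq_zero[OF odd_q])
  have nz: "v \<noteq> 0\<^sub>m 1 (2 * n)"
  proof
    assume z: "v = 0\<^sub>m 1 (2 * n)"
    have "form (0\<^sub>m 1 (2 * n)) (0\<^sub>m 1 (2 * n)) = 0\<^sub>m 1 1"
      using carrier_matD[OF J_carrier] by (simp add: form_def)
    thus False using v(2) two unfolding z by simp
  qed
  have mv: "- v \<in> rows_of (2 * n)" using v(1) by simp
  have "form (- v) (- v) = - (- form v v)"
    using form_uminus_left[OF v(1) mv] form_transpose[OF v(1) mv] form_transpose[OF mv v(1)]
      form_uminus_left[OF v(1) v(1)] form_transpose[OF v(1) v(1)] by (metis transpose_uminus)
  hence "form (- v) (- v) $$ (0, 0) = 2" using v form_carrier[OF v(1) v(1)] by simp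
  thus "- v \<in> norm_two_rows \<and> row_sign (2 * n) (- v) = - row_sign (2 * n) v
      \<and> (row_sign (2 * n) v = 1 \<or> row_sign (2 * n) v = -1)"
    using mv row_sign_uminus[OF v(1) nz] row_sign_pm[of "2 * n" v] by (simp add: norm_two_rows_def)
  show "(form (- v) R, form (- v) R') = (- fst (form v R, form v R'), - snd (form v R, form v R'))"
    using form_uminus_left[OF v(1) hD(1)] form_uminus_left[OF v(1) hD(2)] by simp
next
  fix p assume "p \<in> unit_pairs"
  then obtain x y where p: "p = (x, y)" "(x, y) \<in> unit_pairs" by (cases p) auto
  have xy: "x \<in> rows_of n" "y \<in> rows_of n" "dot x y = 1" using p by (auto simp: unit_pairs_def)
  have my: "- (- y) = y" using xy(2) by (intro row_eqI[of _ n]) auto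
  have "dot (- x) (- y) = dot x y" using xy by (simp add: dot_def)
  hence "(- x, - y) \<in> unit_pairs" using xy by (simp add: unit_pairs_def)
  thus "(- fst p, - snd p) \<in> unit_pairs \<and>
      (- fst (- fst p, - snd p), - snd (- fst p, - snd p)) = p \<and>
      row_sign n (fst (- fst p, - snd p)) = - row_sign n (fst p) \<and>
      (row_sign n (fst p) = 1 \<or> row_sign n (fst p) = -1)"
    using nzrows_uminus[OF unit_pairs_nzrows[OF p(2)]] my by (simp add: p(1))
  show "\<kappa> (- fst p, - snd p) = \<kappa> p" using \<kappa>[OF p(2)] by (simp add: p(1))
qed

text \<open>The product \<open>twist R * twist R'\<close> runs over the signs of both coordinates, a function
  that negation leaves unchanged; so it is the same for all hyperbolic pairs.\<close>

lemma twist_opposite: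
  "\<exists>c. c * c = 1 \<and> (\<forall>R R'. hyper R' R \<longrightarrow> twist R' = c * twist R)"
proof -
  let ?c = "\<Prod>p \<in> {p \<in> unit_pairs. row_sign n (fst p) = 1}. row_sign n (fst p) * row_sign n (snd p)"
  have "twist R' = ?c * twist R" if h: "hyper R' R" for R R'
  proof -
    have "twist R * twist R' = (\<Prod>v \<in> {v \<in> norm_two_rows. row_sign (2 * n) v = 1}.
        (\<lambda>p. row_sign n (fst p) * row_sign n (snd p)) (form v R, form v R'))"
      unfolding twist_def by (simp add: prod.distrib)
    also have "\<dots> = ?c"
    proof (rule twist_reindex[OF h])
      fix x y assume p: "(x, y) \<in> unit_pairs"
      have "(y, x) \<in> unit_pairs" using p dot_commute[of x n y] by (auto simp: unit_pairs_def)
      thus "row_sign n (fst (- x, - y)) * row_sign n (snd (- x, - y)) = row_sign n (fst (x, y)) * row_sign n (snd (x, y))"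
        using nzrows_uminus[OF unit_pairs_nzrows[OF p]] nzrows_uminus[OF unit_pairs_nzrows[of y x]] by simp
    qed
    finally have "twist R * twist R' = ?c" .
    hence "?c * twist R = twist R * twist R * twist R'" by (simp add: mult.commute mult.left_commute)
    also have "twist R * twist R = 1" using twist_pm[of R] by auto
    finally show ?thesis by simp
  qed
  moreover have "?c = 1 \<or> ?c = -1"
    by (rule prod_pm_one) (use row_sign_pm in \<open>metis mult_1 mult_minus1 minus_minus\<close>)
  hence "?c * ?c = 1" by auto
  ultimately show ?thesis by blast
qed

text \<open>The ratio of the two twists compares the signs of \<open>x\<close> and of \<open>x\<close> times the transpose of
  \<open>D\<close>, where \<open>x\<close> is the first coordinate. Each \<open>x\<close> occurs once for every \<open>y\<close> with \<open>dot x y = 1\<close>,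
  an odd number of times, so the ratio is the sign of \<open>zolotarev_eq\<close>.\<close>

lemma twist_GLs:
  fixes \<beta> :: "'k \<Rightarrow> complex"
  assumes \<beta>: "\<beta> \<in> mult_characters" "\<forall>x. x \<noteq> 0 \<longrightarrow> \<beta> x ^ 2 = 1" "\<exists>x. x \<noteq> 0 \<and> \<beta> x \<noteq> 1"
    and R: "R \<in> frames" and D: "D \<in> GLs"
  shows "twist (D * R) = \<beta> (det D) * twist R"
proof -
  obtain R' where h: "hyper R' R" using R by (auto simp: frames_def)
  note hD = hyperD[OF h]
  have Dc: "D \<in> carrier_mat n n" using D by (simp add: GLs_def)
  let ?D = "transpose_mat D"
  have tD: "?D \<in> GLs" by (rule GLs_transpose[OF D])
  let ?H = "{x \<in> nzrows. row_sign n x = 1}" and ?Y = "\<lambda>x :: 'k mat. {y \<in> rows_of n. dot x y = 1}"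
  have fin: "finite ?H" by (rule finite_subset[OF _ finite_carrier_mat[of 1 n]]) (auto simp: nzrows_def)
  have finY: "finite (?Y x)" for x by (rule finite_subset[OF _ finite_carrier_mat[of 1 n]]) auto
  have "twist (D * R) * twist R = (\<Prod>v \<in> {v \<in> norm_two_rows. row_sign (2 * n) v = 1}.
      (\<lambda>p. row_sign n (fst p * ?D) * row_sign n (fst p)) (form v R, form v R'))"
    unfolding twist_def prod.distrib[symmetric]
  proof (rule prod.cong)
    fix v assume "v \<in> {v \<in> norm_two_rows. row_sign (2 * n) v = 1}"
    hence v: "v \<in> rows_of (2 * n)" by (simp add: norm_two_rows_def)
    show "row_sign n (form v (D * R)) * row_sign n (form v R)
        = row_sign n (fst (form v R, form v R') * ?D) * row_sign n (fst (form v R, form v R'))"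
      unfolding form_mult_right[OF Dc v hD(2)] by simp
  qed simp
  also have "\<dots> = (\<Prod>p \<in> {p \<in> unit_pairs. row_sign n (fst p) = 1}. row_sign n (fst p * ?D) * row_sign n (fst p))"
  proof (rule twist_reindex[OF h])
    fix x y assume p: "(x, y) \<in> unit_pairs"
    note x = unit_pairs_nzrows[OF p]
    have "x * ?D \<in> nzrows" using GLs_bij_nzrows[OF tD] x by (auto simp: bij_betw_def)
    moreover have "- x * ?D = - (x * ?D)"
      using x Dc by (intro uminus_mult_left_mat) (auto simp: nzrows_def)
    ultimately show "row_sign n (fst (- x, - y) * ?D) * row_sign n (fst (- x, - y))
        = row_sign n (fst (x, y) * ?D) * row_sign n (fst (x, y))"
      using nzrows_uminus[of "x * ?D"] nzrows_uminus[OF x] by simp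
  qed
  also have "{p \<in> unit_pairs. row_sign n (fst p) = 1} = Sigma ?H ?Y"
    using unit_pairs_nzrows by (auto simp: unit_pairs_def nzrows_def)
  also have "(\<Prod>p \<in> Sigma ?H ?Y. row_sign n (fst p * ?D) * row_sign n (fst p))
      = (\<Prod>x \<in> ?H. \<Prod>y \<in> ?Y x. row_sign n (x * ?D) * row_sign n x)"
    using prod.Sigma[OF fin, of ?Y "\<lambda>x y. row_sign n (x * ?D) * row_sign n x"] finY
    by (simp add: split_beta)
  also have "\<dots> = (\<Prod>x \<in> ?H. row_sign n (x * ?D))"
  proof (rule prod.cong)
    fix x assume x: "x \<in> ?H"
    hence odd: "odd (card (?Y x))" using odd_affine_hyperplane by blast
    have "(\<Prod>y \<in> ?Y x. row_sign n (x * ?D) * row_sign n x) = row_sign n (x * ?D) ^ card (?Y x)"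
      using x by simp
    also have "\<dots> = row_sign n (x * ?D)" using row_sign_pm[of n "x * ?D"] odd by auto
    finally show "(\<Prod>y \<in> ?Y x. row_sign n (x * ?D) * row_sign n x) = row_sign n (x * ?D)" .
  qed simp
  also have "\<dots> = \<beta> (det D)"
    using zolotarev_eq[OF \<beta> tD] det_transpose[OF Dc] by (simp add: zolotarev_def)
  finally have e: "twist (D * R) * twist R = \<beta> (det D)" .
  have "\<beta> (det D) * twist R = twist (D * R) * (twist R * twist R)" unfolding e[symmetric] by simp
  also have "twist R * twist R = 1" using twist_pm[of R] by auto
  finally show ?thesis by simp
qed

end

section \<open>Similitudes and the Siegel parabolic\<close>

lemma four_block_inject:
  assumes "A \<in> carrier_mat n n" "B \<in> carrier_mat n n" "C \<in> carrier_mat n n" "D \<in> carrier_mat n n"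
    and "A' \<in> carrier_mat n n" "B' \<in> carrier_mat n n" "C' \<in> carrier_mat n n" "D' \<in> carrier_mat n n"
    and eq: "four_block_mat A B C D = four_block_mat A' B' C' D'"
  shows "A = A' \<and> B = B' \<and> C = C' \<and> D = D'"
proof -
  have e: "four_block_mat A B C D $$ (i, j) = four_block_mat A' B' C' D' $$ (i, j)" for i j
    by (simp only: eq)
  have "A $$ (i, j) = A' $$ (i, j)" "B $$ (i, j) = B' $$ (i, j)"
    "C $$ (i, j) = C' $$ (i, j)" "D $$ (i, j) = D' $$ (i, j)" if "i < n" "j < n" for i j
    using e[of i j] e[of i "n + j"] e[of "n + i" j] e[of "n + i" "n + j"] that assms(1-8) by auto
  thus ?thesis using assms(1-8) by (auto intro!: eq_matI)
qed

lemma mult_grp_hom: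
  assumes "\<alpha> \<in> mult_characters"
  shows "\<alpha> 1 = 1" "x \<noteq> 0 \<Longrightarrow> y \<noteq> 0 \<Longrightarrow> \<alpha> (x * y) = \<alpha> x * \<alpha> y"
proof -
  have h: "\<alpha> (x * y) = \<alpha> x * \<alpha> y" if "x \<noteq> 0" "y \<noteq> 0" for x y
    using assms that by (auto simp: hom_def mult_grp_def)
  have "\<alpha> 1 \<noteq> 0" using assms by (auto simp: hom_def mult_grp_def Pi_def)
  moreover have "\<alpha> 1 * \<alpha> 1 = \<alpha> 1" using h[of 1 1] by simp
  ultimately show "\<alpha> 1 = 1" by simp
  show "x \<noteq> 0 \<Longrightarrow> y \<noteq> 0 \<Longrightarrow> \<alpha> (x * y) = \<alpha> x * \<alpha> y" by (rule h)
qed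

lemma GL_carrier:
  "A \<in> carrier (GL m) \<longleftrightarrow> A \<in> carrier_mat m m \<and> (\<exists>B \<in> carrier_mat m m. B * A = 1\<^sub>m m \<and> A * B = 1\<^sub>m m)"
  by (auto simp: GL_def units_of_def Units_def ring_mat_def)

lemma GL_inv:
  assumes "A \<in> carrier_mat m m" "B \<in> carrier_mat m m" "A * B = (1\<^sub>m m :: 'a::field mat)"
  shows "A \<in> carrier (GL m)" "inv\<^bsub>GL m\<^esub> A = B"
proof -
  have BA: "B * A = 1\<^sub>m m" by (rule mat_mult_left_right_inverse[OF assms])
  show A: "A \<in> carrier (GL m)" using assms BA by (auto simp: GL_carrier)
  have B: "B \<in> carrier (GL m)" using assms BA by (auto simp: GL_carrier)
  interpret R: ring "ring_mat TYPE('a) m ()" by (rule ring_mat)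
  have "group (GL m :: 'a mat monoid)" unfolding GL_def by (rule R.units_group)
  moreover have "B \<otimes>\<^bsub>GL m\<^esub> A = \<one>\<^bsub>GL m\<^esub>"
    using BA by (simp add: GL_def units_of_def ring_mat_def)
  ultimately show "inv\<^bsub>GL m\<^esub> A = B" using A B by (simp add: group.inv_equality)
qed

lemma GO_mult: "x \<otimes>\<^bsub>GO m\<^esub> y = x * y"
  by (simp add: GO_def GL_def units_of_def ring_mat_def)

lemma GO_one: "\<one>\<^bsub>GO m\<^esub> = 1\<^sub>m (2 * m)"
  by (simp add: GO_def GL_def units_of_def ring_mat_def)

context hyperbolic_space
begin

lemma similitude_transpose:
  assumes g: "g \<in> carrier_mat (2 * n) (2 * n)" and l: "l \<noteq> 0" and s: "g * J * transpose_mat g = l \<cdot>\<^sub>m J"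
  shows "transpose_mat g * J * g = l \<cdot>\<^sub>m J" "g * ((1 / l) \<cdot>\<^sub>m (J * transpose_mat g * J)) = 1\<^sub>m (2 * n)"
proof -
  let ?N = "2 * n" and ?t = "transpose_mat g"
  have t: "?t \<in> carrier_mat ?N ?N" using g by simp
  note JJ = J_carrier
  have X: "J * ?t * J \<in> carrier_mat ?N ?N" using t JJ by (auto intro!: mult_carrier_mat[of _ _ ?N])
  have lJ: "l \<cdot>\<^sub>m J * J = l \<cdot>\<^sub>m 1\<^sub>m ?N" using mult_smult_assoc_mat[OF JJ JJ, of l] J_square by simp
  have "g * ((1 / l) \<cdot>\<^sub>m (J * ?t * J)) = (1 / l) \<cdot>\<^sub>m (g * (J * ?t * J))"
    by (rule mult_smult_distrib[OF g X])
  also have "g * (J * ?t * J) = l \<cdot>\<^sub>m 1\<^sub>m ?N" unfolding assoc4_mat(1)[OF g JJ t JJ] s lJ ..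
  also have "(1 / l) \<cdot>\<^sub>m (l \<cdot>\<^sub>m 1\<^sub>m ?N) = 1\<^sub>m ?N" using l by (intro eq_matI) auto
  finally show inv: "g * ((1 / l) \<cdot>\<^sub>m (J * ?t * J)) = 1\<^sub>m ?N" .
  have "(1 / l) \<cdot>\<^sub>m (J * ?t * J) \<in> carrier_mat ?N ?N" using X by simp
  from mat_mult_left_right_inverse[OF g this inv]
  have "(1 / l) \<cdot>\<^sub>m (J * ?t * J) * g = 1\<^sub>m ?N" .
  hence "(1 / l) \<cdot>\<^sub>m (J * ?t * J * g) = 1\<^sub>m ?N" unfolding mult_smult_assoc_mat[OF X g] .
  hence "l \<cdot>\<^sub>m ((1 / l) \<cdot>\<^sub>m (J * ?t * J * g)) = l \<cdot>\<^sub>m 1\<^sub>m ?N" by simp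
  also have "l \<cdot>\<^sub>m ((1 / l) \<cdot>\<^sub>m (J * ?t * J * g)) = J * ?t * J * g" using l by (intro eq_matI) auto
  finally have e: "J * ?t * J * g = l \<cdot>\<^sub>m 1\<^sub>m ?N" .
  have Y: "?t * J * g \<in> carrier_mat ?N ?N" using t g JJ by (auto intro!: mult_carrier_mat[of _ _ ?N])
  have "J * (?t * J * g) = l \<cdot>\<^sub>m 1\<^sub>m ?N" using e assoc4_mat(1)[OF JJ t JJ g] by simp
  hence "J * (J * (?t * J * g)) = J * (l \<cdot>\<^sub>m 1\<^sub>m ?N)" by simp
  moreover have "J * (J * (?t * J * g)) = J * J * (?t * J * g)" by (rule assoc_mult_mat[symmetric, OF JJ JJ Y])
  moreover have "J * (l \<cdot>\<^sub>m 1\<^sub>m ?N) = l \<cdot>\<^sub>m J" using mult_smult_distrib[OF JJ one_carrier_mat, of l] JJ by simp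
  ultimately have "J * J * (?t * J * g) = l \<cdot>\<^sub>m J" by (simp only:)
  thus "?t * J * g = l \<cdot>\<^sub>m J" unfolding J_square left_mult_one_mat[OF Y] .
qed

text \<open>The defining relation of the group is stated with the transpose on the left; with it on
  the right the relation concerns the rows of \<open>g\<close>.\<close>

lemma GO_iff:
  "g \<in> carrier (GO n) \<longleftrightarrow> g \<in> carrier_mat (2 * n) (2 * n) \<and> (\<exists>l. l \<noteq> 0 \<and> g * J * transpose_mat g = l \<cdot>\<^sub>m J)"
proof
  assume "g \<in> carrier (GO n)"
  then obtain l where l: "g \<in> carrier (GL (2 * n))" "l \<noteq> 0" "transpose_mat g * J * g = l \<cdot>\<^sub>m J"
    by (auto simp: GO_def)
  hence g: "g \<in> carrier_mat (2 * n) (2 * n)" by (simp add: GL_carrier)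
  have "g * J * transpose_mat g = l \<cdot>\<^sub>m J"
    using similitude_transpose(1)[of "transpose_mat g" l] g l by simp
  thus "g \<in> carrier_mat (2 * n) (2 * n) \<and> (\<exists>l. l \<noteq> 0 \<and> g * J * transpose_mat g = l \<cdot>\<^sub>m J)"
    using g l by blast
next
  assume "g \<in> carrier_mat (2 * n) (2 * n) \<and> (\<exists>l. l \<noteq> 0 \<and> g * J * transpose_mat g = l \<cdot>\<^sub>m J)"
  then obtain l where l: "g \<in> carrier_mat (2 * n) (2 * n)" "l \<noteq> 0" "g * J * transpose_mat g = l \<cdot>\<^sub>m J"
    by blast
  have "J * transpose_mat g * J \<in> carrier_mat (2 * n) (2 * n)"
    using l(1) by (auto intro!: mult_carrier_mat[of _ _ "2 * n"])
  hence X: "(1 / l) \<cdot>\<^sub>m (J * transpose_mat g * J) \<in> carrier_mat (2 * n) (2 * n)" by simp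
  have "g \<in> carrier (GL (2 * n))" by (rule GL_inv(1)[OF l(1) X similitude_transpose(2)[OF l]])
  thus "g \<in> carrier (GO n)" using similitude_transpose(1)[OF l] l(2) by (auto simp: GO_def)
qed

lemma smult_J_inject: "a \<cdot>\<^sub>m J = b \<cdot>\<^sub>m J \<Longrightarrow> a = b"
proof -
  assume e: "a \<cdot>\<^sub>m J = b \<cdot>\<^sub>m J"
  have i: "0 < 2 * n" "n < 2 * n" using n_pos by auto
  have "J $$ (0, n) = 1" unfolding J_entry[OF i] by simp
  moreover have "(a \<cdot>\<^sub>m J) $$ (0, n) = (b \<cdot>\<^sub>m J) $$ (0, n)" by (simp only: e)
  ultimately show "a = b" using i carrier_matD[OF J_carrier] by simp
qed

text \<open>Scaling the upper rows of an isometry gives multiplier \<open>l\<close> without touching the frame of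
  lower rows.\<close>

definition simil :: "'k \<Rightarrow> 'k mat \<Rightarrow> 'k mat \<Rightarrow> 'k mat" where
  "simil l T R = (l \<cdot>\<^sub>m T) @\<^sub>r R"

definition multiplier :: "'k mat \<Rightarrow> 'k" where
  "multiplier g = (THE l. g * J * transpose_mat g = l \<cdot>\<^sub>m J)"

definition bottom :: "'k mat \<Rightarrow> 'k mat" where
  "bottom g = mat n (2 * n) (\<lambda>(i, j). g $$ (n + i, j))"

lemma bottom_append_rows:
  assumes "T \<in> carrier_mat n (2 * n)" "R \<in> carrier_mat n (2 * n)"
  shows "bottom (T @\<^sub>r R) = R"
  using assms by (intro eq_matI) (auto simp: bottom_def append_rows_def)

lemma multiplier_eq:
  assumes "g * J * transpose_mat g = l \<cdot>\<^sub>m J" shows "multiplier g = l"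
  unfolding multiplier_def using assms smult_J_inject by (intro the_equality) auto

lemma simil_GO:
  assumes h: "hyper T R" and l: "l \<noteq> 0"
  shows "simil l T R * J * transpose_mat (simil l T R) = l \<cdot>\<^sub>m J" "simil l T R \<in> carrier (GO n)"
    "multiplier (simil l T R) = l" "bottom (simil l T R) = R"
proof -
  note hD = hyperD[OF h]
  have c: "l \<cdot>\<^sub>m T \<in> carrier_mat n (2 * n)" using hD by simp
  have f1: "form (l \<cdot>\<^sub>m T) R = l \<cdot>\<^sub>m 1\<^sub>m n" using form_smult_left[OF hD(1,2)] hD by simp
  have "transpose_mat (l \<cdot>\<^sub>m 1\<^sub>m n) = l \<cdot>\<^sub>m 1\<^sub>m n" by (intro eq_matI) auto
  hence f2: "form R (l \<cdot>\<^sub>m T) = l \<cdot>\<^sub>m 1\<^sub>m n"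
    using form_transpose[OF c hD(2)] unfolding f1 by simp
  have "form (l \<cdot>\<^sub>m T) T = 0\<^sub>m n n" using form_smult_left[OF hD(1,1)] hD(3) by (auto intro!: eq_matI)
  hence "form T (l \<cdot>\<^sub>m T) = 0\<^sub>m n n" using form_transpose[OF c hD(1)] by simp
  hence f3: "form (l \<cdot>\<^sub>m T) (l \<cdot>\<^sub>m T) = 0\<^sub>m n n"
    using form_smult_left[OF hD(1) c, of l] by (auto intro!: eq_matI)
  show s: "simil l T R * J * transpose_mat (simil l T R) = l \<cdot>\<^sub>m J"
    unfolding simil_def form_def[symmetric] form_append_rows[OF c hD(2)] f1 f2 f3 hD(4)
    by (intro eq_matI) (auto simp: J_mat_def)
  show "simil l T R \<in> carrier (GO n)"
    unfolding GO_iff using s l append_rows_square[OF c hD(2)] by (auto simp: simil_def)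
  show "multiplier (simil l T R) = l" by (rule multiplier_eq[OF s])
  show "bottom (simil l T R) = R" unfolding simil_def by (rule bottom_append_rows[OF c hD(2)])
qed

lemma GO_cases:
  assumes "g \<in> carrier (GO n)"
  obtains l T R where "l \<noteq> 0" "hyper T R" "g = simil l T R"
proof -
  obtain l where g: "g \<in> carrier_mat (2 * n) (2 * n)" "l \<noteq> 0" "g * J * transpose_mat g = l \<cdot>\<^sub>m J"
    using assms unfolding GO_iff by blast
  obtain T R where TR: "g = T @\<^sub>r R" "T \<in> carrier_mat n (2 * n)" "R \<in> carrier_mat n (2 * n)"
      "form T T = 0\<^sub>m n n" "form R R = 0\<^sub>m n n" "form T R = l \<cdot>\<^sub>m 1\<^sub>m n"
    by (rule similitude_frames[OF g(1,3)])
  let ?T = "(1 / l) \<cdot>\<^sub>m T"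
  have c: "?T \<in> carrier_mat n (2 * n)" using TR by simp
  have "form ?T R = 1\<^sub>m n" unfolding form_smult_left[OF TR(2,3)] TR(6) using g(2) by (intro eq_matI) auto
  moreover have "form ?T ?T = 0\<^sub>m n n"
  proof -
    have "form ?T T = 0\<^sub>m n n" unfolding form_smult_left[OF TR(2,2)] TR(4) by (intro eq_matI) auto
    hence "form T ?T = 0\<^sub>m n n" using form_transpose[OF c TR(2)] by simp
    thus ?thesis unfolding form_smult_left[OF TR(2) c] by (auto intro!: eq_matI)
  qed
  ultimately have "hyper ?T R" using c TR by (simp add: hyper_def)
  moreover have "l \<cdot>\<^sub>m ?T = T" using g(2) by (intro eq_matI) auto
  ultimately show ?thesis using that[OF g(2)] TR(1) by (simp add: simil_def)
qed

lemma multiplier_GO: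
  assumes "g \<in> carrier (GO n)"
  shows "g * J * transpose_mat g = multiplier g \<cdot>\<^sub>m J" "multiplier g \<noteq> 0"
  using GO_cases[OF assms] simil_GO by metis+

lemma GO_mult_closed:
  assumes g: "g \<in> carrier (GO n)" and h: "h \<in> carrier (GO n)"
  shows "g * h \<in> carrier (GO n)" "multiplier (g * h) = multiplier g * multiplier h"
proof -
  let ?N = "2 * n"
  have c: "g \<in> carrier_mat ?N ?N" "h \<in> carrier_mat ?N ?N" using assms by (auto simp: GO_iff)
  have tc: "transpose_mat g \<in> carrier_mat ?N ?N" "transpose_mat h \<in> carrier_mat ?N ?N" using c by auto
  note JJ = J_carrier
  have X: "J * transpose_mat h \<in> carrier_mat ?N ?N" "h * J \<in> carrier_mat ?N ?N"
    using JJ tc c by (auto intro!: mult_carrier_mat[of _ _ ?N])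
  have "g * h * J * transpose_mat (g * h) = g * h * J * (transpose_mat h * transpose_mat g)"
    by (subst transpose_mult[OF c]) simp
  also have "\<dots> = g * (h * J * transpose_mat h) * transpose_mat g"
    using c tc JJ X by (simp add: assoc_mult_mat[of _ ?N ?N _ ?N _ ?N] mult_carrier_mat[of _ ?N ?N _ ?N])
  also have "h * J * transpose_mat h = multiplier h \<cdot>\<^sub>m J" by (rule multiplier_GO(1)[OF h])
  also have "g * (multiplier h \<cdot>\<^sub>m J) * transpose_mat g = multiplier h \<cdot>\<^sub>m (g * J * transpose_mat g)"
    unfolding mult_smult_distrib[OF c(1) JJ] mult_smult_assoc_mat[OF mult_carrier_mat[OF c(1) JJ] tc(1)] ..
  also have "\<dots> = (multiplier g * multiplier h) \<cdot>\<^sub>m J"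
    unfolding multiplier_GO(1)[OF g] by (intro eq_matI) auto
  finally have s: "g * h * J * transpose_mat (g * h) = (multiplier g * multiplier h) \<cdot>\<^sub>m J" .
  thus "multiplier (g * h) = multiplier g * multiplier h" by (rule multiplier_eq)
  show "g * h \<in> carrier (GO n)"
    unfolding GO_iff using s multiplier_GO(2)[OF g] multiplier_GO(2)[OF h] c
    by (intro conjI exI[of _ "multiplier g * multiplier h"]) auto
qed

lemma triangular_similitude:
  assumes c: "A \<in> carrier_mat n n" "B \<in> carrier_mat n n" "D \<in> carrier_mat n n"
  defines "p \<equiv> four_block_mat A B (0\<^sub>m n n) (D :: 'k mat)"
  shows "p * J * transpose_mat p = l \<cdot>\<^sub>m J \<longleftrightarrow>
    A * transpose_mat D = l \<cdot>\<^sub>m 1\<^sub>m n \<and> B * transpose_mat A + A * transpose_mat B = 0\<^sub>m n n"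
proof -
  have t: "transpose_mat A \<in> carrier_mat n n" "transpose_mat B \<in> carrier_mat n n" "transpose_mat D \<in> carrier_mat n n"
    using c by auto
  have "p * J = four_block_mat (A * 0\<^sub>m n n + B * 1\<^sub>m n) (A * 1\<^sub>m n + B * 0\<^sub>m n n)
      (0\<^sub>m n n * 0\<^sub>m n n + D * 1\<^sub>m n) (0\<^sub>m n n * 1\<^sub>m n + D * 0\<^sub>m n n)"
    unfolding p_def J_mat_def using c by (intro mult_four_block_mat[of _ n n _ n _ n _ _ n _ n]) auto
  also have "\<dots> = four_block_mat B A D (0\<^sub>m n n)" using c by simp
  finally have pJ: "p * J = four_block_mat B A D (0\<^sub>m n n)" .
  have tp: "transpose_mat p = four_block_mat (transpose_mat A) (0\<^sub>m n n) (transpose_mat B) (transpose_mat D)"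
    unfolding p_def using c by (subst transpose_four_block_mat[of _ n n _ n _ n]) auto
  have "p * J * transpose_mat p = four_block_mat (B * transpose_mat A + A * transpose_mat B)
      (B * 0\<^sub>m n n + A * transpose_mat D) (D * transpose_mat A + 0\<^sub>m n n * transpose_mat B)
      (D * 0\<^sub>m n n + 0\<^sub>m n n * transpose_mat D)"
    unfolding pJ tp using c t by (intro mult_four_block_mat[of _ n n _ n _ n _ _ n _ n]) auto
  also have "\<dots> = four_block_mat (B * transpose_mat A + A * transpose_mat B) (A * transpose_mat D)
      (D * transpose_mat A) (0\<^sub>m n n)"
    using c t by simp
  finally have e: "p * J * transpose_mat p = four_block_mat (B * transpose_mat A + A * transpose_mat B) (A * transpose_mat D)
      (D * transpose_mat A) (0\<^sub>m n n)" .
  have DA: "D * transpose_mat A = transpose_mat (A * transpose_mat D)"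
    using transpose_mult[OF c(1) t(3)] by simp
  have lJ: "l \<cdot>\<^sub>m J = four_block_mat (0\<^sub>m n n) (l \<cdot>\<^sub>m 1\<^sub>m n) (l \<cdot>\<^sub>m 1\<^sub>m n) (0\<^sub>m n n)"
    unfolding J_mat_def by (intro eq_matI) auto
  have cs: "B * transpose_mat A + A * transpose_mat B \<in> carrier_mat n n" "A * transpose_mat D \<in> carrier_mat n n"
    "D * transpose_mat A \<in> carrier_mat n n" using c t by auto
  show ?thesis
  proof
    assume "p * J * transpose_mat p = l \<cdot>\<^sub>m J"
    hence "four_block_mat (B * transpose_mat A + A * transpose_mat B) (A * transpose_mat D)
      (D * transpose_mat A) (0\<^sub>m n n) = four_block_mat (0\<^sub>m n n) (l \<cdot>\<^sub>m 1\<^sub>m n) (l \<cdot>\<^sub>m 1\<^sub>m n) (0\<^sub>m n n)"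
      unfolding e lJ .
    from four_block_inject[OF cs zero_carrier_mat _ _ _ _ this]
    show "A * transpose_mat D = l \<cdot>\<^sub>m 1\<^sub>m n \<and> B * transpose_mat A + A * transpose_mat B = 0\<^sub>m n n" by simp
  next
    assume a: "A * transpose_mat D = l \<cdot>\<^sub>m 1\<^sub>m n \<and> B * transpose_mat A + A * transpose_mat B = 0\<^sub>m n n"
    have "D * transpose_mat A = l \<cdot>\<^sub>m 1\<^sub>m n" unfolding DA conjunct1[OF a] by (intro eq_matI) auto
    thus "p * J * transpose_mat p = l \<cdot>\<^sub>m J" unfolding e lJ using a by simp
  qed
qed

lemma parabolic_iff:
  "p \<in> parabolic n \<longleftrightarrow> (\<exists>A B D l. A \<in> carrier_mat n n \<and> B \<in> carrier_mat n n \<and> D \<in> carrier_mat n n \<and> l \<noteq> 0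
     \<and> A * transpose_mat D = l \<cdot>\<^sub>m 1\<^sub>m n \<and> B * transpose_mat A + A * transpose_mat B = 0\<^sub>m n n
     \<and> p = four_block_mat A B (0\<^sub>m n n) (D :: 'k mat))"
proof
  assume "p \<in> parabolic n"
  then obtain A B D where p: "p \<in> carrier (GO n)" "A \<in> carrier_mat n n" "B \<in> carrier_mat n n"
    "D \<in> carrier_mat n n" "p = four_block_mat A B (0\<^sub>m n n) D" by (auto simp: parabolic_def)
  have "p * J * transpose_mat p = multiplier p \<cdot>\<^sub>m J" "multiplier p \<noteq> 0" using multiplier_GO[OF p(1)] by auto
  thus "\<exists>A B D l. A \<in> carrier_mat n n \<and> B \<in> carrier_mat n n \<and> D \<in> carrier_mat n n \<and> l \<noteq> 0
     \<and> A * transpose_mat D = l \<cdot>\<^sub>m 1\<^sub>m n \<and> B * transpose_mat A + A * transpose_mat B = 0\<^sub>m n n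
     \<and> p = four_block_mat A B (0\<^sub>m n n) D"
    unfolding p(5) triangular_similitude[OF p(2-4)] using p(2-4) by blast
next
  assume "\<exists>A B D l. A \<in> carrier_mat n n \<and> B \<in> carrier_mat n n \<and> D \<in> carrier_mat n n \<and> l \<noteq> 0
     \<and> A * transpose_mat D = l \<cdot>\<^sub>m 1\<^sub>m n \<and> B * transpose_mat A + A * transpose_mat B = 0\<^sub>m n n
     \<and> p = four_block_mat A B (0\<^sub>m n n) (D :: 'k mat)"
  then obtain A B D l where p: "A \<in> carrier_mat n n" "B \<in> carrier_mat n n" "D \<in> carrier_mat n n" "l \<noteq> 0"
    "A * transpose_mat D = l \<cdot>\<^sub>m 1\<^sub>m n" "B * transpose_mat A + A * transpose_mat B = 0\<^sub>m n n"
    "p = four_block_mat A B (0\<^sub>m n n) D" by blast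
  have "p \<in> carrier_mat (2 * n) (2 * n)"
    unfolding p(7) using four_block_carrier_mat[OF p(1,3)] by (simp add: mult_2)
  hence "p \<in> carrier (GO n)"
    unfolding GO_iff using triangular_similitude[OF p(1-3), of l] p(4-7) by blast
  thus "p \<in> parabolic n" using p by (auto simp: parabolic_def)
qed

text \<open>Here \<open>D\<close> is \<open>l\<close> times the transposed inverse of \<open>A\<close>, which identifies \<open>sim_m\<close> with the
  multiplier.\<close>

lemma parabolic_invariants:
  assumes c: "A \<in> carrier_mat n n" "B \<in> carrier_mat n n" "D \<in> carrier_mat n n" and l: "l \<noteq> 0"
    and AD: "A * transpose_mat D = l \<cdot>\<^sub>m 1\<^sub>m n" and BA: "B * transpose_mat A + A * transpose_mat B = 0\<^sub>m n n"
  defines "p \<equiv> four_block_mat A B (0\<^sub>m n n) (D :: 'k mat)"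
  shows "sim_m n p = l" "chi_det n p = inverse (det D)" "multiplier p = l" "D \<in> GLs"
    "det A * det D = l ^ n" "p \<in> parabolic n"
    "conj_J n \<chi> p = \<chi> (four_block_mat D (0\<^sub>m n n) (0\<^sub>m n n) A)"
proof -
  have t: "transpose_mat D \<in> carrier_mat n n" using c by simp
  show mp: "multiplier p = l"
    using triangular_similitude[OF c, of l] AD BA by (intro multiplier_eq) (simp add: p_def)
  have "det (A * transpose_mat D) = det A * det D" using det_mult[OF c(1) t] det_transpose[OF c(3)] by simp
  thus dets: "det A * det D = l ^ n" unfolding AD by simp
  thus "D \<in> GLs" using l c by (auto simp: GLs_def)
  show "p \<in> parabolic n" unfolding parabolic_iff p_def using c l AD BA by blast
  obtain A1 B1 C1 D1 where sp: "split_block p n n = (A1, B1, C1, D1)" by (metis prod_cases4)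
  have dim: "dim_row p = n + n" "dim_col p = n + n" using c by (auto simp: p_def)
  note b = split_block[OF sp dim]
  have blocks: "A = A1 \<and> B = B1 \<and> 0\<^sub>m n n = C1 \<and> D = D1"
    using b(5) unfolding p_def by (intro four_block_inject[OF c(1,2) zero_carrier_mat c(3) b(1-4)])
  show "chi_det n p = inverse (det D)" unfolding chi_det_def sp prod.case using blocks by simp
  show "conj_J n \<chi> p = \<chi> (four_block_mat D (0\<^sub>m n n) (0\<^sub>m n n) A)"
    unfolding conj_J_def sp prod.case using blocks by simp
  let ?A = "(1 / l) \<cdot>\<^sub>m A"
  have cA: "?A \<in> carrier_mat n n" using c by simp
  have "?A * transpose_mat D = (1 / l) \<cdot>\<^sub>m (l \<cdot>\<^sub>m 1\<^sub>m n)"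
    unfolding mult_smult_assoc_mat[OF c(1) t] AD ..
  also have "\<dots> = 1\<^sub>m n" using l by (intro eq_matI) auto
  finally have AD1: "?A * transpose_mat D = 1\<^sub>m n" .
  have lA: "l \<cdot>\<^sub>m ?A = A" using l by (intro eq_matI) auto
  show "sim_m n p = l"
    unfolding sim_m_def
  proof (rule the_equality)
    show "l \<noteq> 0 \<and> (\<exists>A B. A \<in> carrier (GL n) \<and> B \<in> carrier_mat n n \<and>
        p = four_block_mat (l \<cdot>\<^sub>m A) B (0\<^sub>m n n) (transpose_mat (inv\<^bsub>GL n\<^esub> A)))"
    proof (intro conjI exI)
      show "?A \<in> carrier (GL n)" by (rule GL_inv(1)[OF cA t AD1])
      show "p = four_block_mat (l \<cdot>\<^sub>m ?A) B (0\<^sub>m n n) (transpose_mat (inv\<^bsub>GL n\<^esub> ?A))"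
        unfolding GL_inv(2)[OF cA t AD1] lA p_def by simp
    qed (fact l, fact c(2))
  next
    fix k assume "k \<noteq> 0 \<and> (\<exists>A B. A \<in> carrier (GL n) \<and> B \<in> carrier_mat n n \<and>
        p = four_block_mat (k \<cdot>\<^sub>m A) B (0\<^sub>m n n) (transpose_mat (inv\<^bsub>GL n\<^esub> A)))"
    then obtain A' B' where A': "A' \<in> carrier (GL n)" "B' \<in> carrier_mat n n"
      "p = four_block_mat (k \<cdot>\<^sub>m A') B' (0\<^sub>m n n) (transpose_mat (inv\<^bsub>GL n\<^esub> A'))" by blast
    obtain E where E: "A' \<in> carrier_mat n n" "E \<in> carrier_mat n n" "A' * E = 1\<^sub>m n"
      using A'(1) by (auto simp: GL_carrier)
    have inv: "inv\<^bsub>GL n\<^esub> A' = E" by (rule GL_inv(2)[OF E])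
    have k: "k \<cdot>\<^sub>m A' \<in> carrier_mat n n" "transpose_mat E \<in> carrier_mat n n" using E by auto
    have "A = k \<cdot>\<^sub>m A' \<and> B = B' \<and> (0\<^sub>m n n :: 'k mat) = 0\<^sub>m n n \<and> D = transpose_mat E"
      using A'(3) unfolding p_def inv
      by (intro four_block_inject[OF c(1,2) zero_carrier_mat c(3) k(1) A'(2) zero_carrier_mat k(2)])
    hence e: "A = k \<cdot>\<^sub>m A'" "transpose_mat D = E" by auto
    have "l \<cdot>\<^sub>m 1\<^sub>m n = k \<cdot>\<^sub>m (1\<^sub>m n :: 'k mat)"
      unfolding AD[symmetric] e(2) unfolding e(1) mult_smult_assoc_mat[OF E(1,2)] E(3) ..
    hence "(l \<cdot>\<^sub>m 1\<^sub>m n) $$ (0, 0) = (k \<cdot>\<^sub>m (1\<^sub>m n :: 'k mat)) $$ (0, 0)" by simp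
    thus "k = l" using n_pos by simp
  qed
qed

end

section \<open>Transport to the induced representation\<close>

text \<open>The character \<open>\<alpha>\<close> is not fixed here, since \<open>conj_J\<close> alters it.\<close>

locale siegel_series = hyperbolic_space n field_type
  for n :: nat and field_type :: "'k::{field,finite} itself" +
  fixes \<beta> :: "'k \<Rightarrow> complex"
  assumes beta_char: "\<beta> \<in> mult_characters"
    and beta_square: "\<forall>x. x \<noteq> 0 \<longrightarrow> \<beta> x ^ 2 = 1"
    and beta_nontrivial: "\<exists>x. x \<noteq> 0 \<and> \<beta> x \<noteq> 1"
begin

lemmas beta_mult = mult_grp_hom(2)[OF beta_char]
lemmas beta_one = mult_grp_hom(1)[OF beta_char]
lemmas twist_beta = twist_GLs[OF beta_char beta_square beta_nontrivial]

lemma beta_self: "x \<noteq> 0 \<Longrightarrow> \<beta> x * \<beta> x = 1"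
  using beta_square by (simp add: power2_eq_square)

lemma beta_inverse:
  assumes x: "x \<noteq> 0" shows "\<beta> (inverse x) = \<beta> x"
proof -
  have "\<beta> x * \<beta> (inverse x) = 1" using beta_mult[of x "inverse x"] x beta_one by simp
  hence "\<beta> x * (\<beta> x * \<beta> (inverse x)) = \<beta> x" by simp
  thus ?thesis using beta_self[OF x] by (simp add: mult.assoc[symmetric])
qed

lemma beta_power: "x \<noteq> 0 \<Longrightarrow> \<beta> (x ^ m) = \<beta> x ^ m"
  by (induction m) (simp_all add: beta_one beta_mult)

definition mult_fun :: "('k \<Rightarrow> complex) \<Rightarrow> bool" where
  "mult_fun a \<longleftrightarrow> a 1 = 1 \<and> (\<forall>x y. x \<noteq> 0 \<longrightarrow> y \<noteq> 0 \<longrightarrow> a (x * y) = a x * a y)"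

definition siegel :: "('k \<Rightarrow> complex) \<Rightarrow> ('k mat \<Rightarrow> complex) \<Rightarrow> bool" where
  "siegel a \<chi> \<longleftrightarrow> (\<forall>p \<in> parabolic n. \<chi> p = a (sim_m n p) * \<beta> (chi_det n p))"

definition dual_char :: "('k \<Rightarrow> complex) \<Rightarrow> 'k \<Rightarrow> complex" where
  "dual_char a x = a x * \<beta> x ^ n"

lemma mult_fun_dual: "mult_fun a \<Longrightarrow> mult_fun (dual_char a)"
  by (simp add: mult_fun_def dual_char_def beta_one beta_mult power_mult_distrib)

lemma parabolic_cases:
  fixes p :: "'k mat"
  assumes "p \<in> parabolic n"
  obtains A B D l where "A \<in> carrier_mat n n" "B \<in> carrier_mat n n" "D \<in> carrier_mat n n" "l \<noteq> 0"
    "A * transpose_mat D = l \<cdot>\<^sub>m 1\<^sub>m n" "B * transpose_mat A + A * transpose_mat B = 0\<^sub>m n n"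
    "p = four_block_mat A B (0\<^sub>m n n) D"
  using assms unfolding parabolic_iff by blast

lemma siegel_value:
  assumes \<chi>: "siegel a \<chi>"
    and c: "A \<in> carrier_mat n n" "B \<in> carrier_mat n n" "D \<in> carrier_mat n n" and l: "l \<noteq> 0"
    and AD: "A * transpose_mat D = l \<cdot>\<^sub>m 1\<^sub>m n" and BA: "B * transpose_mat A + A * transpose_mat B = 0\<^sub>m n n"
  shows "\<chi> (four_block_mat A B (0\<^sub>m n n) D) = a l * \<beta> (det D)"
proof -
  note inv = parabolic_invariants[OF c l AD BA]
  have "det D \<noteq> 0" using inv(4) by (simp add: GLs_def)
  thus ?thesis using \<chi> inv(1,2,6) beta_inverse by (simp add: siegel_def)
qed

text \<open>On the parabolic subgroup \<open>det A * det D = l ^ n\<close>. Exchanging \<open>A\<close> and \<open>D\<close> therefore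
  replaces \<open>\<beta> (det D)\<close> by \<open>\<beta> l ^ n * \<beta> (det D)\<close>, as \<open>\<beta>\<close> is its own inverse.\<close>

lemma siegel_conj:
  assumes \<chi>: "siegel a \<chi>" shows "siegel (dual_char a) (conj_J n \<chi>)"
  unfolding siegel_def
proof
  fix p :: "'k mat" assume "p \<in> parabolic n"
  then obtain A B D l where c: "A \<in> carrier_mat n n" "B \<in> carrier_mat n n" "D \<in> carrier_mat n n" and l: "l \<noteq> 0"
    and AD: "A * transpose_mat D = l \<cdot>\<^sub>m 1\<^sub>m n" and BA: "B * transpose_mat A + A * transpose_mat B = 0\<^sub>m n n"
    and p: "p = four_block_mat A B (0\<^sub>m n n) D" by (rule parabolic_cases)
  note inv = parabolic_invariants[OF c l AD BA, folded p]
  have dD: "det D \<noteq> 0" using inv(4) by (simp add: GLs_def)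
  have dA: "det A \<noteq> 0" using inv(5) l by auto
  have "D * transpose_mat A = transpose_mat (A * transpose_mat D)"
    using transpose_mult[of A n n "transpose_mat D" n] c by simp
  also have "\<dots> = l \<cdot>\<^sub>m 1\<^sub>m n" unfolding AD by (intro eq_matI) auto
  finally have DA: "D * transpose_mat A = l \<cdot>\<^sub>m 1\<^sub>m n" .
  have "0\<^sub>m n n * transpose_mat D + D * transpose_mat (0\<^sub>m n n) = 0\<^sub>m n n" using c by simp
  hence "conj_J n \<chi> p = a l * \<beta> (det A)"
    unfolding inv(7) by (intro siegel_value[OF \<chi> c(3) zero_carrier_mat c(1) l DA])
  also have "\<beta> (det A) = \<beta> (det A) * (\<beta> (det D) * \<beta> (det D))" using beta_self[OF dD] by simp
  also have "\<dots> = \<beta> l ^ n * \<beta> (det D)"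
    using beta_mult[OF dA dD] inv(5) beta_power[OF l, of n] by (simp add: mult.assoc)
  finally show "conj_J n \<chi> p = dual_char a (sim_m n p) * \<beta> (chi_det n p)"
    unfolding inv(1,2) beta_inverse[OF dD] dual_char_def by (simp only: mult.assoc)
qed

text \<open>The factor \<open>twist\<close> absorbs the character \<open>\<beta>\<close>, so that invariant functions \<open>h\<close> correspond
  to elements of the induced representation.\<close>

definition Phi :: "('k \<Rightarrow> complex) \<Rightarrow> ('k mat \<Rightarrow> complex) \<Rightarrow> 'k mat \<Rightarrow> complex" where
  "Phi a h = (\<lambda>g. if g \<in> carrier (GO n) then a (multiplier g) * twist (bottom g) * h (bottom g) else 0)"

lemma Phi_simil:
  assumes "hyper T R" "l \<noteq> 0"
  shows "Phi a h (simil l T R) = a l * twist R * h R"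
  using simil_GO[OF assms] by (simp add: Phi_def)

lemma Phi_add: "Phi a (f + g) = Phi a f + Phi a g"
  by (simp add: Phi_def fun_eq_iff algebra_simps)

lemma Phi_scale: "Phi a (fun_scale c f) = fun_scale c (Phi a f)"
  by (simp add: Phi_def fun_scale_def fun_eq_iff)

lemma triangular_mult_simil:
  assumes c: "A \<in> carrier_mat n n" "B \<in> carrier_mat n n" "D \<in> carrier_mat n n" and h: "hyper T R"
  shows "four_block_mat A B (0\<^sub>m n n) D * simil l T R = (A * (l \<cdot>\<^sub>m T) + B * R) @\<^sub>r (D * R)"
proof -
  note hD = hyperD[OF h]
  have lT: "l \<cdot>\<^sub>m T \<in> carrier_mat n (2 * n)" using hD by simp
  have DR: "D * R \<in> carrier_mat n (2 * n)" using c hD by auto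
  have "four_block_mat A B (0\<^sub>m n n) D * simil l T R = (A * (l \<cdot>\<^sub>m T) + B * R) @\<^sub>r (0\<^sub>m n n * (l \<cdot>\<^sub>m T) + D * R)"
    unfolding simil_def by (rule four_block_mult_append_rows[OF c(1,2) zero_carrier_mat c(3) lT hD(2)])
  also have "0\<^sub>m n n * (l \<cdot>\<^sub>m T) + D * R = D * R"
    unfolding left_mult_zero_mat[OF lT] by (rule left_add_zero_mat[OF DR])
  finally show ?thesis .
qed

lemma Phi_Ind:
  assumes \<chi>: "siegel a \<chi>" and a: "mult_fun a" and h: "h \<in> invariants"
  shows "Phi a h \<in> Ind n \<chi>"
proof -
  have "Phi a h (p * g) = \<chi> p * Phi a h g" if p: "p \<in> parabolic n" and g: "g \<in> carrier (GO n)" for p g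
  proof -
    obtain A B D l where c: "A \<in> carrier_mat n n" "B \<in> carrier_mat n n" "D \<in> carrier_mat n n" and l: "l \<noteq> 0"
      and AD: "A * transpose_mat D = l \<cdot>\<^sub>m 1\<^sub>m n" and BA: "B * transpose_mat A + A * transpose_mat B = 0\<^sub>m n n"
      and p': "p = four_block_mat A B (0\<^sub>m n n) D" using p by (rule parabolic_cases)
    obtain k T R where k: "k \<noteq> 0" and hyp: "hyper T R" and g': "g = simil k T R" using g by (rule GO_cases)
    note hD = hyperD[OF hyp]
    have R: "R \<in> frames" using hyp by (auto simp: frames_def)
    note inv = parabolic_invariants[OF c l AD BA, folded p']
    have pG: "p \<in> carrier (GO n)" using p by (simp add: parabolic_def)
    have pg: "p * g = (A * (k \<cdot>\<^sub>m T) + B * R) @\<^sub>r (D * R)"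
      unfolding p' g' by (rule triangular_mult_simil[OF c hyp])
    have cs: "A * (k \<cdot>\<^sub>m T) + B * R \<in> carrier_mat n (2 * n)" "D * R \<in> carrier_mat n (2 * n)"
      using c hD by auto
    have bot: "bottom (p * g) = D * R" unfolding pg by (rule bottom_append_rows[OF cs])
    have mul: "multiplier (p * g) = l * k"
      using GO_mult_closed(2)[OF pG g] inv(3) simil_GO(3)[OF hyp k] by (simp add: g')
    have "Phi a h (p * g) = a (l * k) * twist (D * R) * h (D * R)"
      using GO_mult_closed(1)[OF pG g] by (simp add: Phi_def bot mul)
    also have "h (D * R) = h R" using h R inv(4) by (simp add: invariants_def)
    also have "twist (D * R) = \<beta> (det D) * twist R" by (rule twist_beta[OF R inv(4)])
    also have "a (l * k) = a l * a k" using a l k by (simp add: mult_fun_def)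
    finally show ?thesis
      unfolding g' Phi_simil[OF hyp k] p' siegel_value[OF \<chi> c l AD BA] by (simp only: mult_ac)
  qed
  thus ?thesis by (simp add: Ind_def Phi_def)
qed

text \<open>Similitudes with the same frame of lower rows differ by an element of the parabolic
  subgroup with \<open>D = 1\<close>, on which the character has the value \<open>a l\<close>.\<close>

lemma Ind_value:
  assumes \<chi>: "siegel a \<chi>" and f: "f \<in> Ind n \<chi>" and h: "hyper T R" "hyper T' R" and l: "l \<noteq> 0"
  shows "f (simil l T' R) = a l * f (simil 1 T R)"
proof -
  note hD = hyperD[OF h(1)]
  have T': "T' \<in> frames" using hyper_sym[OF h(2)] by (auto simp: frames_def)
  obtain X where X: "X \<in> skew n" "T' = T + X * R"
    by (rule opposite_shift[OF h(1) T' hyperD(5)[OF h(2)]])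
  have Xc: "X \<in> carrier_mat n n" "transpose_mat X = - X" using X by (auto simp: skew_def)
  let ?A = "l \<cdot>\<^sub>m 1\<^sub>m n :: 'k mat" and ?B = "l \<cdot>\<^sub>m X"
  have c: "?A \<in> carrier_mat n n" "?B \<in> carrier_mat n n" "(1\<^sub>m n :: 'k mat) \<in> carrier_mat n n" using Xc by auto
  have AD: "?A * transpose_mat (1\<^sub>m n) = l \<cdot>\<^sub>m 1\<^sub>m n" by simp
  have tA: "transpose_mat ?A = ?A" by (intro eq_matI) auto
  have XX: "X $$ (i, j) + X $$ (j, i) = 0" if "i < n" "j < n" for i j using X(1) that by (simp add: skew_iff)
  have BA: "?B * transpose_mat ?A + ?A * transpose_mat ?B = 0\<^sub>m n n"
  proof -
    have "?B * ?A = l \<cdot>\<^sub>m ?B" using mult_smult_distrib[OF c(2,3), of l] Xc by simp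
    moreover have "?A * transpose_mat ?B = l \<cdot>\<^sub>m transpose_mat ?B"
      using mult_smult_assoc_mat[OF c(3), of "transpose_mat ?B" n l] Xc by simp
    ultimately have e: "?B * transpose_mat ?A + ?A * transpose_mat ?B = l \<cdot>\<^sub>m ?B + l \<cdot>\<^sub>m transpose_mat ?B"
      unfolding tA by simp
    have "l * (l * X $$ (i, j)) + l * (l * X $$ (j, i)) = 0" if "i < n" "j < n" for i j
      unfolding distrib_left[symmetric] XX[OF that] by simp
    thus ?thesis unfolding e using Xc(1) by (intro eq_matI) auto
  qed
  let ?p = "four_block_mat ?A ?B (0\<^sub>m n n) (1\<^sub>m n :: 'k mat)"
  have p: "?p \<in> parabolic n" by (rule parabolic_invariants(6)[OF c l AD BA])
  have "?p * simil 1 T R = (?A * (1 \<cdot>\<^sub>m T) + ?B * R) @\<^sub>r (1\<^sub>m n * R)"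
    by (rule triangular_mult_simil[OF c h(1)])
  also have "1 \<cdot>\<^sub>m T = T" by (intro eq_matI) auto
  also have "?A * T = l \<cdot>\<^sub>m T" using mult_smult_assoc_mat[OF c(3) hD(1), of l] hD by simp
  also have "?B * R = l \<cdot>\<^sub>m (X * R)" by (rule mult_smult_assoc_mat[OF Xc(1) hD(2)])
  also have "l \<cdot>\<^sub>m T + l \<cdot>\<^sub>m (X * R) = l \<cdot>\<^sub>m (T + X * R)"
    using hD Xc by (intro add_smult_distrib_left_mat[symmetric, of _ n "2 * n"]) auto
  also have "1\<^sub>m n * R = R" using hD by simp
  finally have "?p * simil 1 T R = simil l T' R" by (simp add: simil_def X(2))
  hence "f (simil l T' R) = f (?p * simil 1 T R)" by simp
  also have "\<dots> = \<chi> ?p * f (simil 1 T R)"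
    using f p simil_GO(2)[OF h(1) one_neq_zero] by (simp add: Ind_def)
  also have "\<chi> ?p = a l" unfolding siegel_value[OF \<chi> c l AD BA] by (simp add: beta_one)
  finally show ?thesis .
qed

lemma Ind_GLs:
  assumes \<chi>: "siegel a \<chi>" and a: "mult_fun a" and f: "f \<in> Ind n \<chi>"
    and h: "hyper T R" "hyper T' (D * R)" and D: "D \<in> GLs"
  shows "f (simil 1 T' (D * R)) = \<beta> (det D) * f (simil 1 T R)"
proof -
  note hD = hyperD[OF h(1)]
  have a1: "a 1 = 1" using a by (simp add: mult_fun_def)
  obtain D' where D': "D' \<in> GLs" "D * D' = 1\<^sub>m n" "D' * D = 1\<^sub>m n" using GLs_inverse[OF D] by metis
  let ?E = "transpose_mat D'"
  have c: "?E \<in> carrier_mat n n" "(0\<^sub>m n n :: 'k mat) \<in> carrier_mat n n" "D \<in> carrier_mat n n" "D' \<in> carrier_mat n n"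
    using D D' by (auto simp: GLs_def)
  have "?E * transpose_mat D = transpose_mat (D * D')"
    using transpose_mult[OF c(3,4)] by simp
  hence AD: "?E * transpose_mat D = 1 \<cdot>\<^sub>m 1\<^sub>m n" unfolding D'(2) by (auto intro!: eq_matI)
  have BA: "0\<^sub>m n n * transpose_mat ?E + ?E * transpose_mat (0\<^sub>m n n) = 0\<^sub>m n n" using c by simp
  let ?p = "four_block_mat ?E (0\<^sub>m n n) (0\<^sub>m n n) D"
  have p: "?p \<in> parabolic n" by (rule parabolic_invariants(6)[OF c(1-3) one_neq_zero AD BA])
  have ET: "?E * T \<in> carrier_mat n (2 * n)" using c hD by auto
  have h'': "hyper (?E * T) (D * R)"
    using c D'(3) by (intro hyper_GLs[OF h(1)]) auto
  have "?p * simil 1 T R = (?E * (1 \<cdot>\<^sub>m T) + 0\<^sub>m n n * R) @\<^sub>r (D * R)"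
    by (rule triangular_mult_simil[OF c(1-3) h(1)])
  also have "1 \<cdot>\<^sub>m T = T" by (intro eq_matI) auto
  also have "?E * T + 0\<^sub>m n n * R = ?E * T"
    unfolding left_mult_zero_mat[OF hD(2)] by (rule right_add_zero_mat[OF ET])
  also have "(?E * T) @\<^sub>r (D * R) = simil 1 (?E * T) (D * R)"
  proof -
    have "1 \<cdot>\<^sub>m (?E * T) = ?E * T" by (intro eq_matI) auto
    thus ?thesis by (simp add: simil_def)
  qed
  finally have pg: "?p * simil 1 T R = simil 1 (?E * T) (D * R)" .
  have "f (simil 1 T' (D * R)) = f (simil 1 (?E * T) (D * R))"
    using Ind_value[OF \<chi> f h'' h(2) one_neq_zero] a1 by simp
  also have "\<dots> = \<chi> ?p * f (simil 1 T R)"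
    unfolding pg[symmetric] using f p simil_GO(2)[OF h(1) one_neq_zero] by (simp add: Ind_def)
  also have "\<chi> ?p = \<beta> (det D)" unfolding siegel_value[OF \<chi> c(1-3) one_neq_zero AD BA] a1 by simp
  finally show ?thesis .
qed

text \<open>Evaluating \<open>f\<close> at an isometry above the frame \<open>R\<close> and multiplying by \<open>twist R\<close> inverts
  \<open>Phi\<close>.\<close>

lemma Ind_eq_Phi:
  assumes \<chi>: "siegel a \<chi>" and a: "mult_fun a"
  shows "Ind n \<chi> = Phi a ` invariants"
proof
  show "Phi a ` invariants \<subseteq> Ind n \<chi>" using Phi_Ind[OF \<chi> a] by blast
  show "Ind n \<chi> \<subseteq> Phi a ` invariants"
  proof
    fix f assume f: "f \<in> Ind n \<chi>"
    define dual where "dual R = (SOME T. hyper T R)" for R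
    have dual: "hyper (dual R) R" if "R \<in> frames" for R
      using that someI_ex[of "\<lambda>T. hyper T R"] by (simp add: dual_def frames_def)
    define h where "h R = (if R \<in> frames then twist R * f (simil 1 (dual R) R) else 0)" for R
    have "h (D * R) = h R" if R: "R \<in> frames" and D: "D \<in> GLs" for R D
    proof -
      have DR: "D * R \<in> frames" by (rule GLs_frames[OF D R])
      have dD: "det D \<noteq> 0" using D by (simp add: GLs_def)
      have "h (D * R) = (\<beta> (det D) * twist R) * (\<beta> (det D) * f (simil 1 (dual R) R))"
        using DR twist_beta[OF R D] Ind_GLs[OF \<chi> a f dual[OF R] dual[OF DR] D] by (simp add: h_def)
      also have "\<dots> = \<beta> (det D) * \<beta> (det D) * h R" using R by (simp add: h_def)
      finally show ?thesis using beta_self[OF dD] by simp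
    qed
    hence "h \<in> invariants" by (simp add: invariants_def h_def)
    moreover have "f = Phi a h"
    proof
      fix g show "f g = Phi a h g"
      proof (cases "g \<in> carrier (GO n)")
        case False thus ?thesis using f by (simp add: Ind_def Phi_def)
      next
        case True
        then obtain l T R where l: "l \<noteq> 0" and hyp: "hyper T R" and g: "g = simil l T R" by (rule GO_cases)
        have R: "R \<in> frames" using hyp by (auto simp: frames_def)
        have "Phi a h g = a l * twist R * (twist R * f (simil 1 (dual R) R))"
          unfolding g Phi_simil[OF hyp l] using R by (simp add: h_def)
        also have "\<dots> = a l * (twist R * twist R) * f (simil 1 (dual R) R)" by (simp only: mult.assoc)
        also have "twist R * twist R = 1" using twist_pm[of R] by auto
        finally show ?thesis unfolding g Ind_value[OF \<chi> f dual[OF R] hyp l] by simp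
      qed
    qed
    ultimately show "f \<in> Phi a ` invariants" by blast
  qed
qed

lemma Phi_inject:
  assumes a: "mult_fun a" and h: "h \<in> invariants" and z: "Phi a h = 0"
  shows "h = 0"
proof
  fix R
  show "h R = 0 R"
  proof (cases "R \<in> frames")
    case True
    then obtain T where hyp: "hyper T R" by (auto simp: frames_def)
    have "a 1 * twist R * h R = 0" using Phi_simil[OF hyp one_neq_zero, of a h] z by simp
    moreover have "a 1 = 1" using a by (simp add: mult_fun_def)
    moreover have "twist R \<noteq> 0" using twist_pm[of R] by auto
    ultimately show ?thesis by simp
  qed (use h in \<open>simp add: invariants_def\<close>)
qed

lemma unip_radical_param:
  "bij_betw (\<lambda>X. four_block_mat (1\<^sub>m n) X (0\<^sub>m n n) (1\<^sub>m n)) (skew n) (unip_radical n :: 'k mat set)"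
  unfolding bij_betw_def
proof
  let ?u = "\<lambda>X. four_block_mat (1\<^sub>m n) X (0\<^sub>m n n) (1\<^sub>m n) :: 'k mat"
  have one: "(1\<^sub>m n :: 'k mat) \<in> carrier_mat n n" by simp
  have sk: "X * transpose_mat (1\<^sub>m n) + 1\<^sub>m n * transpose_mat X = 0\<^sub>m n n \<longleftrightarrow> X \<in> skew n"
    if X: "X \<in> carrier_mat n n" for X :: "'k mat"
  proof -
    have "X * transpose_mat (1\<^sub>m n) + 1\<^sub>m n * transpose_mat X = transpose_mat X + X"
      using X comm_add_mat[of X n n "transpose_mat X"] by simp
    thus ?thesis using add_eq_zero_mat_iff[of "transpose_mat X" n n X] X by (simp add: skew_def)
  qed
  show "inj_on ?u (skew n)"
  proof (rule inj_onI)
    fix X Y :: "'k mat" assume XY: "X \<in> skew n" "Y \<in> skew n" "?u X = ?u Y"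
    have "X \<in> carrier_mat n n" "Y \<in> carrier_mat n n" using XY by (auto simp: skew_def)
    from four_block_inject[OF one this(1) zero_carrier_mat one one this(2) zero_carrier_mat one XY(3)]
    show "X = Y" by blast
  qed
  show "?u ` skew n = unip_radical n"
  proof (intro equalityI subsetI)
    fix u assume "u \<in> ?u ` skew n"
    then obtain X where X: "X \<in> skew n" "u = ?u X" by blast
    have Xc: "X \<in> carrier_mat n n" using X by (simp add: skew_def)
    have o: "1\<^sub>m n * transpose_mat (1\<^sub>m n) = 1 \<cdot>\<^sub>m (1\<^sub>m n :: 'k mat)" by (auto intro!: eq_matI)
    have "u \<in> parabolic n"
      unfolding X(2) by (rule parabolic_invariants(6)[OF one Xc one one_neq_zero o iffD2[OF sk[OF Xc] X(1)]])
    thus "u \<in> unip_radical n" using X Xc by (auto simp: unip_radical_def parabolic_def)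
  next
    fix u :: "'k mat" assume "u \<in> unip_radical n"
    then obtain X where X: "u \<in> carrier (GO n)" "X \<in> carrier_mat n n" "u = ?u X"
      by (auto simp: unip_radical_def)
    have "X * transpose_mat (1\<^sub>m n) + 1\<^sub>m n * transpose_mat X = 0\<^sub>m n n"
      using multiplier_GO(1)[OF X(1)] unfolding X(3) triangular_similitude[OF one X(2) one] by blast
    thus "u \<in> ?u ` skew n" using sk[OF X(2)] X(3) by blast
  qed
qed

lemma inv_J: "inv\<^bsub>GO n\<^esub> J = J"
proof -
  have J: "J \<in> carrier (GO n)"
  proof -
    have "J * J * transpose_mat J = J"
      unfolding J_transpose J_square by (rule left_mult_one_mat[OF J_carrier])
    also have "\<dots> = 1 \<cdot>\<^sub>m J" by (rule eq_matI) auto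
    finally have "J * J * transpose_mat J = 1 \<cdot>\<^sub>m J" .
    hence "\<exists>l. l \<noteq> 0 \<and> J * J * transpose_mat J = l \<cdot>\<^sub>m J" by (intro exI[of _ 1] conjI) simp_all
    thus ?thesis unfolding GO_iff using J_carrier by blast
  qed
  show ?thesis
    unfolding m_inv_def GO_mult GO_one
  proof (rule the_equality)
    show "J \<in> carrier (GO n) \<and> J * J = 1\<^sub>m (2 * n) \<and> J * J = 1\<^sub>m (2 * n)" using J J_square by blast
  next
    fix y assume y: "y \<in> carrier (GO n) \<and> J * y = 1\<^sub>m (2 * n) \<and> y * J = 1\<^sub>m (2 * n)"
    hence yc: "y \<in> carrier_mat (2 * n) (2 * n)" by (simp add: GO_iff)
    have "y = J * J * y" unfolding J_square left_mult_one_mat[OF yc] ..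
    also have "\<dots> = J * (J * y)" by (rule assoc_mult_mat[OF J_carrier J_carrier yc])
    also have "\<dots> = J" using y carrier_matD[OF J_carrier] by simp
    finally show "y = J" .
  qed
qed

lemma skew_smult:
  assumes X: "X \<in> skew n" shows "(k :: 'k) \<cdot>\<^sub>m X \<in> skew n"
proof -
  have Xc: "X \<in> carrier_mat n n" using X by (simp add: skew_def)
  have "k * X $$ (i, j) + k * X $$ (j, i) = 0" if "i < n" "j < n" for i j
  proof -
    have "k * X $$ (i, j) + k * X $$ (j, i) = k * (X $$ (i, j) + X $$ (j, i))"
      by (rule distrib_left[symmetric])
    also have "X $$ (i, j) + X $$ (j, i) = 0" using X that unfolding skew_iff by blast
    finally show ?thesis by simp
  qed
  thus ?thesis unfolding skew_iff using Xc by simp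
qed

text \<open>Translation by an element of the unipotent radical adds \<open>X * R\<close> to the upper rows, and
  \<open>J\<close> interchanges upper and lower rows. Restoring the normal form moves the multiplier \<open>l\<close> from
  the upper to the lower rows.\<close>

lemma translate_simil:
  assumes h: "hyper T R" and l: "l \<noteq> 0" and X: "X \<in> skew n"
  defines "Y \<equiv> (1 / l) \<cdot>\<^sub>m X"
  shows "J * four_block_mat (1\<^sub>m n) X (0\<^sub>m n n) (1\<^sub>m n) * simil l T R
      = simil l ((1 / l) \<cdot>\<^sub>m R) (l \<cdot>\<^sub>m 1\<^sub>m n * (T + Y * R))"
    and "hyper ((1 / l) \<cdot>\<^sub>m R) (l \<cdot>\<^sub>m 1\<^sub>m n * (T + Y * R))"
proof -
  note hD = hyperD[OF h]
  have Xc: "X \<in> carrier_mat n n" using X by (simp add: skew_def)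
  have Yc: "Y \<in> carrier_mat n n" using Xc by (simp add: Y_def)
  have Ys: "Y \<in> skew n" unfolding Y_def by (rule skew_smult[OF X])
  note h' = hyper_sym[OF hyper_shift[OF h Ys]]
  have one: "(1\<^sub>m n :: 'k mat) \<in> carrier_mat n n" by simp
  let ?u = "four_block_mat (1\<^sub>m n) X (0\<^sub>m n n) (1\<^sub>m n)"
  have lT: "l \<cdot>\<^sub>m T \<in> carrier_mat n (2 * n)" and XR: "X * R \<in> carrier_mat n (2 * n)"
    and YR: "Y * R \<in> carrier_mat n (2 * n)" using hD Xc Yc by auto
  have u: "?u \<in> carrier_mat (2 * n) (2 * n)"
    using four_block_carrier_mat[OF one one] by (simp add: mult_2)
  have s: "simil l T R \<in> carrier_mat (2 * n) (2 * n)"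
    unfolding simil_def by (rule append_rows_square[OF lT hD(2)])
  have lY: "l \<cdot>\<^sub>m Y = X" using l by (auto simp: Y_def intro!: eq_matI)
  have bot: "l \<cdot>\<^sub>m 1\<^sub>m n * (T + Y * R) = l \<cdot>\<^sub>m T + X * R"
  proof -
    have TY: "T + Y * R \<in> carrier_mat n (2 * n)" using YR by simp
    have "l \<cdot>\<^sub>m 1\<^sub>m n * (T + Y * R) = l \<cdot>\<^sub>m (T + Y * R)"
      unfolding mult_smult_assoc_mat[OF one TY] left_mult_one_mat[OF TY] ..
    also have "\<dots> = l \<cdot>\<^sub>m T + l \<cdot>\<^sub>m (Y * R)" by (rule add_smult_distrib_left_mat[OF hD(1) YR])
    also have "l \<cdot>\<^sub>m (Y * R) = l \<cdot>\<^sub>m Y * R" by (rule mult_smult_assoc_mat[symmetric, OF Yc hD(2)])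
    finally show ?thesis unfolding lY .
  qed
  have "?u * simil l T R = (1\<^sub>m n * (l \<cdot>\<^sub>m T) + X * R) @\<^sub>r (1\<^sub>m n * R)"
    by (rule triangular_mult_simil[OF one Xc one h])
  also have "\<dots> = (l \<cdot>\<^sub>m T + X * R) @\<^sub>r R" using hD lT by simp
  finally have us: "?u * simil l T R = (l \<cdot>\<^sub>m T + X * R) @\<^sub>r R" .
  have lR: "l \<cdot>\<^sub>m ((1 / l) \<cdot>\<^sub>m R) = R" using l by (intro eq_matI) auto
  have "J * ?u * simil l T R = J * (?u * simil l T R)" by (rule assoc_mult_mat[OF J_carrier u s])
  also have "\<dots> = R @\<^sub>r (l \<cdot>\<^sub>m T + X * R)"
    unfolding us using lT XR hD by (intro J_mult_append_rows[of _ "2 * n"]) auto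
  finally show "J * ?u * simil l T R = simil l ((1 / l) \<cdot>\<^sub>m R) (l \<cdot>\<^sub>m 1\<^sub>m n * (T + Y * R))"
    unfolding simil_def bot lR .
  have "hyper ((1 / l) \<cdot>\<^sub>m 1\<^sub>m n * R) (l \<cdot>\<^sub>m 1\<^sub>m n * (T + Y * R))"
  proof (rule hyper_GLs[OF h'])
    have "transpose_mat ((1 / l) \<cdot>\<^sub>m 1\<^sub>m n) = (1 / l) \<cdot>\<^sub>m (1\<^sub>m n :: 'k mat)" by (intro eq_matI) auto
    thus "transpose_mat ((1 / l) \<cdot>\<^sub>m 1\<^sub>m n) * (l \<cdot>\<^sub>m 1\<^sub>m n) = (1\<^sub>m n :: 'k mat)"
      using l mult_smult_assoc_mat[OF one, of "l \<cdot>\<^sub>m 1\<^sub>m n" n "1 / l"] by (auto intro!: eq_matI)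
  qed auto
  also have "(1 / l) \<cdot>\<^sub>m 1\<^sub>m n * R = (1 / l) \<cdot>\<^sub>m R"
    unfolding mult_smult_assoc_mat[OF one hD(2)] left_mult_one_mat[OF hD(2)] ..
  finally show "hyper ((1 / l) \<cdot>\<^sub>m R) (l \<cdot>\<^sub>m 1\<^sub>m n * (T + Y * R))" .
qed

lemma skew_smult_bij:
  assumes l: "(l :: 'k) \<noteq> 0" shows "bij_betw (\<lambda>X. (1 / l) \<cdot>\<^sub>m X) (skew n) (skew n)"
  using l skew_smult by (intro bij_betw_byWitness[where f' = "\<lambda>X. l \<cdot>\<^sub>m X"]) (auto intro!: eq_matI)

text \<open>The sum over the unipotent radical runs over the frames dual to \<open>R\<close>, scaled by \<open>l\<close>. The
  scaling changes the twist by \<open>\<beta> (l ^ n)\<close>, which is how \<open>dual_char\<close> arises; duality changes it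
  by \<open>c\<close>.\<close>

lemma intertwiner_Phi:
  assumes \<chi>: "siegel a \<chi>" and a: "mult_fun a" and h: "h \<in> invariants"
    and c: "\<forall>R R'. hyper R' R \<longrightarrow> twist R' = c * twist R"
  shows "intertwiner n \<chi> (Phi a h) = Phi (dual_char a) (fun_scale c (opp h))"
proof
  fix g
  have I: "intertwiner n \<chi> (Phi a h) g = (if g \<in> carrier (GO n)
     then \<Sum>u \<in> unip_radical n. Phi a h (J * u * g) else 0)"
    using Phi_Ind[OF \<chi> a h] by (simp add: intertwiner_def inv_J)
  show "intertwiner n \<chi> (Phi a h) g = Phi (dual_char a) (fun_scale c (opp h)) g"
  proof (cases "g \<in> carrier (GO n)")
    case False thus ?thesis unfolding I by (simp add: Phi_def)
  next
    case True
    then obtain l T R where l: "l \<noteq> 0" and hyp: "hyper T R" and g: "g = simil l T R" by (rule GO_cases)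
    have R: "R \<in> frames" using hyp by (auto simp: frames_def)
    let ?F = "\<lambda>Y. a l * (\<beta> l ^ n * (c * twist R)) * h (T + Y * R)"
    have summand: "Phi a h (J * four_block_mat (1\<^sub>m n) X (0\<^sub>m n n) (1\<^sub>m n) * g) = ?F ((1 / l) \<cdot>\<^sub>m X)"
      if X: "X \<in> skew n" for X
    proof -
      let ?Y = "(1 / l) \<cdot>\<^sub>m X" and ?D = "l \<cdot>\<^sub>m 1\<^sub>m n :: 'k mat"
      note tr = translate_simil[OF hyp l X]
      have Y: "?Y \<in> skew n" using skew_smult_bij[OF l] X by (auto simp: bij_betw_def)
      note h' = hyper_shift[OF hyp Y]
      have fr: "T + ?Y * R \<in> frames" using hyper_sym[OF h'] by (auto simp: frames_def)
      have detD: "det ?D = l ^ n" by simp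
      have D: "?D \<in> GLs" using l by (simp add: GLs_def)
      have "Phi a h (J * four_block_mat (1\<^sub>m n) X (0\<^sub>m n n) (1\<^sub>m n) * g)
          = a l * twist (?D * (T + ?Y * R)) * h (?D * (T + ?Y * R))"
        unfolding g tr(1) by (rule Phi_simil[OF tr(2) l])
      also have "twist (?D * (T + ?Y * R)) = \<beta> l ^ n * twist (T + ?Y * R)"
        unfolding twist_beta[OF fr D] detD beta_power[OF l] ..
      also have "twist (T + ?Y * R) = c * twist R" using c h' by blast
      also have "h (?D * (T + ?Y * R)) = h (T + ?Y * R)" using h fr D by (simp add: invariants_def)
      finally show ?thesis .
    qed
    have "intertwiner n \<chi> (Phi a h) g = (\<Sum>u \<in> unip_radical n. Phi a h (J * u * g))"
      unfolding I using True by simp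
    also have "\<dots> = (\<Sum>X \<in> skew n. Phi a h (J * four_block_mat (1\<^sub>m n) X (0\<^sub>m n n) (1\<^sub>m n) * g))"
      by (rule sum.reindex_bij_betw[OF unip_radical_param, symmetric])
    also have "\<dots> = (\<Sum>X \<in> skew n. ?F ((1 / l) \<cdot>\<^sub>m X))"
      by (rule sum.cong) (simp_all only: summand)
    also have "\<dots> = (\<Sum>Y \<in> skew n. ?F Y)"
      by (rule sum.reindex_bij_betw[OF skew_smult_bij[OF l]])
    also have "\<dots> = a l * (\<beta> l ^ n * (c * twist R)) * (\<Sum>Y \<in> skew n. h (T + Y * R))"
      by (simp only: sum_distrib_left)
    also have "(\<Sum>Y \<in> skew n. h (T + Y * R)) = opp h R"
      using sum.reindex_bij_betw[OF opposite_param[OF hyp], of h] R by (simp add: opp_def)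
    also have "a l * (\<beta> l ^ n * (c * twist R)) * opp h R = Phi (dual_char a) (fun_scale c (opp h)) g"
      unfolding g Phi_simil[OF hyp l] dual_char_def fun_scale_def by (simp only: mult_ac)
    finally show ?thesis .
  qed
qed

text \<open>Applying the previous lemma twice gives the factors \<open>c * c = 1\<close> and
  \<open>\<beta> l ^ n * \<beta> l ^ n = 1\<close>.\<close>

lemma intertwiner_sq_Phi:
  assumes \<chi>: "siegel a \<chi>" and a: "mult_fun a" and h: "h \<in> invariants"
  shows "intertwiner_sq n \<chi> (Phi a h) = Phi a (opp (opp h))"
proof -
  obtain c where c: "c * c = 1" "\<forall>R R'. hyper R' R \<longrightarrow> twist R' = c * twist R"
    using twist_opposite by blast
  let ?h = "fun_scale c (opp h)"
  have oh: "?h \<in> invariants"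
    using h opp_closed fun_space.subspace_scale[OF invariants_subspace] unfolding invariants_eq_Filt by blast
  have "intertwiner_sq n \<chi> (Phi a h) = intertwiner n (conj_J n \<chi>) (intertwiner n \<chi> (Phi a h))"
    using Phi_Ind[OF \<chi> a h] by (simp add: intertwiner_sq_def compose_def)
  also have "\<dots> = Phi (dual_char (dual_char a)) (fun_scale c (opp ?h))"
    unfolding intertwiner_Phi[OF \<chi> a h c(2)]
    by (rule intertwiner_Phi[OF siegel_conj[OF \<chi>] mult_fun_dual[OF a] oh c(2)])
  also have "fun_scale c (opp ?h) = opp (opp h)"
    unfolding opp_scale fun_space.scale_scale c(1) by (rule fun_space.scale_one)
  also have "Phi (dual_char (dual_char a)) (opp (opp h)) = Phi a (opp (opp h))"
  proof
    fix g
    have "dual_char (dual_char a) l = a l" if "l \<noteq> 0" for l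
    proof -
      have "\<beta> l ^ n * \<beta> l ^ n = 1" unfolding power_mult_distrib[symmetric] beta_self[OF that] by simp
      thus ?thesis by (simp add: dual_char_def mult.assoc)
    qed
    thus "Phi (dual_char (dual_char a)) (opp (opp h)) g = Phi a (opp (opp h)) g"
      using multiplier_GO(2)[of g] by (simp add: Phi_def)
  qed
  finally show ?thesis .
qed

lemma intertwiner_sq_spectrum:
  assumes \<chi>: "siegel a \<chi>" and a: "mult_fun a"
  shows "diagonalizable_on (Ind n \<chi>) (intertwiner_sq n \<chi>)"
    and "eigenvalues_on (Ind n \<chi>) (intertwiner_sq n \<chi>) = {of_real (lam k ^ 2) | k. k \<le> n}"
proof -
  let ?T = "intertwiner_sq n \<chi>"
  note T = intertwiner_sq_Phi[OF \<chi> a]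
  note Ind = Ind_eq_Phi[OF \<chi> a]
  have zero: "Phi a 0 = 0" by (simp add: Phi_def fun_eq_iff)
  define E where "E = {f \<in> invariants. \<exists>j\<le>n. opp (opp f) = fun_scale (of_real (lam j ^ 2)) f}"
  have inv: "invariants = fun_space.span E" unfolding E_def by (rule opp_opp_eigenvectors_span)
  have "Phi a h \<in> fun_space.span (Phi a ` E)" if "h \<in> fun_space.span E" for h
    using that
  proof (induction rule: fun_space.span_induct_alt)
    case base show ?case unfolding zero by (rule fun_space.span_zero)
  next
    case (step c x y)
    have "Phi a x \<in> fun_space.span (Phi a ` E)" using step(1) by (intro fun_space.span_base) blast
    thus ?case unfolding Phi_add Phi_scale
      using step(2) fun_space.span_add fun_space.span_scale by blast
  qed
  moreover have "fun_space.subspace (Phi a ` invariants)"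
  proof (rule fun_space.subspaceI)
    show "0 \<in> Phi a ` invariants"
      using zero fun_space.subspace_0[OF invariants_subspace] by (metis imageI)
    fix x assume "x \<in> Phi a ` invariants"
    then obtain h where h: "h \<in> invariants" "x = Phi a h" by blast
    show "fun_scale c x \<in> Phi a ` invariants" for c
      unfolding h(2) Phi_scale[symmetric] using fun_space.subspace_scale[OF invariants_subspace h(1)] by blast
    fix y assume "y \<in> Phi a ` invariants"
    then obtain k where k: "k \<in> invariants" "y = Phi a k" by blast
    show "x + y \<in> Phi a ` invariants"
      unfolding h(2) k(2) Phi_add[symmetric] using fun_space.subspace_add[OF invariants_subspace h(1) k(1)] by blast
  qed
  moreover have "Phi a ` E \<subseteq> Phi a ` invariants" by (auto simp: E_def)
  ultimately have "Ind n \<chi> = fun_space.span (Phi a ` E)"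
    unfolding Ind using inv fun_space.span_minimal by (metis image_subsetI subset_antisym)
  thus "diagonalizable_on (Ind n \<chi>) ?T"
  proof (rule diagonalizable_onI)
    fix f assume "f \<in> Phi a ` E"
    then obtain h j where h: "h \<in> invariants" "opp (opp h) = fun_scale (of_real (lam j ^ 2)) h" "f = Phi a h"
      by (auto simp: E_def)
    show "\<exists>c. ?T f = fun_scale c f" unfolding h(3) T[OF h(1)] h(2) Phi_scale by blast
  qed
  show "eigenvalues_on (Ind n \<chi>) ?T = {of_real (lam k ^ 2) | k. k \<le> n}"
  proof (intro equalityI subsetI)
    fix c assume "c \<in> eigenvalues_on (Ind n \<chi>) ?T"
    then obtain h where h: "h \<in> invariants" "Phi a h \<noteq> 0" "?T (Phi a h) = fun_scale c (Phi a h)"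
      unfolding eigenvalues_on_def Ind by blast
    let ?d = "opp (opp h) - fun_scale c h"
    have "opp (opp h) \<in> invariants" using h(1) opp_closed unfolding invariants_eq_Filt by blast
    hence d: "?d \<in> invariants"
      using fun_space.subspace_diff[OF invariants_subspace] fun_space.subspace_scale[OF invariants_subspace h(1)] by blast
    have "Phi a ?d + Phi a (fun_scale c h) = Phi a (opp (opp h))"
      unfolding Phi_add[symmetric] by simp
    also have "\<dots> = Phi a (fun_scale c h)" using h(3) unfolding T[OF h(1)] Phi_scale .
    finally have "Phi a ?d = 0" by simp
    hence "?d = 0" by (rule Phi_inject[OF a d])
    hence "opp (opp h) = fun_scale c h" by simp
    moreover have "h \<noteq> 0" using h(2) zero by auto
    ultimately show "c \<in> {of_real (lam k ^ 2) | k. k \<le> n}" using opp_opp_eigenvalues[of c] h(1) by blast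
  next
    fix c :: complex assume "c \<in> {of_real (lam k ^ 2) | k. k \<le> n}"
    then obtain h where h: "h \<in> invariants" "h \<noteq> 0" "opp (opp h) = fun_scale c h"
      using opp_opp_eigenvalues[of c] by blast
    have "?T (Phi a h) = fun_scale c (Phi a h)" unfolding T[OF h(1)] h(3) Phi_scale ..
    moreover have "Phi a h \<noteq> 0" using Phi_inject[OF a h(1)] h(2) by blast
    ultimately show "c \<in> eigenvalues_on (Ind n \<chi>) ?T" unfolding eigenvalues_on_def Ind using h(1) by blast
  qed
qed

end

section \<open>The eigenvalues\<close>

lemma twice_choose_two: "2 * (a choose 2) + a = a * a" for a :: nat
proof (induction a)
  case (Suc a)
  thus ?case unfolding choose_two_Suc by simp
qed (simp add: numeral_2_eq_2)

lemma even_exponent: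
  assumes "i \<le> m"
  shows "2 * (((m - i) choose 2) + ((m + i) choose 2)) = 2 * m * (m - 1) + 2 * i ^ (2::nat)"
proof -
  obtain j where m: "m = i + j" using assms le_Suc_ex by blast
  have "m * (m - 1) + m = m * m" by (cases m) simp_all
  hence 1: "m * (m - 1) + (i + j) = i * i + 2 * (i * j) + j * j"
    unfolding m by (simp add: algebra_simps)
  have "2 * ((i + i + j) choose 2) + (i + i + j) = 4 * (i * i) + 4 * (i * j) + j * j"
    using twice_choose_two[of "i + i + j"] by (simp add: algebra_simps)
  moreover have "2 * (j choose 2) + j = j * j" by (rule twice_choose_two)
  moreover have "m - i = j" "m + i = i + i + j" using m by auto
  moreover have "2 * m * (m - 1) + 2 * i ^ (2::nat) = 2 * (m * (m - 1)) + 2 * (i * i)"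
    unfolding power2_eq_square mult.assoc ..
  moreover have "2 * (x + y) = 2 * w + 2 * a" if "2 * y + (i + i + j) = 4 * a + 4 * b + c"
    "2 * x + j = c" "w + (i + j) = a + 2 * b + c" for x y w a b c :: nat
    using that by presburger
  ultimately show ?thesis using 1 by metis
qed

lemma odd_exponent:
  assumes "i \<le> m"
  shows "2 * (((m - i) choose 2) + ((m + 1 + i) choose 2)) = 2 * m ^ (2::nat) + 2 * i * (i + 1)"
proof -
  obtain j where m: "m = i + j" using assms le_Suc_ex by blast
  have "2 * ((i + i + j + 1) choose 2) + (i + i + j + 1) = 4 * (i * i) + 4 * (i * j) + j * j + 4 * i + 2 * j + 1"
    using twice_choose_two[of "i + i + j + 1"] by (simp add: algebra_simps)
  moreover have "2 * (j choose 2) + j = j * j" by (rule twice_choose_two)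
  moreover have "m - i = j" "m + 1 + i = i + i + j + 1" using m by auto
  moreover have "m * m = i * i + 2 * (i * j) + j * j" unfolding m by (simp add: algebra_simps)
  ultimately show ?thesis by (simp add: power2_eq_square algebra_simps)
qed

lemma (in hyperbolic_space) lam_square:
  "complex_of_real (lam k ^ 2) = of_nat CARD('k) ^ (2 * ((k choose 2) + ((n - k) choose 2)))"
proof -
  have "lam k ^ 2 = ((-1) ^ k) ^ 2 * (real CARD('k) ^ ((k choose 2) + ((n - k) choose 2))) ^ 2"
    unfolding lam_def by (rule power_mult_distrib)
  also have "((-1 :: real) ^ k) ^ 2 = 1" by (simp add: power_mult[symmetric] mult.commute[of k])
  finally show ?thesis by (simp add: power_mult[symmetric] mult.commute)
qed

theorem theorem4p4p2:
  fixes n :: nat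
    and \<chi> :: "'k::{field,finite} mat \<Rightarrow> complex"
    and \<alpha> \<beta> :: "'k \<Rightarrow> complex"
  assumes "odd (CARD('k))" and "\<not> 3 dvd CARD('k)" and "n \<ge> 1"
    and "\<chi> \<in> hom ((GO n)\<lparr>carrier := parabolic n\<rparr>) mult_grp"
    and "\<alpha> \<in> mult_characters" and "\<beta> \<in> mult_characters"
    and "\<forall>p \<in> parabolic n. \<chi> p = \<alpha> (sim_m n p) * \<beta> (chi_det n p)"
    and "\<forall>x. x \<noteq> 0 \<longrightarrow> \<beta> x ^ 2 = 1" and "\<exists>x. x \<noteq> 0 \<and> \<beta> x \<noteq> 1"
  shows "(\<forall>m. n = 2 * m \<longrightarrow>
            diagonalizable_on (Ind n \<chi>) (intertwiner_sq n \<chi>) \<and>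
            eigenvalues_on (Ind n \<chi>) (intertwiner_sq n \<chi>) =
              {of_nat CARD('k) ^ (2 * m * (m - 1) + 2 * i ^ 2) | i. i \<le> m})
       \<and> (\<forall>m. n = 2 * m + 1 \<longrightarrow>
            diagonalizable_on (Ind n \<chi>) (intertwiner_sq n \<chi>) \<and>
            eigenvalues_on (Ind n \<chi>) (intertwiner_sq n \<chi>) =
              {of_nat CARD('k) ^ (2 * m ^ 2 + 2 * i * (i + 1)) | i. i \<le> m})"
proof -
  interpret siegel_series n "TYPE('k)" \<beta>
    using assms by unfold_locales
  have \<chi>: "siegel \<alpha> \<chi>" using assms(7) by (simp add: siegel_def)
  have \<alpha>: "mult_fun \<alpha>" using mult_grp_hom[OF assms(5)] by (simp add: mult_fun_def)
  note spec = intertwiner_sq_spectrum[OF \<chi> \<alpha>]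
  let ?ev = "eigenvalues_on (Ind n \<chi>) (intertwiner_sq n \<chi>)"
  \<comment> \<open>For \<open>m = n div 2\<close> the indices \<open>k \<le> m\<close> represent all \<open>k \<le> n\<close> up to \<open>k \<mapsto> n - k\<close>, and
    \<open>i = m - k\<close>.\<close>
  have ev: "?ev = {of_nat CARD('k) ^ e i | i. i \<le> m}"
    if e: "\<And>i. i \<le> m \<Longrightarrow> 2 * (((m - i) choose 2) + ((n - (m - i)) choose 2)) = e i"
      and range: "2 * m \<le> n" "n \<le> 2 * m + 1" for e m
  proof -
    have small: "complex_of_real (lam (m - i) ^ 2) = of_nat CARD('k) ^ e i" if "i \<le> m" for i
      unfolding lam_square e[OF that] ..
    have sym: "complex_of_real (lam k ^ 2) = of_real (lam (n - k) ^ 2)" if "k \<le> n" for k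
      unfolding lam_square diff_diff_cancel[OF that] by (simp only: add.commute)
    show ?thesis
      unfolding spec(2)
    proof (intro equalityI subsetI)
      fix c :: complex assume "c \<in> {of_real (lam k ^ 2) | k. k \<le> n}"
      then obtain k where k: "k \<le> n" "c = of_real (lam k ^ 2)" by blast
      show "c \<in> {of_nat CARD('k) ^ e i | i. i \<le> m}"
      proof (cases "k \<le> m")
        case True
        hence "c = of_nat CARD('k) ^ e (m - k)" using small[of "m - k"] k by simp
        thus ?thesis by (intro CollectI exI[of _ "m - k"]) simp
      next
        case False
        hence le: "n - k \<le> m" using range by simp
        have "c = of_real (lam (n - k) ^ 2)" unfolding k(2) by (rule sym[OF k(1)])
        also have "\<dots> = of_nat CARD('k) ^ e (m - (n - k))" using small[of "m - (n - k)"] le by simp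
        finally show ?thesis by (intro CollectI exI[of _ "m - (n - k)"]) simp
      qed
    next
      fix c :: complex assume "c \<in> {of_nat CARD('k) ^ e i | i. i \<le> m}"
      then obtain i where i: "i \<le> m" "c = of_nat CARD('k) ^ e i" by blast
      have "m - i \<le> n" using range by simp
      thus "c \<in> {of_real (lam k ^ 2) | k. k \<le> n}" using small[OF i(1)] i(2) by (intro CollectI exI[of _ "m - i"]) simp
    qed
  qed
  have "?ev = {of_nat CARD('k) ^ (2 * m * (m - 1) + 2 * i ^ 2) | i. i \<le> m}" if n: "n = 2 * m" for m
  proof (rule ev)
    fix i assume i: "i \<le> m"
    have "n - (m - i) = m + i" using n i by simp
    thus "2 * (((m - i) choose 2) + ((n - (m - i)) choose 2)) = 2 * m * (m - 1) + 2 * i ^ 2"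
      using even_exponent[OF i] by simp
  qed (use n in auto)
  moreover have "?ev = {of_nat CARD('k) ^ (2 * m ^ 2 + 2 * i * (i + 1)) | i. i \<le> m}" if n: "n = 2 * m + 1" for m
  proof (rule ev)
    fix i assume i: "i \<le> m"
    have "n - (m - i) = m + 1 + i" using n i by simp
    thus "2 * (((m - i) choose 2) + ((n - (m - i)) choose 2)) = 2 * m ^ 2 + 2 * i * (i + 1)"
      using odd_exponent[OF i] by simp
  qed (use n in auto)
  ultimately show ?thesis using spec(1) by blast
qed

end
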